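(* Let $k\ge1$ be an integer, $0<\epsilon<1$, $F:=\epsilon^{2/k}$, and let $I(t)=\langle z_1^k-\epsilon e^{it}\rangle\subseteq\mathbb{C}[z_1,z_2]$. Let $U:=U_{2\pi}:I(0)^\perp\to I(2\pi)^\perp=I(0)^\perp$ be the monodromy operator of the connection $D$, let $T_1,T_2$ be the compressions to $I(0)^\perp$ of multiplication by $z_1,z_2$, and let $\mathfrak{T}_{I(0)}$ be the Toeplitz algebra (all defined in the context). Then the unitary operator $U$ acts by conjugation on $\mathfrak{T}_{I(0)}$ in the sense that $U^*\mathfrak{T}_{I(0)}U\subseteq\mathfrak{T}_{I(0)}$. In more detail, the operators $$U^*T_1U-e^{i\frac{2\pi}{k}}T_1,\quad U^*T_1^*U-e^{-i\frac{2\pi}{k}}T_1^*,\quad U^*T_2U-e^{-i\frac{2\pi F}{k(1-F)}}T_2,\quad U^*T_2^*U-e^{i\frac{2\pi F}{k(1-F)}}T_2^*$$ are all compact.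
   Context: $H^2_2$ is the Drury-Arveson space on the unit ball $\mathbb{B}^2\subset\mathbb{C}^2$: the Hilbert space of analytic functions in which distinct monomials are orthogonal and $\|z_1^mz_2^n\|^2=\binom{m+n}{m}^{-1}$. $I(t)^\perp$ is the orthogonal complement of the principal ideal $I(t)$ in $H^2_2$, and $P_t$ is the orthogonal projection of $H^2_2$ onto $I(t)^\perp$. $T_j:=P_0M_{z_j}|_{I(0)^\perp}$, $j=1,2$, where $M_{z_j}$ is multiplication by $z_j$ on $H^2_2$. $\mathfrak{T}_{I(0)}$ is the $C^*$-algebra of operators on $I(0)^\perp$ generated by $\{1,T_1,T_2\}$ together with all compact operators on $I(0)^\perp$. A smooth section is a smooth function $\xi:\mathbb{R}\to H^2_2$ with $\xi(t)\in I(t)^\perp$ for all $t$; the connection is $D\xi(t)=P_t\big(\frac{d\xi}{dt}(t)\big)$, and $\xi$ is $D$-flat if $D\xi(t)=0$ for all $t$. The parallel transport $U_t:I(0)^\perp\to I(t)^\perp$ is the linear (unitary) operator sending the initial value $\xi(0)$ of a $D$-flat section $\xi$ to $\xi(t)$, extended by continuity from such initial values to all of $I(0)^\perp$. *)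

theory Defs
  imports "HOL-Complex_Analysis.Complex_Analysis"
begin

definition monomial_norm2 :: "nat \<times> nat \<Rightarrow> real" where
  "monomial_norm2 = (\<lambda>(m, n). 1 / real ((m + n) choose m))"

definition da_coeffs :: "(nat \<times> nat \<Rightarrow> complex) set" where
  "da_coeffs = {a. (\<lambda>p. (cmod (a p))\<^sup>2 * monomial_norm2 p) summable_on UNIV}"

text \<open>
  Functions on the ball are represented by total functions vanishing outside the open Euclidean
  unit ball \<^term>\<open>ball 0 1\<close> of \<^typ>\<open>complex \<times> complex\<close>.
\<close>

definition power_series2 :: "(nat \<times> nat \<Rightarrow> complex) \<Rightarrow> complex \<times> complex \<Rightarrow> complex" where
  "power_series2 a = (\<lambda>z. if z \<in> ball 0 1
     then \<Sum>\<^sub>\<infinity>p. a p * fst z ^ fst p * snd z ^ snd p else 0)"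

lemma monomial_norm2_pos: "0 < monomial_norm2 p"
  by (cases p) (simp add: monomial_norm2_def zero_less_binomial)

lemma ball_pair_iff: "z \<in> ball 0 1 \<longleftrightarrow> (cmod (fst z))\<^sup>2 + (cmod (snd z))\<^sup>2 < 1"
  by (cases z) (simp add: norm_Pair)

lemma summable_inverse_weight:
  fixes x y :: real
  assumes "0 \<le> x" "0 \<le> y" "x + y < 1"
  shows "(\<lambda>p. x ^ fst p * y ^ snd p / monomial_norm2 p) summable_on UNIV"
proof (rule nonneg_bdd_above_summable_on)
  fix p show "0 \<le> x ^ fst p * y ^ snd p / monomial_norm2 p"
    using assms monomial_norm2_pos[of p] by auto
next
  let ?f = "\<lambda>p. x ^ fst p * y ^ snd p / monomial_norm2 p"
  have nn: "0 \<le> ?f p" for p using assms monomial_norm2_pos[of p] by auto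
  have "sum ?f F \<le> 1 / (1 - (x + y))" if "finite F" for F
  proof -
    define N where "N = Max (insert 0 ((\<lambda>p. fst p + snd p) ` F))"
    have N: "fst p + snd p \<le> N" if "p \<in> F" for p
      unfolding N_def using \<open>finite F\<close> that by (intro Max_ge) auto
    let ?T = "Sigma {..N} (\<lambda>d. {..d})"
    have "sum ?f F = sum (?f \<circ> (\<lambda>(d, m). (m, d - m))) ((\<lambda>p. (fst p + snd p, fst p)) ` F)"
      by (subst sum.reindex) (auto intro!: inj_onI sum.cong simp: prod_eq_iff)
    also have "\<dots> \<le> sum (?f \<circ> (\<lambda>(d, m). (m, d - m))) ?T"
      using N nn \<open>finite F\<close> by (intro sum_mono2) auto
    also have "\<dots> = (\<Sum>d\<le>N. \<Sum>m\<le>d. ?f (m, d - m))"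
      by (subst sum.Sigma) (auto intro!: sum.cong)
    also have "\<dots> = (\<Sum>d\<le>N. (x + y) ^ d)"
      by (intro sum.cong refl) (auto simp: binomial_ring monomial_norm2_def mult_ac intro!: sum.cong)
    also have "\<dots> \<le> (\<Sum>d. (x + y) ^ d)"
      using assms by (intro sum_le_suminf) (auto intro!: summable_geometric)
    also have "\<dots> = 1 / (1 - (x + y))"
      using assms by (intro suminf_geometric) auto
    finally show ?thesis .
  qed
  then show "bdd_above (sum ?f ` {F. F \<subseteq> UNIV \<and> finite F})"
    by (intro bdd_aboveI2) auto
qed

lemma power_series2_abs_summable:
  assumes "a \<in> da_coeffs" "z \<in> ball 0 1"
  shows "(\<lambda>p. norm (a p * fst z ^ fst p * snd z ^ snd p)) summable_on UNIV"
proof -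
  let ?x = "(cmod (fst z))\<^sup>2" and ?y = "(cmod (snd z))\<^sup>2"
  let ?g = "\<lambda>p. (cmod (a p))\<^sup>2 * monomial_norm2 p + ?x ^ fst p * ?y ^ snd p / monomial_norm2 p"
  have g: "?g summable_on UNIV"
    using assms(1) assms(2)[unfolded ball_pair_iff]
    by (intro summable_on_add summable_inverse_weight) (auto simp: da_coeffs_def)
  have "norm (a p * fst z ^ fst p * snd z ^ snd p) \<le> ?g p" for p
  proof -
    define w where "w = sqrt (monomial_norm2 p)"
    have w: "w > 0" "monomial_norm2 p = w\<^sup>2" using monomial_norm2_pos[of p] by (auto simp: w_def)
    define u where "u = cmod (fst z) ^ fst p * cmod (snd z) ^ snd p"
    have u: "u\<^sup>2 = ?x ^ fst p * ?y ^ snd p"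
      by (simp add: u_def power_mult_distrib power_mult[symmetric] mult.commute)
    have "0 \<le> (cmod (a p) * w - u / w)\<^sup>2" by simp
    also have "\<dots> = (cmod (a p) * w)\<^sup>2 + (u / w)\<^sup>2 - 2 * (cmod (a p) * u)"
      using w by (simp add: power2_diff)
    finally have "2 * (cmod (a p) * u) \<le> (cmod (a p) * w)\<^sup>2 + (u / w)\<^sup>2" by simp
    moreover have "0 \<le> cmod (a p) * u" by (simp add: u_def)
    ultimately have "cmod (a p) * u \<le> (cmod (a p) * w)\<^sup>2 + (u / w)\<^sup>2" by linarith
    also have "\<dots> = ?g p" by (simp add: w u power_mult_distrib power_divide)
    finally show ?thesis by (simp add: u_def norm_mult norm_power mult_ac)
  qed
  then show ?thesis
    by (intro summable_on_comparison_test[OF g]) auto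
qed

lemma power_series2_summable:
  assumes "a \<in> da_coeffs" "z \<in> ball 0 1"
  shows "(\<lambda>p. a p * fst z ^ fst p * snd z ^ snd p) summable_on UNIV"
  using power_series2_abs_summable[OF assms] by (rule abs_summable_summable)

lemma powser_zero_imp:
  fixes c :: "nat \<Rightarrow> complex"
  assumes "\<And>z. cmod z < r \<Longrightarrow> (\<lambda>n. c n * z ^ n) sums 0" and r: "0 < r"
  shows "c n = 0"
proof (rule ccontr)
  assume n: "c n \<noteq> 0"
  have s: "\<And>z. norm (z - 0) < r \<Longrightarrow> (\<lambda>n. c n * (z - 0) ^ n) sums (\<lambda>_. 0) z"
    using assms by simp
  obtain q where q: "0 < q" "\<And>z. z \<in> cball 0 q - {0} \<Longrightarrow> (\<lambda>_::complex. 0::complex) z \<noteq> 0"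
  proof (cases "n = 0")
    case True
    have "c 0 = 0" using assms(1)[of 0] r by simp
    then show ?thesis using True n by simp
  next
    case False
    then show ?thesis
      using powser_0_nonzero[of r 0 c "\<lambda>_. 0" n, OF r s _ n] that by auto
  qed
  then show False using q(2)[of "of_real q"] by auto
qed

lemma da_coeffs_lin:
  assumes "a \<in> da_coeffs" "b \<in> da_coeffs"
  shows "(\<lambda>p. a p + c * b p) \<in> da_coeffs"
proof -
  have "(\<lambda>p. 2 * ((cmod (a p))\<^sup>2 * monomial_norm2 p)
      + (2 * (cmod c)\<^sup>2) * ((cmod (b p))\<^sup>2 * monomial_norm2 p)) summable_on UNIV"
    using assms by (intro summable_on_add summable_on_cmult_right) (auto simp: da_coeffs_def)
  then have "(\<lambda>p. (cmod (a p + c * b p))\<^sup>2 * monomial_norm2 p) summable_on UNIV"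
  proof (rule summable_on_comparison_test)
    fix p
    have "(cmod (a p + c * b p))\<^sup>2 \<le> (cmod (a p) + cmod (c * b p))\<^sup>2"
      by (intro power_mono norm_triangle_ineq) auto
    also have "\<dots> \<le> 2 * (cmod (a p))\<^sup>2 + 2 * (cmod (c * b p))\<^sup>2"
      using zero_le_power2[of "cmod (a p) - cmod (c * b p)"]
      by (simp add: power2_sum power2_diff)
    finally have "(cmod (a p + c * b p))\<^sup>2 \<le> 2 * (cmod (a p))\<^sup>2 + 2 * (cmod c)\<^sup>2 * (cmod (b p))\<^sup>2"
      by (simp add: norm_mult power_mult_distrib)
    from mult_right_mono[OF this, of "monomial_norm2 p"]
    show "(cmod (a p + c * b p))\<^sup>2 * monomial_norm2 p
      \<le> 2 * ((cmod (a p))\<^sup>2 * monomial_norm2 p) + (2 * (cmod c)\<^sup>2) * ((cmod (b p))\<^sup>2 * monomial_norm2 p)"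
      using monomial_norm2_pos[of p] by (simp add: algebra_simps)
    show "0 \<le> (cmod (a p + c * b p))\<^sup>2 * monomial_norm2 p"
      using monomial_norm2_pos[of p] by simp
  qed
  then show ?thesis by (simp add: da_coeffs_def)
qed

lemma da_coeffs_zero: "(\<lambda>_. 0) \<in> da_coeffs"
  by (simp add: da_coeffs_def)

lemma power_series2_lin:
  assumes "a \<in> da_coeffs" "b \<in> da_coeffs"
  shows "power_series2 (\<lambda>p. a p + c * b p) z = power_series2 a z + c * power_series2 b z"
proof (cases "z \<in> ball 0 1")
  case True
  have "(\<Sum>\<^sub>\<infinity>p. (a p + c * b p) * fst z ^ fst p * snd z ^ snd p)
     = (\<Sum>\<^sub>\<infinity>p. a p * fst z ^ fst p * snd z ^ snd p + c * (b p * fst z ^ fst p * snd z ^ snd p))"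
    by (simp add: algebra_simps)
  also have "\<dots> = (\<Sum>\<^sub>\<infinity>p. a p * fst z ^ fst p * snd z ^ snd p)
     + (\<Sum>\<^sub>\<infinity>p. c * (b p * fst z ^ fst p * snd z ^ snd p))"
    using assms True
    by (intro infsum_add summable_on_cmult_right power_series2_summable)
  also have "(\<Sum>\<^sub>\<infinity>p. c * (b p * fst z ^ fst p * snd z ^ snd p))
     = c * (\<Sum>\<^sub>\<infinity>p. b p * fst z ^ fst p * snd z ^ snd p)"
    by (rule infsum_cmult_right')
  finally show ?thesis using True by (simp add: power_series2_def)
qed (simp add: power_series2_def)

lemma power_series2_zero: "power_series2 (\<lambda>_. 0) z = 0"
  by (simp add: power_series2_def)

lemma power_series2_eq_0:
  assumes c: "c \<in> da_coeffs" and 0: "power_series2 c = (\<lambda>_. 0)"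
  shows "c = (\<lambda>_. 0)"
proof -
  have inball: "(z, w) \<in> ball 0 1" if "cmod z < 1/2" "cmod w < 1/2" for z w
  proof -
    have "(cmod z)\<^sup>2 \<le> (1/2)\<^sup>2" "(cmod w)\<^sup>2 \<le> (1/2)\<^sup>2"
      using that by (intro power_mono; simp)+
    then show ?thesis unfolding ball_pair_iff by (simp add: power2_eq_square)
  qed
  have sm: "(\<lambda>(m, n). c (m, n) * z ^ m * w ^ n) summable_on UNIV \<times> UNIV"
    if "cmod z < 1/2" "cmod w < 1/2" for z w
    using power_series2_summable[OF c inball[OF that]] by (simp add: case_prod_unfold)
  have smn: "(\<lambda>n. c (m, n) * z ^ m * w ^ n) summable_on UNIV"
    if "cmod z < 1/2" "cmod w < 1/2" for z w m
    using summable_on_SigmaD1[OF sm[OF that], of m] by simp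
  have smn': "(\<lambda>n. c (m, n) * w ^ n) summable_on UNIV" if "cmod w < 1/2" for w m
  proof -
    have "(\<lambda>n. (c (m, n) * (1/4) ^ m * w ^ n) * 4 ^ m) summable_on UNIV"
      using that by (intro summable_on_cmult_left smn) auto
    then show ?thesis by (simp add: power_divide)
  qed
  have row: "(\<Sum>\<^sub>\<infinity>n. c (m, n) * w ^ n) = 0" if w: "cmod w < 1/2" for w m
  proof (rule powser_zero_imp[of "1/2"])
    fix z :: complex assume z: "cmod z < 1/2"
    have eq: "(\<Sum>\<^sub>\<infinity>n. c (m, n) * w ^ n) * z ^ m = (\<Sum>\<^sub>\<infinity>n. c (m, n) * z ^ m * w ^ n)" for m
      by (subst infsum_cmult_left'[symmetric]) (simp add: mult_ac)
    have "(\<Sum>\<^sub>\<infinity>m. \<Sum>\<^sub>\<infinity>n. c (m, n) * z ^ m * w ^ n)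
        = (\<Sum>\<^sub>\<infinity>(m, n)\<in>UNIV \<times> UNIV. c (m, n) * z ^ m * w ^ n)"
      using sm[OF z w] by (rule infsum_Sigma'_banach)
    also have "\<dots> = 0"
      using fun_cong[OF 0, of "(z, w)"] inball[OF z w]
      by (simp add: power_series2_def case_prod_unfold)
    finally have "((\<lambda>m. \<Sum>\<^sub>\<infinity>n. c (m, n) * z ^ m * w ^ n) has_sum 0) UNIV"
      using has_sum_infsum[OF summable_on_Sigma_banach[OF sm[OF z w]]] by simp
    then show "(\<lambda>m. (\<Sum>\<^sub>\<infinity>n. c (m, n) * w ^ n) * z ^ m) sums 0"
      unfolding eq by (rule has_sum_imp_sums)
  qed simp
  have "c (m, n) = 0" for m n
  proof (rule powser_zero_imp[of "1/2"])
    fix w :: complex assume w: "cmod w < 1/2"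
    show "(\<lambda>n. c (m, n) * w ^ n) sums 0"
      using has_sum_imp_sums[OF has_sum_infsum[OF smn'[OF w, of m]]] row[OF w, of m] by simp
  qed simp
  then show ?thesis by auto
qed

lemma power_series2_inj: "inj_on power_series2 da_coeffs"
proof (rule inj_onI)
  fix a b assume ab: "a \<in> da_coeffs" "b \<in> da_coeffs" "power_series2 a = power_series2 b"
  have "power_series2 (\<lambda>p. a p + (-1) * b p) = (\<lambda>_. 0)"
    by (rule ext, subst power_series2_lin) (use ab in auto)
  with da_coeffs_lin[OF ab(1,2)] have "(\<lambda>p. a p + (-1) * b p) = (\<lambda>_. 0)"
    by (rule power_series2_eq_0)
  then show "a = b" by (auto simp: fun_eq_iff)
qed

text \<open>
  \<open>da\<close> is \<open>H\<^sup>2\<^sub>2\<close>. By uniqueness of Taylor coefficients (\<open>power_series2_inj\<close>) its inner product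
  can be defined through \<open>coeffs2\<close> below. The library has no class of complex inner product spaces;
  \<open>da\<close> is an instance of \<^class>\<open>real_inner\<close> with the real part of the complex inner product, which
  induces the same norm, and complex scalar multiplication and the complex inner product (linear
  in the first argument) are the separate constants \<open>cscale\<close> and \<open>cinner\<close>.
\<close>

typedef da = "power_series2 ` da_coeffs"
  morphisms da_fun Abs_da
  using da_coeffs_zero by blast

setup_lifting type_definition_da

definition coeffs2 :: "da \<Rightarrow> nat \<times> nat \<Rightarrow> complex" where
  "coeffs2 f = the_inv_into da_coeffs power_series2 (da_fun f)"

lemma coeffs2_in: "coeffs2 f \<in> da_coeffs"
  unfolding coeffs2_def using da_fun[of f] by (intro the_inv_into_into[OF power_series2_inj]) auto

lemma da_fun_coeffs2: "da_fun f = power_series2 (coeffs2 f)"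
  unfolding coeffs2_def using da_fun[of f] by (simp add: f_the_inv_into_f[OF power_series2_inj])

lemma coeffs2_eqI: "a \<in> da_coeffs \<Longrightarrow> da_fun f = power_series2 a \<Longrightarrow> coeffs2 f = a"
  by (rule inj_onD[OF power_series2_inj _ coeffs2_in]) (simp_all add: da_fun_coeffs2)

lemma da_lin_closed:
  "f \<in> power_series2 ` da_coeffs \<Longrightarrow> g \<in> power_series2 ` da_coeffs
    \<Longrightarrow> (\<lambda>z. f z + c * g z) \<in> power_series2 ` da_coeffs"
proof (elim imageE)
  fix a b assume "a \<in> da_coeffs" "f = power_series2 a" "b \<in> da_coeffs" "g = power_series2 b"
  then show ?thesis
    by (intro image_eqI[of _ _ "\<lambda>p. a p + c * b p"])
      (simp_all add: power_series2_lin da_coeffs_lin fun_eq_iff)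
qed

lemma da_zero_closed: "(\<lambda>_. 0) \<in> power_series2 ` da_coeffs"
  using da_coeffs_zero by (intro image_eqI[of _ _ "\<lambda>_. 0"]) (auto simp: power_series2_def)

lift_definition cscale :: "complex \<Rightarrow> da \<Rightarrow> da" is "\<lambda>c f z. c * f z"
  using da_lin_closed[OF da_zero_closed] by simp

definition cinner :: "da \<Rightarrow> da \<Rightarrow> complex" where
  "cinner f g = (\<Sum>\<^sub>\<infinity>p. coeffs2 f p * cnj (coeffs2 g p) * of_real (monomial_norm2 p))"

instantiation da :: real_inner
begin

lift_definition zero_da :: da is "\<lambda>_. 0" by (rule da_zero_closed)
lift_definition plus_da :: "da \<Rightarrow> da \<Rightarrow> da" is "\<lambda>f g z. f z + g z"
  using da_lin_closed[where c = 1] by simp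
lift_definition minus_da :: "da \<Rightarrow> da \<Rightarrow> da" is "\<lambda>f g z. f z - g z"
  using da_lin_closed[where c = "-1"] by simp
lift_definition uminus_da :: "da \<Rightarrow> da" is "\<lambda>f z. - f z"
  using da_lin_closed[OF da_zero_closed, where c = "-1"] by simp
definition scaleR_da :: "real \<Rightarrow> da \<Rightarrow> da" where
  "scaleR_da r f = cscale (of_real r) f"
definition inner_da :: "da \<Rightarrow> da \<Rightarrow> real" where
  "inner_da f g = Re (cinner f g)"
definition norm_da :: "da \<Rightarrow> real" where
  "norm_da f = sqrt (inner f f)"
definition sgn_da :: "da \<Rightarrow> da" where
  "sgn_da f = inverse (norm f) *\<^sub>R f"
definition dist_da :: "da \<Rightarrow> da \<Rightarrow> real" where
  "dist_da f g = norm (f - g)"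
definition uniformity_da :: "(da \<times> da) filter" where
  "uniformity_da = (INF e\<in>{0<..}. principal {(x, y). dist x y < e})"
definition open_da :: "da set \<Rightarrow> bool" where
  "open_da U = (\<forall>x\<in>U. \<forall>\<^sub>F (x', y) in uniformity. x' = x \<longrightarrow> y \<in> U)"

lemma coeffs2_add: "coeffs2 (f + g) = (\<lambda>p. coeffs2 f p + coeffs2 g p)"
proof (rule coeffs2_eqI)
  show "(\<lambda>p. coeffs2 f p + coeffs2 g p) \<in> da_coeffs"
    using da_coeffs_lin[OF coeffs2_in coeffs2_in, of f 1 g] by simp
  show "da_fun (f + g) = power_series2 (\<lambda>p. coeffs2 f p + coeffs2 g p)"
    using power_series2_lin[OF coeffs2_in coeffs2_in, of f 1 g]
    unfolding plus_da.rep_eq da_fun_coeffs2[of f] da_fun_coeffs2[of g] by (intro ext) simp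
qed

lemma coeffs2_cscale: "coeffs2 (cscale c f) = (\<lambda>p. c * coeffs2 f p)"
proof (rule coeffs2_eqI)
  show "(\<lambda>p. c * coeffs2 f p) \<in> da_coeffs"
    using da_coeffs_lin[OF da_coeffs_zero coeffs2_in, of c f] by simp
  show "da_fun (cscale c f) = power_series2 (\<lambda>p. c * coeffs2 f p)"
    using power_series2_lin[OF da_coeffs_zero coeffs2_in, of c f]
    unfolding cscale.rep_eq da_fun_coeffs2[of f]
    by (intro ext) (simp add: power_series2_zero)
qed

lemma cinner_summable:
  "(\<lambda>p. coeffs2 f p * cnj (coeffs2 g p) * of_real (monomial_norm2 p)) summable_on UNIV"
proof (rule abs_summable_summable)
  have "(\<lambda>p. (cmod (coeffs2 f p))\<^sup>2 * monomial_norm2 p + (cmod (coeffs2 g p))\<^sup>2 * monomial_norm2 p)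
    summable_on UNIV"
    using coeffs2_in by (intro summable_on_add) (auto simp: da_coeffs_def)
  then show "(\<lambda>p. norm (coeffs2 f p * cnj (coeffs2 g p) * of_real (monomial_norm2 p))) summable_on UNIV"
  proof (rule summable_on_comparison_test)
    fix p
    have "cmod (coeffs2 f p) * cmod (coeffs2 g p) \<le> (cmod (coeffs2 f p))\<^sup>2 + (cmod (coeffs2 g p))\<^sup>2"
      using zero_le_power2[of "cmod (coeffs2 f p) - cmod (coeffs2 g p)"]
        mult_nonneg_nonneg[OF norm_ge_zero norm_ge_zero, of "coeffs2 f p" "coeffs2 g p"]
      unfolding power2_diff by linarith
    from mult_right_mono[OF this, of "monomial_norm2 p"]
    show "norm (coeffs2 f p * cnj (coeffs2 g p) * of_real (monomial_norm2 p))
      \<le> (cmod (coeffs2 f p))\<^sup>2 * monomial_norm2 p + (cmod (coeffs2 g p))\<^sup>2 * monomial_norm2 p"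
      using monomial_norm2_pos[of p] by (simp add: norm_mult algebra_simps)
  qed auto
qed

lemma cinner_add_left: "cinner (f + g) h = cinner f h + cinner g h"
  unfolding cinner_def coeffs2_add
  by (subst infsum_add[OF cinner_summable cinner_summable, symmetric]) (simp add: distrib_right)

lemma cinner_cscale_left: "cinner (cscale c f) g = c * cinner f g"
  unfolding cinner_def coeffs2_cscale
  by (subst infsum_cmult_right'[symmetric]) (simp add: mult_ac)

lemma cinner_commute: "cinner f g = cnj (cinner g f)"
  unfolding cinner_def by (subst infsum_cnj[symmetric]) (simp add: mult_ac)

lemma cinner_self: "cinner f f = of_real (\<Sum>\<^sub>\<infinity>p. (cmod (coeffs2 f p))\<^sup>2 * monomial_norm2 p)"
proof -
  have "(\<lambda>p. (cmod (coeffs2 f p))\<^sup>2 * monomial_norm2 p) summable_on UNIV"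
    using coeffs2_in[of f] by (simp add: da_coeffs_def)
  then have "((\<lambda>p. complex_of_real ((cmod (coeffs2 f p))\<^sup>2 * monomial_norm2 p)) has_sum
      of_real (\<Sum>\<^sub>\<infinity>p. (cmod (coeffs2 f p))\<^sup>2 * monomial_norm2 p)) UNIV"
    by (intro has_sum_of_real has_sum_infsum)
  then show ?thesis
    unfolding cinner_def complex_norm_square[symmetric] of_real_mult[symmetric]
    by (simp add: infsumI)
qed

lemma da_eq_0_iff: "f = 0 \<longleftrightarrow> coeffs2 f = (\<lambda>_. 0)"
proof
  assume "f = 0" then show "coeffs2 f = (\<lambda>_. 0)"
    by (intro coeffs2_eqI ext) (simp_all add: da_coeffs_zero zero_da.rep_eq power_series2_zero)
next
  assume "coeffs2 f = (\<lambda>_. 0)"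
  then have "da_fun f = da_fun 0"
    unfolding da_fun_coeffs2[of f] zero_da.rep_eq by (intro ext) (simp add: power_series2_zero)
  then show "f = 0" by (simp add: da_fun_inject)
qed

instance
proof
  fix f g h :: da and r s :: real
  show "f + g + h = f + (g + h)" by transfer (simp add: add_ac)
  show "f + g = g + f" by transfer (simp add: add_ac)
  show "0 + f = f" by transfer simp
  show "- f + f = 0" by transfer simp
  show "f - g = f + - g" by transfer simp
  show "r *\<^sub>R (f + g) = r *\<^sub>R f + r *\<^sub>R g"
    unfolding scaleR_da_def by transfer (simp add: algebra_simps)
  show "(r + s) *\<^sub>R f = r *\<^sub>R f + s *\<^sub>R f"
    unfolding scaleR_da_def by transfer (simp add: algebra_simps)
  show "r *\<^sub>R s *\<^sub>R f = (r * s) *\<^sub>R f"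
    unfolding scaleR_da_def by transfer (simp add: algebra_simps)
  show "1 *\<^sub>R f = f" unfolding scaleR_da_def by transfer simp
  show "inner f g = inner g f"
    unfolding inner_da_def using cinner_commute[of f g] by simp
  show "inner (f + g) h = inner f h + inner g h"
    by (simp add: inner_da_def cinner_add_left)
  show "inner (r *\<^sub>R f) g = r * inner f g"
    by (simp add: inner_da_def scaleR_da_def cinner_cscale_left)
  have sm: "(\<lambda>p. (cmod (coeffs2 f p))\<^sup>2 * monomial_norm2 p) summable_on UNIV"
    using coeffs2_in[of f] by (simp add: da_coeffs_def)
  have nn: "0 \<le> (cmod (coeffs2 f p))\<^sup>2 * monomial_norm2 p" for p
    using monomial_norm2_pos[of p] by simp
  show "0 \<le> inner f f"
    unfolding inner_da_def cinner_self using nn by (simp add: infsum_nonneg)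
  show "inner f f = 0 \<longleftrightarrow> f = 0"
  proof
    assume "inner f f = 0"
    then have "(\<Sum>\<^sub>\<infinity>p. (cmod (coeffs2 f p))\<^sup>2 * monomial_norm2 p) = 0"
      by (simp add: inner_da_def cinner_self)
    then have "(cmod (coeffs2 f p))\<^sup>2 * monomial_norm2 p = 0" for p
      using nonneg_infsum_le_0D[OF _ sm nn] by simp
    then have "coeffs2 f p = 0" for p using monomial_norm2_pos[of p] by (metis less_irrefl mult_eq_0_iff norm_eq_zero zero_eq_power2)
    then show "f = 0" by (auto simp: da_eq_0_iff)
  next
    assume "f = 0" then show "inner f f = 0" by (simp add: inner_da_def cinner_self da_eq_0_iff)
  qed
qed (simp_all add: norm_da_def sgn_da_def dist_da_def uniformity_da_def open_da_def)

end

lemma power_series2_embed: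
  assumes a: "a \<in> da_coeffs" and inj: "inj h"
    and w: "\<And>p. monomial_norm2 (h p) \<le> monomial_norm2 p"
    and b: "\<And>p. b (h p) = a p" "\<And>p. p \<notin> range h \<Longrightarrow> b p = 0"
    and e: "\<And>p. fst z ^ fst (h p) * snd z ^ snd (h p) = u * (fst z ^ fst p * snd z ^ snd p)"
  shows "b \<in> da_coeffs" "power_series2 b z = u * power_series2 a z"
proof -
  have "(\<lambda>p. (cmod (a p))\<^sup>2 * monomial_norm2 p) summable_on UNIV"
    using a by (simp add: da_coeffs_def)
  then have "((\<lambda>p. (cmod (b p))\<^sup>2 * monomial_norm2 p) \<circ> h) summable_on UNIV"
    by (rule summable_on_comparison_test)
      (simp_all add: b(1) w mult_left_mono less_imp_le[OF monomial_norm2_pos])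
  then have "(\<lambda>p. (cmod (b p))\<^sup>2 * monomial_norm2 p) summable_on range h"
    by (simp add: summable_on_reindex[OF inj])
  then have "(\<lambda>p. (cmod (b p))\<^sup>2 * monomial_norm2 p) summable_on UNIV"
    by (subst summable_on_cong_neutral[where T = "range h"]) (use b in auto)
  then show "b \<in> da_coeffs" by (simp add: da_coeffs_def)
  have "(\<Sum>\<^sub>\<infinity>p. b p * fst z ^ fst p * snd z ^ snd p)
      = (\<Sum>\<^sub>\<infinity>p\<in>range h. b p * fst z ^ fst p * snd z ^ snd p)"
    by (rule infsum_cong_neutral) (use b in auto)
  also have "\<dots> = (\<Sum>\<^sub>\<infinity>p. u * (a p * fst z ^ fst p * snd z ^ snd p))"
    unfolding infsum_reindex[OF inj] o_def
    using e by (intro infsum_cong) (simp add: b mult_ac)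
  also have "\<dots> = u * (\<Sum>\<^sub>\<infinity>p. a p * fst z ^ fst p * snd z ^ snd p)"
    by (rule infsum_cmult_right')
  finally show "power_series2 b z = u * power_series2 a z" by (simp add: power_series2_def)
qed

lemma monomial_norm2_Suc:
  "monomial_norm2 (Suc m, n) \<le> monomial_norm2 (m, n)"
  "monomial_norm2 (m, Suc n) \<le> monomial_norm2 (m, n)"
proof -
  have "(m + n choose m) \<le> (Suc (m + n) choose Suc m)" by simp
  moreover have "(m + n choose m) \<le> (Suc (m + n) choose m)" by (cases m) auto
  moreover have "0 < (m + n choose m)" by (simp add: zero_less_binomial)
  ultimately show "monomial_norm2 (Suc m, n) \<le> monomial_norm2 (m, n)"
    "monomial_norm2 (m, Suc n) \<le> monomial_norm2 (m, n)"
    unfolding monomial_norm2_def by (auto intro!: frac_le simp del: binomial_Suc_Suc)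
qed

lemma da_mult1_closed:
  assumes "f \<in> power_series2 ` da_coeffs"
  shows "(\<lambda>z. fst z * f z) \<in> power_series2 ` da_coeffs"
proof -
  obtain a where a: "a \<in> da_coeffs" "f = power_series2 a" using assms by blast
  let ?b = "\<lambda>p. if fst p = 0 then 0 else a (fst p - 1, snd p)"
  have "?b \<in> da_coeffs \<and> power_series2 ?b z = fst z * power_series2 a z" for z
    by (intro conjI power_series2_embed[OF a(1), where h = "\<lambda>p. (Suc (fst p), snd p)"])
      (auto intro!: injI simp: prod_eq_iff image_iff monomial_norm2_Suc gr0_conv_Suc)
  then show ?thesis by (intro image_eqI[of _ _ ?b]) (auto simp: a)
qed

lemma da_mult2_closed:
  assumes "f \<in> power_series2 ` da_coeffs"
  shows "(\<lambda>z. snd z * f z) \<in> power_series2 ` da_coeffs"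
proof -
  obtain a where a: "a \<in> da_coeffs" "f = power_series2 a" using assms by blast
  let ?b = "\<lambda>p. if snd p = 0 then 0 else a (fst p, snd p - 1)"
  have "?b \<in> da_coeffs \<and> power_series2 ?b z = snd z * power_series2 a z" for z
    by (intro conjI power_series2_embed[OF a(1), where h = "\<lambda>p. (fst p, Suc (snd p))"])
      (auto intro!: injI simp: prod_eq_iff image_iff monomial_norm2_Suc gr0_conv_Suc)
  then show ?thesis by (intro image_eqI[of _ _ ?b]) (auto simp: a)
qed

lift_definition mult_z1 :: "da \<Rightarrow> da" is "\<lambda>f z. fst z * f z"
  by (rule da_mult1_closed)

lift_definition mult_z2 :: "da \<Rightarrow> da" is "\<lambda>f z. snd z * f z"
  by (rule da_mult2_closed)

text \<open>
  Elements of \<open>\<complex>[z\<^sub>1, z\<^sub>2]\<close> have type \<^typ>\<open>complex poly poly\<close>: the outer variable is \<open>z\<^sub>1\<close>, the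
  inner one \<open>z\<^sub>2\<close>.
\<close>

lemma da_one_closed: "(\<lambda>z. if z \<in> ball 0 1 then 1 else 0) \<in> power_series2 ` da_coeffs"
proof (rule image_eqI)
  let ?d = "\<lambda>p. if p = (0, 0) then 1 else 0 :: complex"
  have "(\<Sum>\<^sub>\<infinity>p. ?d p * fst z ^ fst p * snd z ^ snd p) = 1" for z :: "complex \<times> complex"
    by (subst infsum_cong_neutral[where T = "{(0, 0)}"
          and g = "\<lambda>p. ?d p * fst z ^ fst p * snd z ^ snd p"]) auto
  then show "(\<lambda>z. if z \<in> ball 0 1 then 1 else 0) = power_series2 ?d"
    by (intro ext) (simp add: power_series2_def)
  have "(\<lambda>p. (cmod (?d p))\<^sup>2 * monomial_norm2 p) summable_on UNIV"
    by (subst summable_on_cong_neutral[where T = "{(0, 0)}"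
          and g = "\<lambda>p. (cmod (?d p))\<^sup>2 * monomial_norm2 p"]) auto
  then show "?d \<in> da_coeffs" by (simp add: da_coeffs_def)
qed

lemma da_poly_closed:
  "(\<lambda>z. if z \<in> ball 0 1 then poly (poly p [:fst z:]) (snd z) else 0) \<in> power_series2 ` da_coeffs"
proof -
  have 1: "(\<lambda>z. if z \<in> ball 0 1 then poly q (snd z) else 0) \<in> power_series2 ` da_coeffs" for q
  proof (induction q)
    case 0
    then show ?case using da_zero_closed by (simp cong: if_cong)
  next
    case (pCons c q)
    from da_lin_closed[OF da_mult2_closed[OF pCons(2)] da_one_closed, of c]
    show ?case by (rule back_subst[of "\<lambda>f. f \<in> power_series2 ` da_coeffs"])
        (auto simp: fun_eq_iff)
  qed
  show ?thesis
  proof (induction p)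
    case 0
    then show ?case using da_zero_closed by (simp cong: if_cong)
  next
    case (pCons q p)
    from da_lin_closed[OF da_mult1_closed[OF pCons(2)] 1, of 1 q]
    show ?case by (rule back_subst[of "\<lambda>f. f \<in> power_series2 ` da_coeffs"])
        (auto simp: fun_eq_iff)
  qed
qed

lift_definition da_of_poly :: "complex poly poly \<Rightarrow> da" is
  "\<lambda>p z. if z \<in> ball 0 1 then poly (poly p [:fst z:]) (snd z) else 0"
  by (rule da_poly_closed)

lemma coeffs2_monomial:
  "coeffs2 (da_of_poly (monom (monom 1 n) m)) = (\<lambda>p. if p = (m, n) then 1 else 0)" (is "_ = ?d")
proof (rule coeffs2_eqI)
  have "(\<Sum>\<^sub>\<infinity>p. ?d p * fst z ^ fst p * snd z ^ snd p) = fst z ^ m * snd z ^ n"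
    for z :: "complex \<times> complex"
    by (subst infsum_cong_neutral[where T = "{(m, n)}"
          and g = "\<lambda>p. ?d p * fst z ^ fst p * snd z ^ snd p"]) auto
  then show "da_fun (da_of_poly (monom (monom 1 n) m)) = power_series2 ?d"
    by (intro ext) (simp add: da_of_poly.rep_eq power_series2_def poly_monom poly_power)
  have "(\<lambda>p. (cmod (?d p))\<^sup>2 * monomial_norm2 p) summable_on UNIV"
    by (subst summable_on_cong_neutral[where T = "{(m, n)}"
          and g = "\<lambda>p. (cmod (?d p))\<^sup>2 * monomial_norm2 p"]) auto
  then show "?d \<in> da_coeffs" by (simp add: da_coeffs_def)
qed

lemma cinner_monomials:
  "cinner (da_of_poly (monom (monom 1 n) m)) (da_of_poly (monom (monom 1 n') m'))
    = (if m = m' \<and> n = n' then 1 / of_nat ((m + n) choose m) else 0)"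
  unfolding cinner_def coeffs2_monomial
  by (subst infsum_cong_neutral[where T = "{(m, n)}" and g = "\<lambda>p. if p = (m', n') then
        of_real (monomial_norm2 p) else 0"]) (auto simp: monomial_norm2_def)

definition ortho :: "da set \<Rightarrow> da set" where
  "ortho A = {f. \<forall>g\<in>A. cinner f g = 0}"

text \<open>The characterizing property of \<open>proj S f\<close> determines it uniquely if \<open>S\<close> is a closed subspace.\<close>

definition proj :: "da set \<Rightarrow> da \<Rightarrow> da" where
  "proj S f = (THE g. g \<in> S \<and> (\<forall>h\<in>S. cinner (f - g) h = 0))"

text \<open>
  Operators between subspaces \<open>S\<close> and \<open>S'\<close> are extensional functions (\<^const>\<open>undefined\<close> outside
  \<open>S\<close>), so that HOL equality is equality of operators.
\<close>

definition bounded_ops :: "da set \<Rightarrow> da set \<Rightarrow> (da \<Rightarrow> da) set" where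
  "bounded_ops S S' = {A \<in> S \<rightarrow>\<^sub>E S'.
     (\<forall>f\<in>S. \<forall>g\<in>S. A (f + g) = A f + A g) \<and>
     (\<forall>c. \<forall>f\<in>S. A (cscale c f) = cscale c (A f)) \<and>
     (\<exists>K. \<forall>f\<in>S. norm (A f) \<le> K * norm f)}"

definition adj :: "da set \<Rightarrow> da set \<Rightarrow> (da \<Rightarrow> da) \<Rightarrow> da \<Rightarrow> da" where
  "adj S S' A = (THE B. B \<in> bounded_ops S' S \<and>
     (\<forall>f\<in>S. \<forall>g\<in>S'. cinner (A f) g = cinner f (B g)))"

definition unitary_op :: "da set \<Rightarrow> da set \<Rightarrow> (da \<Rightarrow> da) \<Rightarrow> bool" where
  "unitary_op S S' A \<longleftrightarrow> A \<in> bounded_ops S S' \<and> A ` S = S' \<and>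
     (\<forall>f\<in>S. \<forall>g\<in>S. cinner (A f) (A g) = cinner f g)"

definition compact_ops :: "da set \<Rightarrow> da set \<Rightarrow> (da \<Rightarrow> da) set" where
  "compact_ops S S' = {A \<in> bounded_ops S S'. compact (closure (A ` (S \<inter> cball 0 1)))}"

definition compression :: "da set \<Rightarrow> (da \<Rightarrow> da) \<Rightarrow> da \<Rightarrow> da" where
  "compression S M = (\<lambda>f\<in>S. proj S (M f))"

text \<open>The last clause is closedness in the operator norm on \<open>S\<close>.\<close>

definition cstar_subalgebra :: "da set \<Rightarrow> (da \<Rightarrow> da) set \<Rightarrow> bool" where
  "cstar_subalgebra S \<A> \<longleftrightarrow> \<A> \<subseteq> bounded_ops S S \<and>
     (\<forall>A\<in>\<A>. \<forall>B\<in>\<A>. (\<lambda>f\<in>S. A f + B f) \<in> \<A>) \<and>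
     (\<forall>c. \<forall>A\<in>\<A>. (\<lambda>f\<in>S. cscale c (A f)) \<in> \<A>) \<and>
     (\<forall>A\<in>\<A>. \<forall>B\<in>\<A>. compose S A B \<in> \<A>) \<and>
     (\<forall>A\<in>\<A>. adj S S A \<in> \<A>) \<and>
     (\<forall>B\<in>bounded_ops S S.
        (\<forall>e>0. \<exists>A\<in>\<A>. \<forall>f\<in>S. norm (A f - B f) \<le> e * norm f) \<longrightarrow> B \<in> \<A>)"

definition ideal_gen :: "nat \<Rightarrow> real \<Rightarrow> real \<Rightarrow> complex poly poly" where
  "ideal_gen k \<epsilon> t = monom 1 k - [:[:of_real \<epsilon> * cis t:]:]"

definition principal_ideal :: "'a::comm_ring_1 \<Rightarrow> 'a set" where
  "principal_ideal p = range (\<lambda>q. q * p)"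

definition I_perp :: "nat \<Rightarrow> real \<Rightarrow> real \<Rightarrow> da set" where
  "I_perp k \<epsilon> t = ortho (da_of_poly ` principal_ideal (ideal_gen k \<epsilon> t))"

definition T1 :: "nat \<Rightarrow> real \<Rightarrow> da \<Rightarrow> da" where
  "T1 k \<epsilon> = compression (I_perp k \<epsilon> 0) mult_z1"

definition T2 :: "nat \<Rightarrow> real \<Rightarrow> da \<Rightarrow> da" where
  "T2 k \<epsilon> = compression (I_perp k \<epsilon> 0) mult_z2"

definition toeplitz_algebra :: "nat \<Rightarrow> real \<Rightarrow> (da \<Rightarrow> da) set" where
  "toeplitz_algebra k \<epsilon> = (let S = I_perp k \<epsilon> 0 in
     cstar_subalgebra S hull ({(\<lambda>f\<in>S. f), T1 k \<epsilon>, T2 k \<epsilon>} \<union> compact_ops S S))"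

definition vderiv :: "(real \<Rightarrow> da) \<Rightarrow> real \<Rightarrow> da" where
  "vderiv \<xi> = (\<lambda>t. vector_derivative \<xi> (at t))"

definition smooth :: "(real \<Rightarrow> da) \<Rightarrow> bool" where
  "smooth \<xi> \<longleftrightarrow> (\<forall>n t. ((vderiv ^^ n) \<xi>) differentiable (at t))"

definition smooth_section :: "nat \<Rightarrow> real \<Rightarrow> (real \<Rightarrow> da) \<Rightarrow> bool" where
  "smooth_section k \<epsilon> \<xi> \<longleftrightarrow> smooth \<xi> \<and> (\<forall>t. \<xi> t \<in> I_perp k \<epsilon> t)"

definition connection :: "nat \<Rightarrow> real \<Rightarrow> (real \<Rightarrow> da) \<Rightarrow> real \<Rightarrow> da" where
  "connection k \<epsilon> \<xi> t = proj (I_perp k \<epsilon> t) (vderiv \<xi> t)"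

definition flat :: "nat \<Rightarrow> real \<Rightarrow> (real \<Rightarrow> da) \<Rightarrow> bool" where
  "flat k \<epsilon> \<xi> \<longleftrightarrow> smooth_section k \<epsilon> \<xi> \<and> (\<forall>t. connection k \<epsilon> \<xi> t = 0)"

text \<open>
  The extension by continuity is the unique bounded operator with the prescribed values on the
  (dense) set of initial values of flat sections.
\<close>

definition parallel_transport :: "nat \<Rightarrow> real \<Rightarrow> real \<Rightarrow> da \<Rightarrow> da" where
  "parallel_transport k \<epsilon> t = (THE U. U \<in> bounded_ops (I_perp k \<epsilon> 0) (I_perp k \<epsilon> t) \<and>
     (\<forall>\<xi>. flat k \<epsilon> \<xi> \<longrightarrow> U (\<xi> 0) = \<xi> t))"

definition monodromy :: "nat \<Rightarrow> real \<Rightarrow> da \<Rightarrow> da" where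
  "monodromy k \<epsilon> = parallel_transport k \<epsilon> (2 * pi)"

end

theory Submission
  imports Defs
begin

text \<open>
  A function lies in \<open>I(t)\<^sup>\<bottom>\<close> iff its coefficients, weighted by the squared norms of the monomials,
  are multiplied by \<open>\<epsilon> e\<^sup>-\<^sup>i\<^sup>t\<close> when the exponent of \<open>z\<^sub>1\<close> grows by \<open>k\<close>. So the families
  \<open>m \<equiv> r (mod k)\<close>, \<open>n\<close> fixed, of monomials \<open>z\<^sub>1\<^sup>m z\<^sub>2\<^sup>n\<close> each contribute one vector to an orthogonal
  basis, the connection decouples, and parallel transport multiplies the coefficient of \<open>z\<^sub>1\<^sup>m z\<^sub>2\<^sup>n\<close> by
  \<open>cis (t (\<lambda> - m div k))\<close>, where \<open>\<lambda>\<close> is the mean of \<open>m div k\<close> under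
  the weights \<open>F\<^sup>m (m+n choose m)\<close> on the family. Thus the monodromy is diagonal with entries \<open>cis (2 \<pi> \<lambda>)\<close>, and
  since \<open>k \<lambda> = (n + 1) F / (1 - F) - r + o(1)\<close> as \<open>n\<close> tends to infinity, conjugating the shifts by it changes
  them by the stated constants up to diagonal factors tending to zero, which are compact.
\<close>

section \<open>Hilbert space geometry\<close>

text \<open>The transport is generated by the unbounded diagonal operator with entries
  \<open>phase\<close>, so a transported vector is smooth in t only if its coefficients decay. The
  basis vectors have this decay, and they suffice: the pairing of any flat section with a
  transported basis vector is constant in t, which pins the section down.

  At t = 2 \<pi> the integer m div k drops out, leaving a symbol of period k in m. Diagonal
  operators with such symbols commute with the projection onto \<open>I(0)\<^sup>\<bottom>\<close>,
  so conjugating a compressed shift only compares phases of neighbouring monomials. They are compact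
  once the symbol vanishes as n grows, since each n carries only k basis vectors.

  The constants come from probability: as F^k = \<epsilon>^2, the weights form a negative binomial
  distribution, of mean (n + 1) F / (1 - F), conditioned on a residue class mod k, and conditioning
  changes the mean by a vanishing amount. A step in m moves the residue, worth 1 / k of a turn; a
  step in n moves the mean by F / (1 - F), worth F / (k (1 - F)) of a turn.\<close>

text \<open>The representing vector minimizes \<open>\<parallel>f\<parallel>\<^sup>2 - 2 \<phi> f\<close>; this yields projections and adjoints alike.\<close>

lemma riesz_subspace:
  fixes S :: "'a::{real_inner,complete_space} set" and \<phi> :: "'a \<Rightarrow> real"
  assumes S: "subspace S" "closed S"
    and add: "\<And>f g. f \<in> S \<Longrightarrow> g \<in> S \<Longrightarrow> \<phi> (f + g) = \<phi> f + \<phi> g"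
    and scale: "\<And>r f. f \<in> S \<Longrightarrow> \<phi> (r *\<^sub>R f) = r * \<phi> f"
    and bdd: "\<And>f. f \<in> S \<Longrightarrow> \<bar>\<phi> f\<bar> \<le> K * norm f"
  obtains g where "g \<in> S" "\<And>f. f \<in> S \<Longrightarrow> \<phi> f = inner f g"
proof -
  define J where "J f = (norm f)\<^sup>2 - 2 * \<phi> f" for f
  define m where "m = Inf (J ` S)"
  have lower: "- K\<^sup>2 \<le> J f" if "f \<in> S" for f
    using bdd[OF that] zero_le_power2[of "norm f - K"]
    unfolding J_def power2_diff by (simp add: mult.commute abs_le_iff)
  have m: "m \<le> J f" if "f \<in> S" for f
    unfolding m_def using lower that by (intro cInf_lower bdd_belowI2) auto
  \<comment> \<open>Parallelogram law, with \<open>J\<close> bounded below at the midpoint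
    \<open>h\<close>: near-minimizers of \<open>J\<close> are close to each other, so a minimizing
    sequence is Cauchy.\<close>
  have par: "(norm (f - g))\<^sup>2 \<le> 2 * (J f - m) + 2 * (J g - m)" if "f \<in> S" "g \<in> S" for f g
  proof -
    define h where "h = (1/2) *\<^sub>R (f + g)"
    have "f + g \<in> S" using that S by (simp add: subspace_add)
    then have "m \<le> J h" "\<phi> h = (\<phi> f + \<phi> g) / 2"
      unfolding h_def using S that by (simp_all add: m subspace_scale scale add)
    moreover have "(norm h)\<^sup>2 = (2 * (norm f)\<^sup>2 + 2 * (norm g)\<^sup>2 - (norm (f - g))\<^sup>2) / 4"
      by (simp add: h_def power_mult_distrib power_divide)
        (simp add: power2_norm_eq_inner inner_add_left inner_add_right inner_diff_left inner_diff_right inner_commute)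
    ultimately show ?thesis unfolding J_def by argo
  qed
  have "\<exists>f\<in>S. J f < m + 1 / Suc n" for n
  proof -
    have "J ` S \<noteq> {}" using S subspace_0 by auto
    from cInf_lessD[OF this, of "m + 1 / Suc n"] show ?thesis by (auto simp: m_def)
  qed
  then obtain X where X: "\<And>n. X n \<in> S" "\<And>n. J (X n) < m + 1 / Suc n" by metis
  have "Cauchy X"
  proof (rule CauchyI)
    fix e :: real assume e: "0 < e"
    obtain N where N: "4 / e\<^sup>2 < real N" using reals_Archimedean2 by blast
    show "\<exists>M. \<forall>i\<ge>M. \<forall>j\<ge>M. norm (X i - X j) < e"
    proof (intro exI allI impI)
      fix i j assume ij: "N \<le> i" "N \<le> j"
      have small: "J (X l) - m < 1 / Suc N" if "N \<le> l" for l
        using X(2)[of l] frac_le[of 1 1 "real (Suc N)" "real (Suc l)"] that by auto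
      have "(norm (X i - X j))\<^sup>2 < 4 * (1 / Suc N)"
        using par[OF X(1) X(1), of i j] small[OF ij(1)] small[OF ij(2)] by argo
      also have "4 / e\<^sup>2 < Suc N" using N by simp
      then have "4 * (1 / Suc N) < e\<^sup>2" using e by (simp add: field_simps)
      finally show "norm (X i - X j) < e" using e by (simp add: power2_less_imp_less)
    qed
  qed
  then obtain g where g: "X \<longlonglongrightarrow> g" using Cauchy_convergent convergent_def by blast
  have gS: "g \<in> S" using closed_sequentially[OF S(2)] X(1) g by blast
  have diff: "\<phi> f - \<phi> h = \<phi> (f - h)" if "f \<in> S" "h \<in> S" for f h
    using add[of "f - h" h] that S by (simp add: subspace_diff)
  have "(\<lambda>n. \<phi> (X n)) \<longlonglongrightarrow> \<phi> g"
  proof (rule LIM_zero_cancel, rule Lim_null_comparison)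
    show "\<forall>\<^sub>F n in sequentially. norm (\<phi> (X n) - \<phi> g) \<le> K * norm (X n - g)"
      using diff[OF X(1) gS] bdd[of "X _ - g"] X(1) gS S by (intro always_eventually) (simp add: subspace_diff)
    show "(\<lambda>n. K * norm (X n - g)) \<longlonglongrightarrow> 0"
      using tendsto_mult_right_zero[OF tendsto_norm_zero[OF LIM_zero[OF g]]] by simp
  qed
  then have "(\<lambda>n. J (X n)) \<longlonglongrightarrow> J g"
    unfolding J_def by (intro tendsto_intros g)
  moreover have "(\<lambda>n. m + 1 / Suc n) \<longlonglongrightarrow> m + 0"
    using LIMSEQ_inverse_real_of_nat by (intro tendsto_intros) (simp add: inverse_eq_divide)
  ultimately have "J g \<le> m + 0"
    by (rule LIMSEQ_le) (intro exI[of _ 0] allI impI less_imp_le X(2))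
  then have Jg: "J g \<le> m" by simp
  have "\<phi> h = inner h g" if h: "h \<in> S" for h
  proof (cases "h = 0")
    case True
    then show ?thesis using scale[OF h, of 0] by simp
  next
    case False
    define b where "b = inner h g - \<phi> h"
    \<comment> \<open>The minimizer of the quadratic \<open>J (g + s *\<^sub>R h) - J g\<close> in
      \<open>s\<close>; a nonzero \<open>b\<close> would make its value negative.\<close>
    define s where "s = - b / (norm h)\<^sup>2"
    have nz: "0 < (norm h)\<^sup>2" using False by simp
    have "J g \<le> J (g + s *\<^sub>R h)" using Jg m[of "g + s *\<^sub>R h"] gS h S by (simp add: subspace_add subspace_scale)
    also have "\<phi> (g + s *\<^sub>R h) = \<phi> g + s * \<phi> h"
      using gS h S by (simp add: add scale subspace_scale)
    then have "J (g + s *\<^sub>R h) = J g + s\<^sup>2 * (norm h)\<^sup>2 + 2 * s * b"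
      unfolding J_def b_def
      by (simp add: power2_norm_eq_inner inner_add_left inner_add_right inner_commute)
        (simp add: algebra_simps power2_eq_square)
    also have "s\<^sup>2 * (norm h)\<^sup>2 = - s * b"
      using nz by (simp add: s_def power2_eq_square)
    finally have "0 \<le> s * b" by (simp add: mult.commute)
    then have "b\<^sup>2 / (norm h)\<^sup>2 \<le> 0" by (simp add: s_def power2_eq_square)
    then have "b\<^sup>2 \<le> 0" using nz by (simp only: divide_le_0_iff) simp
    then show ?thesis by (simp add: b_def)
  qed
  with gS show thesis by (rule that)
qed

section \<open>Coefficients, norm and completeness of the Drury-Arveson space\<close>

lemma da_eqI: "(\<And>p. coeffs2 f p = coeffs2 g p) \<Longrightarrow> f = g"
  by (metis da_fun_coeffs2 da_fun_inject ext)

lemma coeffs2_zero [simp]: "coeffs2 0 p = 0"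
  using da_eq_0_iff[of 0] by simp

lemma cscale_minus_one: "cscale (-1) f = - f"
  by transfer simp

lemma coeffs2_uminus: "coeffs2 (- f) p = - coeffs2 f p"
  by (simp add: coeffs2_cscale flip: cscale_minus_one)

lemma coeffs2_diff: "coeffs2 (f - g) p = coeffs2 f p - coeffs2 g p"
  using coeffs2_add[of f "- g"] by (simp add: coeffs2_uminus)

lemma coeffs2_scaleR: "coeffs2 (r *\<^sub>R f) p = of_real r * coeffs2 f p"
  by (simp add: scaleR_da_def coeffs2_cscale)

lemma coeffs2_sum: "coeffs2 (sum f A) p = (\<Sum>x\<in>A. coeffs2 (f x) p)"
  by (induction A rule: infinite_finite_induct) (simp_all add: coeffs2_add)

lemmas coeffs2_simps = coeffs2_add coeffs2_cscale coeffs2_diff coeffs2_uminus coeffs2_scaleR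

lemma cscale_one [simp]: "cscale 1 f = f"
  and cscale_cscale: "cscale c (cscale d f) = cscale (c * d) f"
  and cscale_add_right: "cscale c (f + g) = cscale c f + cscale c g"
  by (rule da_eqI; simp add: coeffs2_simps algebra_simps)+

text \<open>Meaningful only for square summable families, because \<open>Abs_da\<close> is
  unspecified elsewhere; membership in \<open>da_coeffs\<close> therefore accompanies its
  uses.\<close>

definition of_coeffs :: "(nat \<times> nat \<Rightarrow> complex) \<Rightarrow> da" where
  "of_coeffs a = Abs_da (power_series2 a)"

lemma coeffs2_of_coeffs: "a \<in> da_coeffs \<Longrightarrow> coeffs2 (of_coeffs a) = a"
  unfolding of_coeffs_def by (rule coeffs2_eqI) (auto simp: Abs_da_inverse)

lemma coeffs2_square_summable: "(\<lambda>p. (cmod (coeffs2 f p))\<^sup>2 * monomial_norm2 p) summable_on UNIV"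
  using coeffs2_in[of f] by (simp add: da_coeffs_def)

lemma norm_da_square: "(norm f)\<^sup>2 = (\<Sum>\<^sub>\<infinity>p. (cmod (coeffs2 f p))\<^sup>2 * monomial_norm2 p)"
  by (simp add: power2_norm_eq_inner inner_da_def cinner_self)

lemma coeffs_term_nonneg: "0 \<le> (cmod (a p))\<^sup>2 * monomial_norm2 p"
  using monomial_norm2_pos[of p] by simp

text \<open>Bounds on finite partial sums survive coefficientwise limits, which is what the
  completeness proof relies on.\<close>

lemma da_coeffs_finite_bound:
  assumes "\<And>G. finite G \<Longrightarrow> (\<Sum>p\<in>G. (cmod (a p))\<^sup>2 * monomial_norm2 p) \<le> C"
  shows "a \<in> da_coeffs" "(norm (of_coeffs a))\<^sup>2 \<le> C"
proof -
  have s: "(\<lambda>p. (cmod (a p))\<^sup>2 * monomial_norm2 p) summable_on UNIV"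
    by (rule nonneg_bdd_above_summable_on[OF coeffs_term_nonneg]) (use assms in \<open>auto intro!: bdd_aboveI2\<close>)
  then show a: "a \<in> da_coeffs" by (simp add: da_coeffs_def)
  show "(norm (of_coeffs a))\<^sup>2 \<le> C"
    unfolding norm_da_square coeffs2_of_coeffs[OF a]
    by (rule infsum_le_finite_sums[OF s]) (use assms in auto)
qed

lemma finite_sum_le_norm:
  "finite G \<Longrightarrow> (\<Sum>p\<in>G. (cmod (coeffs2 f p))\<^sup>2 * monomial_norm2 p) \<le> (norm f)\<^sup>2"
  unfolding norm_da_square
  by (rule finite_sum_le_infsum[OF coeffs2_square_summable]) (auto simp: coeffs_term_nonneg)

lemma coeffs2_le_norm: "cmod (coeffs2 f p) * sqrt (monomial_norm2 p) \<le> norm f"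
  by (rule power2_le_imp_le)
    (use finite_sum_le_norm[of "{p}" f] monomial_norm2_pos[of p] in \<open>simp_all add: power_mult_distrib\<close>)

lemma dominated_da_coeffs:
  assumes "0 \<le> K" "\<And>p. cmod (a p) \<le> K * cmod (coeffs2 f p)"
  shows "a \<in> da_coeffs" "norm (of_coeffs a) \<le> K * norm f"
proof -
  have *: "(\<Sum>p\<in>G. (cmod (a p))\<^sup>2 * monomial_norm2 p) \<le> (K * norm f)\<^sup>2" if "finite G" for G
  proof -
    have "(\<Sum>p\<in>G. (cmod (a p))\<^sup>2 * monomial_norm2 p) \<le>
        (\<Sum>p\<in>G. (K * cmod (coeffs2 f p))\<^sup>2 * monomial_norm2 p)"
      using assms monomial_norm2_pos by (intro sum_mono mult_right_mono power_mono) (auto simp: less_imp_le)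
    also have "\<dots> = K\<^sup>2 * (\<Sum>p\<in>G. (cmod (coeffs2 f p))\<^sup>2 * monomial_norm2 p)"
      by (simp add: sum_distrib_left power_mult_distrib mult_ac)
    also have "\<dots> \<le> K\<^sup>2 * (norm f)\<^sup>2" by (intro mult_left_mono finite_sum_le_norm that) auto
    finally show ?thesis by (simp add: power_mult_distrib)
  qed
  then show "a \<in> da_coeffs" by (rule da_coeffs_finite_bound)
  show "norm (of_coeffs a) \<le> K * norm f"
    by (rule power2_le_imp_le[OF da_coeffs_finite_bound(2)[OF *]]) (use assms(1) in simp_all)
qed

lemma norm_le_coeffs:
  assumes "0 \<le> K" "\<And>p. cmod (coeffs2 g p) \<le> K * cmod (coeffs2 f p)"
  shows "norm g \<le> K * norm f"
proof -
  have "g = of_coeffs (coeffs2 g)" by (rule da_eqI) (simp add: coeffs2_of_coeffs[OF coeffs2_in])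
  then show ?thesis using dominated_da_coeffs(2)[OF assms] by simp
qed

text \<open>Each coefficient is a bounded functional, so a Cauchy sequence converges
  coefficientwise; on finite index sets the Cauchy estimate passes to the limit, with a bound
  independent of the set.\<close>

instance da :: complete_space
proof
  fix X :: "nat \<Rightarrow> da" assume X: "Cauchy X"
  have "\<exists>l. (\<lambda>n. coeffs2 (X n) p) \<longlonglongrightarrow> l" for p
  proof -
    have w: "0 < sqrt (monomial_norm2 p)" using monomial_norm2_pos by simp
    have "Cauchy (\<lambda>n. coeffs2 (X n) p)"
    proof (rule CauchyI)
      fix e :: real assume "0 < e"
      then obtain M where M: "\<forall>m\<ge>M. \<forall>n\<ge>M. norm (X m - X n) < e * sqrt (monomial_norm2 p)"
        using X w CauchyD[of X "e * sqrt (monomial_norm2 p)"] by auto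
      show "\<exists>M. \<forall>m\<ge>M. \<forall>n\<ge>M. norm (coeffs2 (X m) p - coeffs2 (X n) p) < e"
      proof (intro exI allI impI)
        fix m n assume "M \<le> m" "M \<le> n"
        with M have "norm (X m - X n) < e * sqrt (monomial_norm2 p)" by blast
        then have "cmod (coeffs2 (X m - X n) p) * sqrt (monomial_norm2 p) < e * sqrt (monomial_norm2 p)"
          using coeffs2_le_norm[of "X m - X n" p] by linarith
        then show "norm (coeffs2 (X m) p - coeffs2 (X n) p) < e"
          using w by (simp add: coeffs2_diff)
      qed
    qed
    then show ?thesis using Cauchy_convergent convergent_def by blast
  qed
  then obtain a where a: "\<And>p. (\<lambda>n. coeffs2 (X n) p) \<longlonglongrightarrow> a p" by metis
  have fin: "(\<Sum>p\<in>G. (cmod (coeffs2 (X m) p - a p))\<^sup>2 * monomial_norm2 p) \<le> e\<^sup>2"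
    if "\<forall>n\<ge>M. norm (X m - X n) < e" for m M e G
  proof (cases "finite G")
    case True
    have "(\<lambda>n. \<Sum>p\<in>G. (cmod (coeffs2 (X m) p - coeffs2 (X n) p))\<^sup>2 * monomial_norm2 p)
      \<longlonglongrightarrow> (\<Sum>p\<in>G. (cmod (coeffs2 (X m) p - a p))\<^sup>2 * monomial_norm2 p)"
      by (intro tendsto_intros a)
    moreover have "(\<Sum>p\<in>G. (cmod (coeffs2 (X m) p - coeffs2 (X n) p))\<^sup>2 * monomial_norm2 p) \<le> e\<^sup>2"
      if n: "n \<ge> M" for n
    proof -
      have "norm (X m - X n) \<le> e" using that \<open>\<forall>n\<ge>M. norm (X m - X n) < e\<close> by (simp add: less_imp_le)
      then have "(norm (X m - X n))\<^sup>2 \<le> e\<^sup>2" by (simp add: power_mono)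
      with finite_sum_le_norm[OF True, of "X m - X n"] show ?thesis by (simp add: coeffs2_diff)
    qed
    ultimately show ?thesis using Lim_bounded[where M = M] by blast
  qed simp
  have diff: "(\<lambda>p. coeffs2 (X m) p - a p) \<in> da_coeffs"
    "norm (of_coeffs (\<lambda>p. coeffs2 (X m) p - a p)) \<le> e"
    if "\<forall>n\<ge>M. norm (X m - X n) < e" "0 \<le> e" for m M e
    by (rule da_coeffs_finite_bound[OF fin[OF that(1)]],
        rule power2_le_imp_le[OF da_coeffs_finite_bound(2)[OF fin[OF that(1)]] that(2)])
  have N: "\<exists>M. \<forall>m\<ge>M. \<forall>n\<ge>M. norm (X m - X n) < e" if "e > 0" for e
    using CauchyD[OF X that] .
  obtain M where "\<forall>m\<ge>M. \<forall>n\<ge>M. norm (X m - X n) < 1" using N[of 1] by auto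
  \<comment> \<open>The limit family is square summable because it differs from the coefficients of
    one \<open>X M\<close> by a square summable family.\<close>
  then have "(\<lambda>p. coeffs2 (X M) p - a p) \<in> da_coeffs" by (intro diff(1)[of M _ 1]) auto
  from da_coeffs_lin[OF coeffs2_in[of "X M"] this, of "-1"] have a_in: "a \<in> da_coeffs" by simp
  have eq: "X m - of_coeffs a = of_coeffs (\<lambda>p. coeffs2 (X m) p - a p)" for m
    using da_coeffs_lin[OF coeffs2_in[of "X m"] a_in, of "-1"]
    by (intro da_eqI) (simp add: coeffs2_diff coeffs2_of_coeffs a_in)
  have "X \<longlonglongrightarrow> of_coeffs a"
  proof (rule LIMSEQ_I)
    fix e :: real assume "0 < e"
    then obtain M where M: "\<forall>m\<ge>M. \<forall>n\<ge>M. norm (X m - X n) < e / 2" using N[of "e / 2"] by auto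
    show "\<exists>no. \<forall>n\<ge>no. norm (X n - of_coeffs a) < e"
    proof (intro exI allI impI)
      fix n assume "n \<ge> M"
      with M have "norm (X n - of_coeffs a) \<le> e / 2"
        unfolding eq using \<open>0 < e\<close> by (intro diff(2)[of M]) auto
      with \<open>0 < e\<close> show "norm (X n - of_coeffs a) < e" by linarith
    qed
  qed
  then show "convergent X" by (rule convergentI)
qed

section \<open>The complex inner product, closed subspaces and projections\<close>

lemma cinner_add_right: "cinner f (g + h) = cinner f g + cinner f h"
  by (metis cinner_add_left cinner_commute complex_cnj_add)

lemma cinner_cscale_right: "cinner f (cscale c g) = cnj c * cinner f g"
  by (metis cinner_commute cinner_cscale_left complex_cnj_mult)

lemma cinner_uminus_left: "cinner (- f) g = - cinner f g"
  using cinner_cscale_left[of "-1" f g] by (simp add: cscale_minus_one)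

lemma cinner_diff_left: "cinner (f - g) h = cinner f h - cinner g h"
  using cinner_add_left[of f "- g" h] by (simp add: cinner_uminus_left)

lemma cinner_diff_right: "cinner f (g - h) = cinner f g - cinner f h"
  by (metis cinner_commute cinner_diff_left complex_cnj_diff)

lemma cinner_zero_left [simp]: "cinner 0 g = 0"
  and cinner_zero_right [simp]: "cinner g 0 = 0"
  by (simp_all add: cinner_def)

lemma cinner_self_norm: "cinner f f = of_real ((norm f)\<^sup>2)"
  by (simp add: cinner_self norm_da_square)

lemma cinner_self_eq_0_iff: "cinner f f = 0 \<longleftrightarrow> f = 0"
  by (simp add: cinner_self_norm)

lemma norm_cscale: "norm (cscale c f) = cmod c * norm f"
proof (rule power2_eq_imp_eq)
  have "(of_real ((norm (cscale c f))\<^sup>2) :: complex) = c * cnj c * of_real ((norm f)\<^sup>2)"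
    by (simp only: cinner_self_norm[symmetric] cinner_cscale_left cinner_cscale_right mult_ac)
  also have "\<dots> = of_real ((cmod c * norm f)\<^sup>2)"
    by (simp only: complex_norm_square[symmetric] power_mult_distrib of_real_mult)
  finally have "(of_real ((norm (cscale c f))\<^sup>2) :: complex) = of_real ((cmod c * norm f)\<^sup>2)" .
  then show "(norm (cscale c f))\<^sup>2 = (cmod c * norm f)\<^sup>2" using of_real_eq_iff by blast
qed auto

text \<open>A unimodular factor \<open>c\<close> rotates the inner product onto the positive real
  axis, where the real inequality applies.\<close>

lemma cinner_Cauchy_Schwarz: "cmod (cinner f g) \<le> norm f * norm g"
proof (cases "cinner f g = 0")
  case False
  define c where "c = cnj (sgn (cinner f g))"
  have "cinner f g = of_real (cmod (cinner f g)) * sgn (cinner f g)"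
    using False by (simp add: sgn_div_norm scaleR_conv_of_real field_simps)
  then have "cinner (cscale c f) g = cnj (sgn (cinner f g)) * (of_real (cmod (cinner f g)) * sgn (cinner f g))"
    unfolding cinner_cscale_left c_def by (rule arg_cong)
  also have "\<dots> = of_real (cmod (cinner f g)) * (sgn (cinner f g) * cnj (sgn (cinner f g)))"
    by (simp only: mult_ac)
  also have "sgn (cinner f g) * cnj (sgn (cinner f g)) = 1"
    using False by (simp add: norm_sgn flip: complex_norm_square)
  finally have "cmod (cinner f g) = Re (cinner (cscale c f) g)" by simp
  also have "\<dots> \<le> norm (cscale c f) * norm g"
    using norm_cauchy_schwarz[of "cscale c f" g] by (simp add: inner_da_def)
  also have "norm (cscale c f) = norm f" using False by (simp add: norm_cscale c_def norm_sgn)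
  finally show ?thesis .
qed simp

text \<open>Real bilinearity gives continuity, hence closed orthogonal complements, and the product
  rule for pairings of sections.\<close>

interpretation cinner: bounded_bilinear cinner
  by standard (auto simp: cinner_add_left cinner_add_right scaleR_da_def cinner_cscale_left
      cinner_cscale_right scaleR_conv_of_real intro!: exI[of _ 1] cinner_Cauchy_Schwarz)

definition closed_csubspace :: "da set \<Rightarrow> bool" where
  "closed_csubspace S \<longleftrightarrow> 0 \<in> S \<and> (\<forall>f\<in>S. \<forall>g\<in>S. f + g \<in> S) \<and> (\<forall>c. \<forall>f\<in>S. cscale c f \<in> S) \<and> closed S"

lemma closed_csubspaceD:
  assumes "closed_csubspace S"
  shows "0 \<in> S" "f \<in> S \<Longrightarrow> g \<in> S \<Longrightarrow> f + g \<in> S" "f \<in> S \<Longrightarrow> cscale c f \<in> S" "closed S"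
    "f \<in> S \<Longrightarrow> g \<in> S \<Longrightarrow> f - g \<in> S" "subspace S"
proof -
  show *: "0 \<in> S" "\<And>f g. f \<in> S \<Longrightarrow> g \<in> S \<Longrightarrow> f + g \<in> S" "\<And>c f. f \<in> S \<Longrightarrow> cscale c f \<in> S" "closed S"
    using assms by (auto simp: closed_csubspace_def)
  then show S: "subspace S" by (auto simp: subspace_def scaleR_da_def)
  show "f \<in> S \<Longrightarrow> g \<in> S \<Longrightarrow> f - g \<in> S" by (rule subspace_diff[OF S])
qed

lemma closed_csubspace_ortho: "closed_csubspace (ortho A)"
proof -
  have "ortho A = (\<Inter>g\<in>A. {f. cinner f g = 0})" by (auto simp: ortho_def)
  moreover have "closed {f. cinner f g = 0}" for g
    by (intro closed_Collect_eq continuous_intros cinner.continuous_on)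
  ultimately have "closed (ortho A)" by auto
  then show ?thesis by (auto simp: closed_csubspace_def ortho_def cinner_add_left cinner_cscale_left)
qed

text \<open>Real Riesz representation of the real part of the functional; complex linearity recovers
  the imaginary part as the real part at \<open>cscale (- \<i>) f\<close>.\<close>

lemma riesz_da:
  assumes S: "closed_csubspace S"
    and add: "\<And>f g. f \<in> S \<Longrightarrow> g \<in> S \<Longrightarrow> \<phi> (f + g) = \<phi> f + \<phi> g"
    and scale: "\<And>c f. f \<in> S \<Longrightarrow> \<phi> (cscale c f) = c * \<phi> f"
    and bdd: "\<And>f. f \<in> S \<Longrightarrow> cmod (\<phi> f) \<le> K * norm f"
  obtains g where "g \<in> S" "\<And>f. f \<in> S \<Longrightarrow> \<phi> f = cinner f g"
proof -
  note SD = closed_csubspaceD[OF S]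
  obtain g where g: "g \<in> S" "\<And>f. f \<in> S \<Longrightarrow> Re (\<phi> f) = inner f g"
    by (rule riesz_subspace[OF SD(6,4), of "\<lambda>f. Re (\<phi> f)" K])
      (auto simp: add scale scaleR_da_def intro: order_trans[OF abs_Re_le_cmod bdd])
  have "\<phi> f = cinner f g" if "f \<in> S" for f
    using g(2)[OF that] g(2)[OF SD(3)[OF that, of "- \<i>"]] that
    by (simp add: inner_da_def scale cinner_cscale_left complex_eq_iff)
  with g(1) show thesis by (rule that)
qed

lemma inner_eq_imp_eq:
  assumes "closed_csubspace S" "g \<in> S" "h \<in> S" "\<And>f. f \<in> S \<Longrightarrow> cinner f g = cinner f h"
  shows "g = h"
proof -
  have "g - h \<in> S" using assms by (intro closed_csubspaceD(5))
  then have "cinner (g - h) (g - h) = 0" using assms(4) by (simp add: cinner_diff_right)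
  then show ?thesis by (simp add: cinner_self_eq_0_iff)
qed

lemma proj_eqI:
  assumes S: "closed_csubspace S" and g: "g \<in> S" "\<And>h. h \<in> S \<Longrightarrow> cinner (f - g) h = 0"
  shows "proj S f = g"
  unfolding proj_def
proof (rule the_equality)
  fix g' assume g': "g' \<in> S \<and> (\<forall>h\<in>S. cinner (f - g') h = 0)"
  show "g' = g"
  proof (rule inner_eq_imp_eq[OF S])
    fix h assume "h \<in> S"
    then have "cinner (f - g) h = 0" "cinner (f - g') h = 0" using g(2) g' by auto
    then have "cinner g h = cinner g' h" by (simp add: cinner_diff_left)
    then show "cinner h g' = cinner h g" by (metis cinner_commute)
  qed (use g g' in auto)
qed (use g in auto)

text \<open>The projection is the Riesz representative within \<open>S\<close> of pairing with
  \<open>f\<close>; this supplies the existence behind the definite description.\<close>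

lemma
  assumes S: "closed_csubspace S"
  shows proj_in: "proj S f \<in> S" and cinner_proj: "h \<in> S \<Longrightarrow> cinner (proj S f) h = cinner f h"
    and norm_proj_le: "norm (proj S f) \<le> norm f"
proof -
  obtain g where g: "g \<in> S" "\<And>h. h \<in> S \<Longrightarrow> cinner h f = cinner h g"
    by (rule riesz_da[OF S, of "\<lambda>h. cinner h f" "norm f"])
      (auto simp: cinner_add_left cinner_cscale_left mult.commute intro: cinner_Cauchy_Schwarz order_trans)
  have g': "cinner f h = cinner g h" if "h \<in> S" for h
    using g(2)[OF that] by (metis cinner_commute)
  have p: "proj S f = g" by (rule proj_eqI[OF S g(1)]) (simp add: cinner_diff_left g')
  then show "proj S f \<in> S" "h \<in> S \<Longrightarrow> cinner (proj S f) h = cinner f h" using g g' by auto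
  have "norm g * norm g = cmod (cinner f g)"
    by (simp add: g'[OF g(1)] cinner_self_norm power2_eq_square norm_mult)
  also have "\<dots> \<le> norm f * norm g" by (rule cinner_Cauchy_Schwarz)
  finally show "norm (proj S f) \<le> norm f" unfolding p
    by (cases "g = 0") auto
qed

lemma proj_add: "closed_csubspace S \<Longrightarrow> proj S (f + g) = proj S f + proj S g"
  by (rule proj_eqI) (auto simp: closed_csubspaceD proj_in cinner_diff_left cinner_add_left cinner_proj)

lemma proj_cscale: "closed_csubspace S \<Longrightarrow> proj S (cscale c f) = cscale c (proj S f)"
  by (rule proj_eqI) (auto simp: closed_csubspaceD proj_in cinner_diff_left cinner_cscale_left cinner_proj)

lemma proj_eq_0I: "closed_csubspace S \<Longrightarrow> (\<And>h. h \<in> S \<Longrightarrow> cinner f h = 0) \<Longrightarrow> proj S f = 0"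
  by (rule proj_eqI) (auto simp: closed_csubspaceD)

section \<open>Bounded operators, adjoints and compactness\<close>

lemma bounded_opsD:
  assumes "A \<in> bounded_ops S S'"
  shows "A \<in> S \<rightarrow>\<^sub>E S'" "f \<in> S \<Longrightarrow> A f \<in> S'" "f \<notin> S \<Longrightarrow> A f = undefined"
    "f \<in> S \<Longrightarrow> g \<in> S \<Longrightarrow> A (f + g) = A f + A g"
    "f \<in> S \<Longrightarrow> A (cscale c f) = cscale c (A f)"
proof -
  show A: "A \<in> S \<rightarrow>\<^sub>E S'" using assms by (simp add: bounded_ops_def)
  show "f \<notin> S \<Longrightarrow> A f = undefined" by (rule PiE_arb[OF A])
  show "f \<in> S \<Longrightarrow> A f \<in> S'" using A by blast
qed (use assms in \<open>simp_all add: bounded_ops_def\<close>)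

lemma bounded_ops_bound:
  assumes "A \<in> bounded_ops S S'"
  obtains K where "0 < K" "\<And>f. f \<in> S \<Longrightarrow> norm (A f) \<le> K * norm f"
proof -
  obtain K where K: "\<And>f. f \<in> S \<Longrightarrow> norm (A f) \<le> K * norm f"
    using assms unfolding bounded_ops_def by blast
  have "norm (A f) \<le> max K 1 * norm f" if "f \<in> S" for f
    using K[OF that] mult_right_mono[OF max.cobounded1[of K 1] norm_ge_zero[of f]] by linarith
  then show thesis by (intro that[of "max K 1"]) auto
qed

lemma bounded_opsI:
  assumes "\<And>f. f \<in> S \<Longrightarrow> A f \<in> S'" "\<And>f. f \<notin> S \<Longrightarrow> A f = undefined"
    "\<And>f g. f \<in> S \<Longrightarrow> g \<in> S \<Longrightarrow> A (f + g) = A f + A g"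
    "\<And>c f. f \<in> S \<Longrightarrow> A (cscale c f) = cscale c (A f)"
    "\<And>f. f \<in> S \<Longrightarrow> norm (A f) \<le> K * norm f"
  shows "A \<in> bounded_ops S S'"
  unfolding bounded_ops_def using assms by (simp add: PiE_iff extensional_def) blast

lemma bounded_ops_diff:
  assumes "A \<in> bounded_ops S S'" "closed_csubspace S" "f \<in> S" "g \<in> S"
  shows "A (f - g) = A f - A g"
proof -
  have "A (f - g) + A g = A (f - g + g)"
    using assms by (intro bounded_opsD(4)[symmetric]) (simp_all add: closed_csubspaceD(5))
  then show ?thesis by (simp add: eq_diff_eq)
qed

lemma bounded_ops_eqI:
  assumes "A \<in> bounded_ops S S'" "B \<in> bounded_ops S T" "\<And>f. f \<in> S \<Longrightarrow> A f = B f"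
  shows "A = B"
proof (rule ext)
  fix f show "A f = B f"
    using assms(3)[of f] bounded_opsD(3)[OF assms(1), of f] bounded_opsD(3)[OF assms(2), of f]
    by (cases "f \<in> S") auto
qed

lemma compose_bounded_ops:
  assumes A: "A \<in> bounded_ops S' S''" and B: "B \<in> bounded_ops S S'" and S: "closed_csubspace S"
  shows "compose S A B \<in> bounded_ops S S''"
proof -
  obtain K where K: "0 < K" "\<And>f. f \<in> S' \<Longrightarrow> norm (A f) \<le> K * norm f" by (rule bounded_ops_bound[OF A]) blast
  obtain L where L: "0 < L" "\<And>f. f \<in> S \<Longrightarrow> norm (B f) \<le> L * norm f" by (rule bounded_ops_bound[OF B]) blast
  note D = bounded_opsD[OF A] bounded_opsD[OF B]
  show ?thesis
  proof (rule bounded_opsI[where K = "K * L"])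
    fix f assume f: "f \<in> S"
    have "norm (A (B f)) \<le> K * norm (B f)" using D f K by auto
    also have "\<dots> \<le> K * (L * norm f)" using K L f by (intro mult_left_mono) auto
    finally show "norm (compose S A B f) \<le> K * L * norm f" using f by (simp add: compose_eq mult.assoc)
  qed (use closed_csubspaceD[OF S] D in \<open>simp_all add: compose_def\<close>)
qed

lemma restrict_bounded_ops:
  assumes "closed_csubspace S" "\<And>f. f \<in> S \<Longrightarrow> A f \<in> S'"
    "\<And>f g. f \<in> S \<Longrightarrow> g \<in> S \<Longrightarrow> A (f + g) = A f + A g"
    "\<And>c f. f \<in> S \<Longrightarrow> A (cscale c f) = cscale c (A f)"
    "\<And>f. f \<in> S \<Longrightarrow> norm (A f) \<le> K * norm f"
  shows "restrict A S \<in> bounded_ops S S'"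
  by (rule bounded_opsI[where K = K]) (use assms closed_csubspaceD[OF assms(1)] in simp_all)

lemma id_bounded_ops: "closed_csubspace S \<Longrightarrow> (\<lambda>f\<in>S. f) \<in> bounded_ops S S"
  by (rule restrict_bounded_ops[where K = 1]) auto

lemma add_bounded_ops:
  assumes A: "A \<in> bounded_ops S S'" and B: "B \<in> bounded_ops S S'"
    and S: "closed_csubspace S" "closed_csubspace S'"
  shows "(\<lambda>f\<in>S. A f + B f) \<in> bounded_ops S S'"
proof -
  obtain K where K: "0 < K" "\<And>f. f \<in> S \<Longrightarrow> norm (A f) \<le> K * norm f" by (rule bounded_ops_bound[OF A]) blast
  obtain L where L: "0 < L" "\<And>f. f \<in> S \<Longrightarrow> norm (B f) \<le> L * norm f" by (rule bounded_ops_bound[OF B]) blast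
  note D = bounded_opsD[OF A] bounded_opsD[OF B] closed_csubspaceD[OF S(2)]
  show ?thesis
  proof (rule restrict_bounded_ops[where K = "K + L"])
    fix f assume "f \<in> S"
    then show "norm (A f + B f) \<le> (K + L) * norm f"
      using K(2)[of f] L(2)[of f] norm_triangle_ineq[of "A f" "B f"] by (simp add: distrib_right)
  qed (use S D in \<open>simp_all add: cscale_add_right\<close>)
qed

lemma cscale_bounded_ops:
  assumes A: "A \<in> bounded_ops S S'" and S: "closed_csubspace S" "closed_csubspace S'"
  shows "(\<lambda>f\<in>S. cscale c (A f)) \<in> bounded_ops S S'"
proof -
  obtain K where K: "0 < K" "\<And>f. f \<in> S \<Longrightarrow> norm (A f) \<le> K * norm f" by (rule bounded_ops_bound[OF A]) blast
  note D = bounded_opsD[OF A] closed_csubspaceD[OF S(2)]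
  show ?thesis
  proof (rule restrict_bounded_ops[where K = "cmod c * K"])
    fix f assume "f \<in> S"
    then show "norm (cscale c (A f)) \<le> cmod c * K * norm f"
      using mult_left_mono[OF K(2), of f "cmod c"] by (simp add: norm_cscale mult.assoc)
  qed (use S D in \<open>simp_all add: cscale_add_right cscale_cscale mult.commute\<close>)
qed

text \<open>\<open>B g\<close> represents the functional \<open>cinner (A f) g\<close> of
  \<open>f\<close>. Uniqueness of representatives makes \<open>B\<close> linear, and pairing
  \<open>B g\<close> with itself bounds it by the constant of \<open>A\<close>.\<close>

lemma adj_exists:
  assumes S: "closed_csubspace S" "closed_csubspace S'" and A: "A \<in> bounded_ops S S'"
  obtains B where "B \<in> bounded_ops S' S" "\<And>f g. f \<in> S \<Longrightarrow> g \<in> S' \<Longrightarrow> cinner (A f) g = cinner f (B g)"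
proof -
  obtain K where K: "0 < K" "\<And>f. f \<in> S \<Longrightarrow> norm (A f) \<le> K * norm f" by (rule bounded_ops_bound[OF A]) blast
  have "\<exists>h\<in>S. \<forall>f\<in>S. cinner (A f) g = cinner f h" for g
  proof (rule riesz_da[OF S(1), of "\<lambda>f. cinner (A f) g" "K * norm g"])
    fix f assume "f \<in> S"
    then have "norm (A f) * norm g \<le> K * norm f * norm g" using K by (intro mult_right_mono) auto
    then show "cmod (cinner (A f) g) \<le> K * norm g * norm f"
      using cinner_Cauchy_Schwarz[of "A f" g] by (simp add: mult_ac)
  qed (auto simp: bounded_opsD[OF A] cinner_add_left cinner_cscale_left)
  then obtain B where B: "\<And>g. B g \<in> S" "\<And>f g. f \<in> S \<Longrightarrow> cinner (A f) g = cinner f (B g)" by metis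
  note SD = closed_csubspaceD[OF S(1)]
  have "restrict B S' \<in> bounded_ops S' S"
  proof (rule restrict_bounded_ops[OF S(2), where K = K])
    fix f g show "B (f + g) = B f + B g"
      by (rule inner_eq_imp_eq[OF S(1)]) (auto simp: B(1) SD cinner_add_right simp flip: B(2))
    fix c show "B (cscale c f) = cscale c (B f)"
      by (rule inner_eq_imp_eq[OF S(1)]) (auto simp: B(1) SD cinner_cscale_right simp flip: B(2))
    have "norm (B f) * norm (B f) = cmod (cinner (B f) (B f))"
      by (simp add: cinner_self_norm norm_mult power2_eq_square)
    also have "\<dots> = cmod (cinner (A (B f)) f)" by (simp add: B)
    also have "\<dots> \<le> norm (A (B f)) * norm f" by (rule cinner_Cauchy_Schwarz)
    also have "\<dots> \<le> K * norm (B f) * norm f" using K B by (intro mult_right_mono) auto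
    finally show "norm (B f) \<le> K * norm f"
      using K by (cases "B f = 0") (auto simp: mult_ac)
  qed (rule B)
  then show thesis by (rule that) (auto simp: B)
qed

lemma adj_eqI:
  assumes S: "closed_csubspace S"
    and B: "B \<in> bounded_ops S' S" "\<And>f g. f \<in> S \<Longrightarrow> g \<in> S' \<Longrightarrow> cinner (A f) g = cinner f (B g)"
  shows "adj S S' A = B"
  unfolding adj_def
proof (rule the_equality)
  fix B' assume B': "B' \<in> bounded_ops S' S \<and> (\<forall>f\<in>S. \<forall>g\<in>S'. cinner (A f) g = cinner f (B' g))"
  have B'1: "B' \<in> bounded_ops S' S" using B' by blast
  show "B' = B"
  proof (rule bounded_ops_eqI[OF B'1 B(1)])
    fix g assume g: "g \<in> S'"
    show "B' g = B g"
      by (rule inner_eq_imp_eq[OF S]) (use g B B' bounded_opsD(2)[OF B(1)] bounded_opsD(2)[OF B'1] in auto)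
  qed
qed (use B in auto)

lemma
  assumes S: "closed_csubspace S" "closed_csubspace S'" and A: "A \<in> bounded_ops S S'"
  shows adj_bounded_ops: "adj S S' A \<in> bounded_ops S' S"
    and cinner_adj: "f \<in> S \<Longrightarrow> g \<in> S' \<Longrightarrow> cinner (A f) g = cinner f (adj S S' A g)"
    and cinner_adj': "f \<in> S \<Longrightarrow> g \<in> S' \<Longrightarrow> cinner (adj S S' A g) f = cinner g (A f)"
proof -
  obtain B where B: "B \<in> bounded_ops S' S" "\<And>f g. f \<in> S \<Longrightarrow> g \<in> S' \<Longrightarrow> cinner (A f) g = cinner f (B g)"
    by (rule adj_exists[OF S A]) blast
  have eq: "adj S S' A = B" by (rule adj_eqI[OF S(1)]) (use B in auto)
  show "adj S S' A \<in> bounded_ops S' S" using B eq by simp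
  show *: "f \<in> S \<Longrightarrow> g \<in> S' \<Longrightarrow> cinner (A f) g = cinner f (adj S S' A g)" for f g
    using B eq by simp
  show "f \<in> S \<Longrightarrow> g \<in> S' \<Longrightarrow> cinner (adj S S' A g) f = cinner g (A f)"
    using * by (metis cinner_commute)
qed

lemma bounded_ops_continuous_on:
  assumes A: "A \<in> bounded_ops S S'" and S: "closed_csubspace S"
  shows "continuous_on S A"
proof -
  obtain K where K: "0 < K" "\<And>f. f \<in> S \<Longrightarrow> norm (A f) \<le> K * norm f" by (rule bounded_ops_bound[OF A]) blast
  have "K-lipschitz_on S A"
    by (rule lipschitz_onI)
      (use K in \<open>auto simp: dist_norm closed_csubspaceD(5)[OF S] simp flip: bounded_ops_diff[OF A S]\<close>)
  then show ?thesis by (rule lipschitz_on_continuous_on)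
qed

lemma compact_closure_subset:
  fixes X :: "'a::metric_space set"
  assumes "X \<subseteq> C" "compact C"
  shows "compact (closure X)"
proof -
  have "closure X \<subseteq> C" using assms by (simp add: closure_minimal compact_imp_closed)
  then show ?thesis using compact_Int_closed[OF assms(2) closed_closure[of X]] by (simp add: Int_absorb1)
qed

text \<open>\<open>B\<close> maps the unit ball into a ball of radius \<open>K\<close>, whose image
  under \<open>A\<close> is \<open>K\<close> times that of the unit ball.\<close>

lemma compact_ops_comp_right:
  assumes A: "A \<in> compact_ops S' S''" and B: "B \<in> bounded_ops S S'"
    and S: "closed_csubspace S" "closed_csubspace S'"
  shows "compose S A B \<in> compact_ops S S''"
proof -
  have A': "A \<in> bounded_ops S' S''" and C: "compact (closure (A ` (S' \<inter> cball 0 1)))"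
    using A by (auto simp: compact_ops_def)
  obtain K where K: "0 < K" "\<And>f. f \<in> S \<Longrightarrow> norm (B f) \<le> K * norm f" by (rule bounded_ops_bound[OF B]) blast
  have "compose S A B ` (S \<inter> cball 0 1) \<subseteq> (\<lambda>x. K *\<^sub>R x) ` closure (A ` (S' \<inter> cball 0 1))"
  proof (rule image_subsetI)
    fix f assume f: "f \<in> S \<inter> cball 0 1"
    define h where "h = cscale (of_real (1 / K)) (B f)"
    have "K * norm f \<le> K * 1" using f K(1) by (intro mult_left_mono) auto
    then have "norm (B f) \<le> K" using K(2)[of f] f by simp
    then have "norm h \<le> 1" using K(1) by (simp add: h_def norm_cscale norm_divide)
    moreover have "h \<in> S'"
      unfolding h_def using f by (intro closed_csubspaceD(3)[OF S(2)] bounded_opsD(2)[OF B]) simp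
    ultimately have h: "h \<in> S' \<inter> cball 0 1" by simp
    have "B f = cscale (of_real K) h" using K by (simp add: h_def cscale_cscale)
    then have "A (B f) = K *\<^sub>R A h" using h bounded_opsD(5)[OF A'] by (simp add: scaleR_da_def)
    then have "compose S A B f = K *\<^sub>R A h" using f by (simp add: compose_eq)
    moreover have "A h \<in> closure (A ` (S' \<inter> cball 0 1))"
      using h by (intro subsetD[OF closure_subset] imageI)
    ultimately show "compose S A B f \<in> (\<lambda>x. K *\<^sub>R x) ` closure (A ` (S' \<inter> cball 0 1))"
      by (simp only: imageI)
  qed
  then have "compact (closure (compose S A B ` (S \<inter> cball 0 1)))"
    by (rule compact_closure_subset[OF _ compact_scaling[OF C]])
  then show ?thesis using compose_bounded_ops[OF A' B S(1)] by (simp add: compact_ops_def)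
qed

lemma compact_ops_comp_left:
  assumes A: "A \<in> bounded_ops S' S''" and B: "B \<in> compact_ops S S'"
    and S: "closed_csubspace S" "closed_csubspace S'"
  shows "compose S A B \<in> compact_ops S S''"
proof -
  have B': "B \<in> bounded_ops S S'" and C: "compact (closure (B ` (S \<inter> cball 0 1)))"
    using B by (auto simp: compact_ops_def)
  \<comment> \<open>\<open>A\<close> is an operator on \<open>S'\<close> only, so its continuity can
    be used on the closure only after placing the closure inside the closed space
    \<open>S'\<close>.\<close>
  have "closure (B ` (S \<inter> cball 0 1)) \<subseteq> S'"
    using bounded_opsD(2)[OF B'] closed_csubspaceD(4)[OF S(2)] by (intro closure_minimal) auto
  then have "continuous_on (closure (B ` (S \<inter> cball 0 1))) A"
    using bounded_ops_continuous_on[OF A S(2)] continuous_on_subset by blast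
  moreover have "compose S A B ` (S \<inter> cball 0 1) \<subseteq> A ` closure (B ` (S \<inter> cball 0 1))"
    using closure_subset[of "B ` (S \<inter> cball 0 1)"] by (auto simp: compose_eq)
  ultimately have "compact (closure (compose S A B ` (S \<inter> cball 0 1)))"
    using compact_closure_subset compact_continuous_image C by blast
  then show ?thesis using compose_bounded_ops[OF A B' S(1)] by (simp add: compact_ops_def)
qed

section \<open>C*-subalgebras and conjugation by unitaries\<close>

lemma cstar_subalgebraD:
  assumes "cstar_subalgebra S \<A>"
  shows "\<A> \<subseteq> bounded_ops S S"
    "A \<in> \<A> \<Longrightarrow> B \<in> \<A> \<Longrightarrow> (\<lambda>f\<in>S. A f + B f) \<in> \<A>"
    "A \<in> \<A> \<Longrightarrow> (\<lambda>f\<in>S. cscale c (A f)) \<in> \<A>"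
    "A \<in> \<A> \<Longrightarrow> B \<in> \<A> \<Longrightarrow> compose S A B \<in> \<A>"
    "A \<in> \<A> \<Longrightarrow> adj S S A \<in> \<A>"
    "B \<in> bounded_ops S S \<Longrightarrow>
      (\<And>e. e > 0 \<Longrightarrow> \<exists>A\<in>\<A>. \<forall>f\<in>S. norm (A f - B f) \<le> e * norm f) \<Longrightarrow> B \<in> \<A>"
proof -
  note * = assms[unfolded cstar_subalgebra_def]
  show "\<A> \<subseteq> bounded_ops S S" using * by (rule conjunct1)
  show "A \<in> \<A> \<Longrightarrow> B \<in> \<A> \<Longrightarrow> (\<lambda>f\<in>S. A f + B f) \<in> \<A>"
    using *[THEN conjunct2, THEN conjunct1] by blast
  show "A \<in> \<A> \<Longrightarrow> (\<lambda>f\<in>S. cscale c (A f)) \<in> \<A>"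
    using *[THEN conjunct2, THEN conjunct2, THEN conjunct1] by blast
  show "A \<in> \<A> \<Longrightarrow> B \<in> \<A> \<Longrightarrow> compose S A B \<in> \<A>"
    using *[THEN conjunct2, THEN conjunct2, THEN conjunct2, THEN conjunct1] by blast
  show "A \<in> \<A> \<Longrightarrow> adj S S A \<in> \<A>"
    using *[THEN conjunct2, THEN conjunct2, THEN conjunct2, THEN conjunct2, THEN conjunct1] by blast
  show "B \<in> bounded_ops S S \<Longrightarrow>
      (\<And>e. e > 0 \<Longrightarrow> \<exists>A\<in>\<A>. \<forall>f\<in>S. norm (A f - B f) \<le> e * norm f) \<Longrightarrow> B \<in> \<A>"
    using *[THEN conjunct2, THEN conjunct2, THEN conjunct2, THEN conjunct2, THEN conjunct2] by metis
qed

lemma cstar_subalgebra_bounded_ops: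
  assumes "closed_csubspace S"
  shows "cstar_subalgebra S (bounded_ops S S)"
  unfolding cstar_subalgebra_def
proof (intro conjI ballI allI impI)
  fix A B assume "A \<in> bounded_ops S S" "B \<in> bounded_ops S S"
  then show "compose S A B \<in> bounded_ops S S" using assms by (rule compose_bounded_ops)
qed (simp_all add: assms add_bounded_ops cscale_bounded_ops adj_bounded_ops)

text \<open>The closure conditions pass to intersections, and \<open>bounded_ops S S\<close> belongs
  to the intersected family, which keeps the intersection within the bounded operators.\<close>

lemma cstar_subalgebra_hull:
  assumes "closed_csubspace S" "G \<subseteq> bounded_ops S S"
  shows "cstar_subalgebra S (cstar_subalgebra S hull G)"
proof -
  define F where "F = {\<A>. cstar_subalgebra S \<A> \<and> G \<subseteq> \<A>}"
  have bd: "bounded_ops S S \<in> F" using assms by (simp add: F_def cstar_subalgebra_bounded_ops)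
  have "cstar_subalgebra S \<A>" if "\<A> \<in> F" for \<A> using that by (simp add: F_def)
  note D = cstar_subalgebraD[OF this]
  have "cstar_subalgebra S (\<Inter>F)"
    unfolding cstar_subalgebra_def
  proof (intro conjI ballI allI impI)
    show "\<Inter>F \<subseteq> bounded_ops S S" using bd by (rule Inter_lower)
    fix A assume A: "A \<in> \<Inter>F"
    show "(\<lambda>f\<in>S. cscale c (A f)) \<in> \<Inter>F" for c
      by (rule InterI, rule D(3)) (use A in simp_all)
    show "adj S S A \<in> \<Inter>F"
      by (rule InterI, rule D(5)) (use A in simp_all)
    fix B assume B: "B \<in> \<Inter>F"
    show "(\<lambda>f\<in>S. A f + B f) \<in> \<Inter>F"
      by (rule InterI, rule D(2)) (use A B in simp_all)
    show "compose S A B \<in> \<Inter>F"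
      by (rule InterI, rule D(4)) (use A B in simp_all)
  next
    fix B assume B: "B \<in> bounded_ops S S"
      "\<forall>e>0. \<exists>A\<in>\<Inter>F. \<forall>f\<in>S. norm (A f - B f) \<le> e * norm f"
    show "B \<in> \<Inter>F"
    proof
      fix \<A> assume \<A>: "\<A> \<in> F"
      show "B \<in> \<A>"
      proof (rule D(6)[OF \<A> B(1)])
        fix e :: real assume "0 < e"
        then obtain A where "A \<in> \<Inter>F" "\<forall>f\<in>S. norm (A f - B f) \<le> e * norm f" using B(2) by blast
        with \<A> show "\<exists>A\<in>\<A>. \<forall>f\<in>S. norm (A f - B f) \<le> e * norm f" by (intro bexI[of _ A]) auto
      qed
    qed
  qed
  then show ?thesis by (simp add: hull_def F_def)
qed

lemma unitary_adj:
  assumes S: "closed_csubspace S" and U: "unitary_op S S U" and f: "f \<in> S"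
  shows "adj S S U (U f) = f" "U (adj S S U f) = f" "norm (U f) = norm f" "norm (adj S S U f) = norm f"
proof -
  have Ub: "U \<in> bounded_ops S S" and Us: "U ` S = S"
    and Ui: "\<And>f g. f \<in> S \<Longrightarrow> g \<in> S \<Longrightarrow> cinner (U f) (U g) = cinner f g"
    using U by (auto simp: unitary_op_def)
  note V = adj_bounded_ops[OF S S Ub]
  have 1: "adj S S U (U f) = f" if f: "f \<in> S" for f
  proof (rule inner_eq_imp_eq[OF S])
    have Uf: "U f \<in> S" using bounded_opsD(2)[OF Ub f] .
    then show "adj S S U (U f) \<in> S" by (rule bounded_opsD(2)[OF V])
    fix h assume h: "h \<in> S"
    show "cinner h (adj S S U (U f)) = cinner h f"
      using cinner_adj[OF S S Ub h Uf] Ui[OF h f] by simp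
  qed (rule f)
  have n: "norm (U f) = norm f" if "f \<in> S" for f
  proof -
    have "complex_of_real ((norm (U f))\<^sup>2) = of_real ((norm f)\<^sup>2)"
      unfolding cinner_self_norm[symmetric] using Ui that by simp
    then have "(norm (U f))\<^sup>2 = (norm f)\<^sup>2" using of_real_eq_iff by blast
    then show ?thesis by simp
  qed
  show "adj S S U (U f) = f" "norm (U f) = norm f" using 1 n f by auto
  obtain g where g: "g \<in> S" "f = U g" using Us f by auto
  show "U (adj S S U f) = f" "norm (adj S S U f) = norm f" using g 1 n by auto
qed

text \<open>Conjugation by a unitary is an isometric *-homomorphism, so the bounded operators whose
  conjugate lies in the hull form a C*-subalgebra \<open>\<B>\<close>; it contains \<open>G\<close>,
  hence the whole hull.\<close>

lemma conj_hull_subset: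
  assumes S: "closed_csubspace S" and U: "unitary_op S S U" and G: "G \<subseteq> bounded_ops S S"
    and step: "\<And>A. A \<in> G \<Longrightarrow> compose S (adj S S U) (compose S A U) \<in> cstar_subalgebra S hull G"
    and A: "A \<in> cstar_subalgebra S hull G"
  shows "compose S (adj S S U) (compose S A U) \<in> cstar_subalgebra S hull G"
proof -
  define \<T> where "\<T> = cstar_subalgebra S hull G"
  define V where "V = adj S S U"
  define \<kappa> where "\<kappa> A = compose S V (compose S A U)" for A
  define \<B> where "\<B> = {A \<in> bounded_ops S S. \<kappa> A \<in> \<T>}"
  have "cstar_subalgebra S \<T>" unfolding \<T>_def by (rule cstar_subalgebra_hull[OF S G])
  note T = cstar_subalgebraD[OF this]
  have Ub: "U \<in> bounded_ops S S" using U by (simp add: unitary_op_def)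
  have Vb: "V \<in> bounded_ops S S" unfolding V_def by (rule adj_bounded_ops[OF S S Ub])
  note UD = bounded_opsD[OF Ub] and VD = bounded_opsD[OF Vb] and SD = closed_csubspaceD[OF S]
  note UV = unitary_adj[OF S U, folded V_def]
  have \<kappa>: "\<kappa> A f = V (A (U f))" if "f \<in> S" for A f using that by (simp add: \<kappa>_def compose_eq)
  have \<kappa>_out: "\<kappa> A f = undefined" if "f \<notin> S" for A f using that by (simp add: \<kappa>_def compose_def)
  have \<kappa>b: "\<kappa> A \<in> bounded_ops S S" if "A \<in> bounded_ops S S" for A
    unfolding \<kappa>_def by (intro compose_bounded_ops[of _ S] that Ub Vb S)
  have "cstar_subalgebra S \<B>"
    unfolding cstar_subalgebra_def
  proof (intro conjI ballI allI impI)
    show "\<B> \<subseteq> bounded_ops S S" by (auto simp: \<B>_def)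
  next
    fix A B assume "A \<in> \<B>" "B \<in> \<B>"
    then have AB: "A \<in> bounded_ops S S" "B \<in> bounded_ops S S" "\<kappa> A \<in> \<T>" "\<kappa> B \<in> \<T>"
      by (auto simp: \<B>_def)
    note AD = bounded_opsD[OF AB(1)] and BD = bounded_opsD[OF AB(2)]
    have "\<kappa> (\<lambda>f\<in>S. A f + B f) = (\<lambda>f\<in>S. \<kappa> A f + \<kappa> B f)"
      by (rule ext) (simp add: \<kappa> \<kappa>_out UD VD AD BD restrict_def)
    then show "(\<lambda>f\<in>S. A f + B f) \<in> \<B>" using AB T S by (simp add: \<B>_def add_bounded_ops)
    have "\<kappa> (compose S A B) = compose S (\<kappa> A) (\<kappa> B)"
      by (rule ext) (simp add: \<kappa> \<kappa>_out UD VD AD BD UV compose_def)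
    then show "compose S A B \<in> \<B>" using AB T S by (simp add: \<B>_def compose_bounded_ops[of _ S])
  next
    fix A c assume "A \<in> \<B>"
    then have A: "A \<in> bounded_ops S S" "\<kappa> A \<in> \<T>" by (auto simp: \<B>_def)
    note AD = bounded_opsD[OF A(1)]
    have "\<kappa> (\<lambda>f\<in>S. cscale c (A f)) = (\<lambda>f\<in>S. cscale c (\<kappa> A f))"
      by (rule ext) (simp add: \<kappa> \<kappa>_out UD VD AD restrict_def)
    then show "(\<lambda>f\<in>S. cscale c (A f)) \<in> \<B>" using A T S by (simp add: \<B>_def cscale_bounded_ops)
  next
    fix A assume "A \<in> \<B>"
    then have A: "A \<in> bounded_ops S S" "\<kappa> A \<in> \<T>" by (auto simp: \<B>_def)
    note A' = adj_bounded_ops[OF S S A(1)]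
    have "adj S S (\<kappa> A) = \<kappa> (adj S S A)"
    proof (rule adj_eqI[OF S \<kappa>b[OF A']])
      fix f g assume fg: "f \<in> S" "g \<in> S"
      have Af: "A (U f) \<in> S" and A'g: "adj S S A (U g) \<in> S"
        using fg UD(2) bounded_opsD(2)[OF A(1)] bounded_opsD(2)[OF A'] by auto
      have "cinner (\<kappa> A f) g = cinner (A (U f)) (U g)"
        using fg cinner_adj'[OF S S Ub fg(2) Af] by (simp add: \<kappa> V_def)
      also have "\<dots> = cinner (U f) (adj S S A (U g))"
        using fg UD(2) by (intro cinner_adj[OF S S A(1)]) auto
      also have "\<dots> = cinner f (\<kappa> (adj S S A) g)"
        using fg cinner_adj[OF S S Ub fg(1) A'g] by (simp add: \<kappa> V_def)
      finally show "cinner (\<kappa> A f) g = cinner f (\<kappa> (adj S S A) g)" .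
    qed
    then show "adj S S A \<in> \<B>" using A A' T(5)[of "\<kappa> A"] by (simp add: \<B>_def)
  next
    fix B assume B: "B \<in> bounded_ops S S" "\<forall>e>0. \<exists>A\<in>\<B>. \<forall>f\<in>S. norm (A f - B f) \<le> e * norm f"
    have "\<kappa> B \<in> \<T>"
    proof (rule T(6)[OF \<kappa>b[OF B(1)]])
      fix e :: real assume "0 < e"
      then obtain A where A: "A \<in> \<B>" "\<And>f. f \<in> S \<Longrightarrow> norm (A f - B f) \<le> e * norm f" using B(2) by blast
      have Ab: "A \<in> bounded_ops S S" using A by (simp add: \<B>_def)
      have "norm (\<kappa> A f - \<kappa> B f) \<le> e * norm f" if f: "f \<in> S" for f
      proof -
        have in_S: "A (U f) \<in> S" "B (U f) \<in> S"
          using UD(2)[OF f] bounded_opsD(2)[OF Ab] bounded_opsD(2)[OF B(1)] by auto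
        have "\<kappa> A f - \<kappa> B f = V (A (U f) - B (U f))"
          using f bounded_ops_diff[OF Vb S in_S] by (simp add: \<kappa>)
        then have "norm (\<kappa> A f - \<kappa> B f) = norm (A (U f) - B (U f))"
          using UV(4) in_S SD(5) by simp
        also have "\<dots> \<le> e * norm (U f)" using A(2) UD(2) f by blast
        finally show ?thesis using UV(3)[OF f] by simp
      qed
      then show "\<exists>A\<in>\<T>. \<forall>f\<in>S. norm (A f - \<kappa> B f) \<le> e * norm f"
        using A(1) by (intro bexI[of _ "\<kappa> A"] ballI) (simp_all add: \<B>_def)
    qed
    with B show "B \<in> \<B>" by (simp add: \<B>_def)
  qed
  moreover have "G \<subseteq> \<B>"
    using G step unfolding \<B>_def \<kappa>_def \<T>_def V_def by blast
  ultimately have "\<T> \<subseteq> \<B>" unfolding \<T>_def by (metis hull_minimal)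
  with A show ?thesis unfolding \<B>_def \<kappa>_def \<T>_def V_def by blast
qed

section \<open>Operators diagonal in the monomials\<close>

definition diag :: "(nat \<times> nat \<Rightarrow> complex) \<Rightarrow> da \<Rightarrow> da" where
  "diag \<nu> f = of_coeffs (\<lambda>p. \<nu> p * coeffs2 f p)"

lemma
  assumes "\<And>p. cmod (\<nu> p) \<le> K"
  shows coeffs2_diag: "coeffs2 (diag \<nu> f) p = \<nu> p * coeffs2 f p"
    and norm_diag_le: "norm (diag \<nu> f) \<le> K * norm f"
proof -
  have K: "0 \<le> K" using order_trans[OF norm_ge_zero assms[of undefined]] .
  have b: "cmod (\<nu> p * coeffs2 f p) \<le> K * cmod (coeffs2 f p)" for p
    unfolding norm_mult using assms by (rule mult_right_mono) simp
  note * = dominated_da_coeffs[where a = "\<lambda>p. \<nu> p * coeffs2 f p" and f = f and K = K, OF K b]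
  show "coeffs2 (diag \<nu> f) p = \<nu> p * coeffs2 f p"
    unfolding diag_def by (simp add: coeffs2_of_coeffs[OF *(1)])
  show "norm (diag \<nu> f) \<le> K * norm f" unfolding diag_def by (rule *(2))
qed

lemma
  assumes "\<And>p. cmod (\<nu> p) \<le> K"
  shows diag_add: "diag \<nu> (f + g) = diag \<nu> f + diag \<nu> g"
    and diag_cscale: "diag \<nu> (cscale c f) = cscale c (diag \<nu> f)"
    and diag_diff: "diag \<nu> (f - g) = diag \<nu> f - diag \<nu> g"
  by (rule da_eqI; simp add: coeffs2_diag[OF assms] coeffs2_simps algebra_simps)+

lemma diag_diag:
  assumes "\<And>p. cmod (\<nu> p) \<le> K" "\<And>p. cmod (\<mu> p) \<le> L"
  shows "diag \<mu> (diag \<nu> f) = diag (\<lambda>p. \<mu> p * \<nu> p) f"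
proof -
  have *: "cmod (\<mu> p * \<nu> p) \<le> L * K" for p
    unfolding norm_mult using assms order_trans[OF norm_ge_zero assms(2)] by (intro mult_mono) auto
  show ?thesis
    by (rule da_eqI)
      (simp add: coeffs2_diag[OF assms(1)] coeffs2_diag[OF assms(2)] coeffs2_diag[OF *] mult.assoc)
qed

lemma diag_one [simp]: "diag (\<lambda>_. 1) f = f"
  by (rule da_eqI) (simp add: coeffs2_diag[where K = 1])

lemma cinner_diag:
  assumes "\<And>p. cmod (\<nu> p) \<le> K"
  shows "cinner (diag \<nu> f) g = cinner f (diag (\<lambda>p. cnj (\<nu> p)) g)"
  unfolding cinner_def using assms
  by (simp add: coeffs2_diag[where K = K] mult_ac)

lemma norm_diag_unimodular:
  assumes "\<And>p. cmod (\<nu> p) = 1"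
  shows "norm (diag \<nu> f) = norm f"
proof -
  have "cnj (\<nu> p) * \<nu> p = 1" for p
    using complex_norm_square[of "\<nu> p"] assms[of p] by (simp add: mult.commute)
  then have "diag (\<lambda>p. cnj (\<nu> p)) (diag \<nu> f) = f"
    using assms by (subst diag_diag[where K = 1 and L = 1]) auto
  then have "norm f \<le> 1 * norm (diag \<nu> f)"
    using norm_diag_le[of "\<lambda>p. cnj (\<nu> p)" 1 "diag \<nu> f"] assms by simp
  then show ?thesis using norm_diag_le[of \<nu> 1 f] assms by simp
qed

section \<open>Multiplication by the coordinate functions\<close>

lemma
  shows coeffs2_mult_z1: "coeffs2 (mult_z1 f) p = (if fst p = 0 then 0 else coeffs2 f (fst p - 1, snd p))"
    and coeffs2_mult_z2: "coeffs2 (mult_z2 f) p = (if snd p = 0 then 0 else coeffs2 f (fst p, snd p - 1))"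
proof -
  let ?b = "\<lambda>p. if fst p = 0 then 0 else coeffs2 f (fst p - 1, snd p)"
  let ?c = "\<lambda>p. if snd p = 0 then 0 else coeffs2 f (fst p, snd p - 1)"
  have b: "?b \<in> da_coeffs \<and> power_series2 ?b z = fst z * power_series2 (coeffs2 f) z" for z
    by (intro conjI power_series2_embed[OF coeffs2_in, where h = "\<lambda>p. (Suc (fst p), snd p)"])
      (auto intro!: injI simp: prod_eq_iff image_iff monomial_norm2_Suc gr0_conv_Suc)
  have c: "?c \<in> da_coeffs \<and> power_series2 ?c z = snd z * power_series2 (coeffs2 f) z" for z
    by (intro conjI power_series2_embed[OF coeffs2_in, where h = "\<lambda>p. (fst p, Suc (snd p))"])
      (auto intro!: injI simp: prod_eq_iff image_iff monomial_norm2_Suc gr0_conv_Suc)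
  have "coeffs2 (mult_z1 f) = ?b"
    by (rule coeffs2_eqI) (use b in \<open>auto simp: mult_z1.rep_eq fun_eq_iff da_fun_coeffs2[of f]\<close>)
  then show "coeffs2 (mult_z1 f) p = ?b p" by simp
  have "coeffs2 (mult_z2 f) = ?c"
    by (rule coeffs2_eqI) (use c in \<open>auto simp: mult_z2.rep_eq fun_eq_iff da_fun_coeffs2[of f]\<close>)
  then show "coeffs2 (mult_z2 f) p = ?c p" by simp
qed

lemma mult_z1_add: "mult_z1 (f + g) = mult_z1 f + mult_z1 g"
  and mult_z2_add: "mult_z2 (f + g) = mult_z2 f + mult_z2 g"
  and mult_z1_cscale: "mult_z1 (cscale c f) = cscale c (mult_z1 f)"
  and mult_z2_cscale: "mult_z2 (cscale c f) = cscale c (mult_z2 f)"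
  by (rule da_eqI; simp add: coeffs2_mult_z1 coeffs2_mult_z2 coeffs2_simps)+

text \<open>Raising an exponent only decreases the weight of a monomial, which makes both coordinate
  multiplications contractions.\<close>

lemma norm_embed_le:
  assumes "inj h" "\<And>p. monomial_norm2 (h p) \<le> monomial_norm2 p"
    and "\<And>p. coeffs2 g (h p) = coeffs2 f p" "\<And>p. p \<notin> range h \<Longrightarrow> coeffs2 g p = 0"
  shows "norm g \<le> norm f"
proof (rule power2_le_imp_le)
  have "(norm g)\<^sup>2 = (\<Sum>\<^sub>\<infinity>p\<in>range h. (cmod (coeffs2 g p))\<^sup>2 * monomial_norm2 p)"
    unfolding norm_da_square by (rule infsum_cong_neutral) (auto simp: assms(4))
  also have "\<dots> = (\<Sum>\<^sub>\<infinity>p. (cmod (coeffs2 g (h p)))\<^sup>2 * monomial_norm2 (h p))"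
    by (subst infsum_reindex[OF assms(1)]) (simp add: o_def)
  also have "\<dots> \<le> (norm f)\<^sup>2"
    unfolding norm_da_square
  proof (rule infsum_mono)
    have "(\<lambda>p. (cmod (coeffs2 g p))\<^sup>2 * monomial_norm2 p) summable_on range h"
      using coeffs2_square_summable by (rule summable_on_subset_banach) simp
    then show "(\<lambda>p. (cmod (coeffs2 g (h p)))\<^sup>2 * monomial_norm2 (h p)) summable_on UNIV"
      by (simp add: summable_on_reindex[OF assms(1)] o_def)
  qed (auto simp: assms coeffs2_square_summable intro: mult_left_mono)
  finally show "(norm g)\<^sup>2 \<le> (norm f)\<^sup>2" .
qed simp

lemma norm_mult_z1_le: "norm (mult_z1 f) \<le> norm f"
  by (rule norm_embed_le[where h = "\<lambda>p. (Suc (fst p), snd p)"])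
    (auto intro!: injI simp: prod_eq_iff image_iff monomial_norm2_Suc gr0_conv_Suc coeffs2_mult_z1)

lemma norm_mult_z2_le: "norm (mult_z2 f) \<le> norm f"
  by (rule norm_embed_le[where h = "\<lambda>p. (fst p, Suc (snd p))"])
    (auto intro!: injI simp: prod_eq_iff image_iff monomial_norm2_Suc gr0_conv_Suc coeffs2_mult_z2)

section \<open>Compactness criteria\<close>

lemma compact_finite_sums:
  fixes C :: "'i \<Rightarrow> 'a::real_normed_vector set"
  assumes "finite I" "\<And>i. i \<in> I \<Longrightarrow> compact (C i)"
  shows "compact {sum x I | x. \<forall>i\<in>I. x i \<in> C i}"
  using assms
proof (induction I)
  case empty
  then show ?case by simp
next
  case (insert j I)
  have "{sum x (insert j I) | x. \<forall>i\<in>insert j I. x i \<in> C i}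
      = {a + b | a b. a \<in> C j \<and> b \<in> {sum x I | x. \<forall>i\<in>I. x i \<in> C i}}" (is "?L = ?R")
  proof
    show "?L \<subseteq> ?R" using insert.hyps by auto
    show "?R \<subseteq> ?L"
    proof
      fix z assume "z \<in> ?R"
      then obtain a x where z: "z = a + sum x I" "a \<in> C j" "\<forall>i\<in>I. x i \<in> C i" by blast
      have "sum (x(j := a)) I = sum x I" by (rule sum.cong) (use insert.hyps in auto)
      then have "sum (x(j := a)) (insert j I) = z" using insert.hyps z by simp
      then show "z \<in> ?L" using z insert.hyps
        by (intro CollectI exI[of _ "x(j := a)"]) auto
    qed
  qed
  moreover have "compact ?R"
    by (rule compact_sums) (use insert in auto)
  ultimately show ?case by simp
qed

text \<open>Total boundedness passes to sets that are approximated by compact ones to any accuracy;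
  the \<open>C\<close> will be images of balls under finite-rank truncations.\<close>

lemma compact_closure_approx:
  fixes X :: "'a::complete_space set"
  assumes "\<And>e. 0 < e \<Longrightarrow> \<exists>C. compact C \<and> (\<forall>x\<in>X. \<exists>c\<in>C. dist c x < e)"
  shows "compact (closure X)"
  unfolding compact_eq_totally_bounded
proof (intro conjI allI impI)
  show "complete (closure X)" by (simp add: complete_eq_closed)
  fix e :: real assume e: "0 < e"
  then obtain C where C: "compact C" "\<forall>x\<in>X. \<exists>c\<in>C. dist c x < e / 3" using assms[of "e / 3"] by auto
  from C(1) e obtain F where F: "finite F" "C \<subseteq> (\<Union>x\<in>F. ball x (e / 3))"
    unfolding compact_eq_totally_bounded by (meson divide_pos_pos zero_less_numeral)
  \<comment> \<open>Closed balls, since a finite union of them is closed and absorbs the closure;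
    the radius 2e/3 still fits into open balls of radius e.\<close>
  have "X \<subseteq> (\<Union>x\<in>F. cball x (2 * e / 3))"
  proof
    fix x assume "x \<in> X"
    then obtain c where c: "c \<in> C" "dist c x < e / 3" using C(2) by blast
    then obtain y where y: "y \<in> F" "dist y c < e / 3" using F(2) by auto
    have "dist y x \<le> 2 * e / 3" using dist_triangle[of y x c] c y by simp
    then show "x \<in> (\<Union>x\<in>F. cball x (2 * e / 3))" using y by auto
  qed
  then have "closure X \<subseteq> (\<Union>x\<in>F. cball x (2 * e / 3))"
    using F(1) by (intro closure_minimal closed_UN) auto
  also have "\<dots> \<subseteq> (\<Union>x\<in>F. ball x e)" using e by force
  finally show "\<exists>k. finite k \<and> closure X \<subseteq> (\<Union>x\<in>k. ball x e)" using F(1) by blast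
qed

lemma compact_cscale_disc: "compact ((\<lambda>c. cscale c f) ` cball 0 r)"
proof (rule compact_continuous_image)
  have "(norm f)-lipschitz_on (cball 0 r) (\<lambda>c. cscale c f)"
  proof (rule lipschitz_onI)
    fix x y :: complex
    have "cscale x f - cscale y f = cscale (x - y) f"
      by (rule da_eqI) (simp add: coeffs2_simps algebra_simps)
    then show "dist (cscale x f) (cscale y f) \<le> norm f * dist x y"
      by (simp add: dist_norm norm_cscale mult.commute)
  qed simp
  then show "continuous_on (cball 0 r) (\<lambda>c. cscale c f)" by (rule lipschitz_on_continuous_on)
qed simp

lemma monomial_norm2_le_1: "monomial_norm2 p \<le> 1"
  by (simp add: monomial_norm2_def case_prod_unfold Suc_le_eq zero_less_binomial)

section \<open>Orthogonal complements of the ideals in terms of coefficients\<close>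

lemma cinner_monomial:
  "cinner f (da_of_poly (monom (monom c n) m)) = cnj c * (coeffs2 f (m, n) * of_real (monomial_norm2 (m, n)))"
proof -
  have *: "da_of_poly (monom (monom c n) m) = cscale c (da_of_poly (monom (monom 1 n) m))"
    by (auto simp: da_fun_inject[symmetric] da_of_poly.rep_eq cscale.rep_eq fun_eq_iff poly_monom poly_power)
  have "cinner f (da_of_poly (monom (monom 1 n) m)) = coeffs2 f (m, n) * of_real (monomial_norm2 (m, n))"
    unfolding cinner_def coeffs2_monomial
    by (subst infsum_cong_neutral[where T = "{(m, n)}"
          and g = "\<lambda>p. coeffs2 f p * of_real (monomial_norm2 p)"]) auto
  then show ?thesis by (simp add: * cinner_cscale_right)
qed

lemma da_of_poly_add: "da_of_poly (p + q) = da_of_poly p + da_of_poly q"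
  by (auto simp: da_fun_inject[symmetric] da_of_poly.rep_eq plus_da.rep_eq fun_eq_iff)

lemma da_of_poly_diff: "da_of_poly (p - q) = da_of_poly p - da_of_poly q"
  by (auto simp: da_fun_inject[symmetric] da_of_poly.rep_eq minus_da.rep_eq fun_eq_iff)

lemma da_of_poly_zero: "da_of_poly 0 = 0"
  by (auto simp: da_fun_inject[symmetric] da_of_poly.rep_eq zero_da.rep_eq fun_eq_iff)

text \<open>In these weighted coefficients \<open>I(t)\<^sup>\<bottom>\<close> is cut out by a one-step recursion in the first index.\<close>

definition wcoeff :: "da \<Rightarrow> nat \<Rightarrow> nat \<Rightarrow> complex" where
  "wcoeff f m n = coeffs2 f (m, n) * of_real (monomial_norm2 (m, n))"

text \<open>Pairing with a monomial multiple of the generator compares two weighted coefficients,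
  and these multiples span the ideal. The second argument of \<open>cinner\<close> is conjugated, so
  \<open>cis t\<close> turns into \<open>cis (- t)\<close>.\<close>

lemma I_perp_iff:
  "f \<in> I_perp k \<epsilon> t \<longleftrightarrow> (\<forall>m n. wcoeff f (m + k) n = of_real \<epsilon> * cis (- t) * wcoeff f m n)"
proof -
  have mono: "cinner f (da_of_poly (monom (monom a n) m * ideal_gen k \<epsilon> t))
      = cnj a * (wcoeff f (m + k) n - of_real \<epsilon> * cis (- t) * wcoeff f m n)" for a n m
  proof -
    have "monom (monom a n) m * ideal_gen k \<epsilon> t
        = monom (monom a n) (m + k) - monom (monom (a * (of_real \<epsilon> * cis t)) n) m"
      by (simp add: ideal_gen_def right_diff_distrib mult_monom smult_monom mult_ac add.commute
          flip: monom_0)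
    then show ?thesis
      by (simp only: da_of_poly_diff cinner_diff_right cinner_monomial wcoeff_def)
        (simp add: cis_cnj right_diff_distrib mult_ac)
  qed
  show ?thesis
  proof
    assume f: "f \<in> I_perp k \<epsilon> t"
    have "cinner f (da_of_poly (monom (monom 1 n) m * ideal_gen k \<epsilon> t)) = 0" for m n
      using f by (auto simp: I_perp_def ortho_def principal_ideal_def)
    then show "\<forall>m n. wcoeff f (m + k) n = of_real \<epsilon> * cis (- t) * wcoeff f m n"
      by (simp add: mono)
  next
    assume *: "\<forall>m n. wcoeff f (m + k) n = of_real \<epsilon> * cis (- t) * wcoeff f m n"
    have monom_sum: "(\<Sum>i\<le>N. monom (g i) m) = monom (\<Sum>i\<le>N. g i) m" for N m and g :: "nat \<Rightarrow> 'b::comm_monoid_add"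
      by (induction N) (simp_all add: add_monom)
    \<comment> \<open>The multipliers that give elements orthogonal to \<open>f\<close> are closed
      under sums; summing monomials first in the inner and then in the outer variable reaches every
      polynomial.\<close>
    define Z where "Z = {q. cinner f (da_of_poly (q * ideal_gen k \<epsilon> t)) = 0}"
    have mono_Z: "monom (monom a n) m \<in> Z" for a n m using * by (simp add: Z_def mono)
    have add_Z: "p + q \<in> Z" if "p \<in> Z" "q \<in> Z" for p q
      using that by (simp add: Z_def distrib_right da_of_poly_add cinner_add_right)
    have "0 \<in> Z" by (simp add: Z_def da_of_poly_zero)
    then have sum_Z: "sum g A \<in> Z" if "\<And>i. i \<in> A \<Longrightarrow> g i \<in> Z" for g and A :: "nat set"
      using that by (induction A rule: infinite_finite_induct) (auto simp: add_Z)
    have "monom r m \<in> Z" for r m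
    proof -
      have "(\<Sum>i\<le>degree r. monom (monom (coeff r i) i) m) \<in> Z" by (intro sum_Z mono_Z)
      also have "(\<Sum>i\<le>degree r. monom (monom (coeff r i) i) m) = monom (\<Sum>i\<le>degree r. monom (coeff r i) i) m"
        by (rule monom_sum)
      finally show ?thesis by (simp add: poly_as_sum_of_monoms)
    qed
    then have "(\<Sum>i\<le>degree q. monom (coeff q i) i) \<in> Z" for q by (intro sum_Z)
    then have "q \<in> Z" for q by (simp add: poly_as_sum_of_monoms)
    then show "f \<in> I_perp k \<epsilon> t"
      by (auto simp: I_perp_def ortho_def principal_ideal_def Z_def)
  qed
qed

lemma closed_csubspace_I_perp: "closed_csubspace (I_perp k \<epsilon> t)"
  unfolding I_perp_def by (rule closed_csubspace_ortho)

text \<open>If the operator and its adjoint, the diagonal operator with conjugate symbol, both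
  preserve \<open>S\<close>, then \<open>S\<close> is a reducing subspace.\<close>

lemma proj_diag:
  assumes S: "closed_csubspace S" and b: "\<And>p. cmod (\<nu> p) \<le> K"
    and inv: "\<And>f. f \<in> S \<Longrightarrow> diag \<nu> f \<in> S" "\<And>f. f \<in> S \<Longrightarrow> diag (\<lambda>p. cnj (\<nu> p)) f \<in> S"
  shows "proj S (diag \<nu> f) = diag \<nu> (proj S f)"
proof (rule proj_eqI[OF S])
  show "diag \<nu> (proj S f) \<in> S" by (intro inv proj_in S)
  fix h assume h: "h \<in> S"
  have "cinner (diag \<nu> f - diag \<nu> (proj S f)) h = cinner (f - proj S f) (diag (\<lambda>p. cnj (\<nu> p)) h)"
    by (simp only: diag_diff[OF b, symmetric] cinner_diag[OF b])
  also have "\<dots> = 0" using cinner_proj[OF S inv(2)[OF h]] by (simp add: cinner_diff_left)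
  finally show "cinner (diag \<nu> f - diag \<nu> (proj S f)) h = 0" .
qed

lemma compression_bounded_ops:
  assumes S: "closed_csubspace S"
    and M: "\<And>f g. M (f + g) = M f + M g" "\<And>c f. M (cscale c f) = cscale c (M f)"
      "\<And>f. norm (M f) \<le> norm f"
  shows "compression S M \<in> bounded_ops S S"
  unfolding compression_def
proof (rule restrict_bounded_ops[OF S, where K = 1])
  fix f show "norm (proj S (M f)) \<le> 1 * norm f"
    using norm_proj_le[OF S, of "M f"] M(3)[of f] by simp
qed (simp_all add: M proj_add proj_cscale proj_in S)

section \<open>Parallel transport\<close>

lemma quadratic_error_has_vector_derivative:
  fixes f :: "real \<Rightarrow> 'a::real_normed_vector"
  assumes "\<And>s. norm (f s - f t - (s - t) *\<^sub>R v) \<le> K * (s - t)\<^sup>2"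
  shows "(f has_vector_derivative v) (at t)"
  unfolding has_vector_derivative_def has_derivative_iff_norm
proof (intro conjI)
  show "bounded_linear (\<lambda>x. x *\<^sub>R v)" by (rule bounded_linear_scaleR_left)
  show "((\<lambda>y. norm (f y - f t - (y - t) *\<^sub>R v) / norm (y - t)) \<longlongrightarrow> 0) (at t)"
  proof (rule Lim_null_comparison)
    show "\<forall>\<^sub>F y in at t. norm (norm (f y - f t - (y - t) *\<^sub>R v) / norm (y - t)) \<le> K * \<bar>y - t\<bar>"
      using assms
      by (intro eventually_at_filter[THEN iffD2] always_eventually)
        (simp add: divide_le_eq power2_eq_square mult.assoc)
    show "((\<lambda>y. K * \<bar>y - t\<bar>) \<longlongrightarrow> 0) (at t)"
      by (auto intro!: tendsto_eq_intros)
  qed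
qed

lemma monomial_norm2_neq_0 [simp]: "monomial_norm2 p \<noteq> 0"
  using monomial_norm2_pos[of p] by simp

lemma cis_Taylor: "cmod (cis x - 1 - \<i> * of_real x) \<le> x\<^sup>2"
  using Taylor_exp[of "\<i> * of_real x" 1] by (simp add: cis_conv_exp norm_mult algebra_simps power2_eq_square)

text \<open>
  Coefficient families living on one row \<open>z\<^sub>2\<^sup>n\<close> with geometric decay. They are stable under multiplication
  by the linearly growing \<open>phase\<close> below, so transporting them gives smooth curves.
\<close>

definition row_decay :: "nat \<Rightarrow> (nat \<times> nat \<Rightarrow> complex) \<Rightarrow> bool" where
  "row_decay n a \<longleftrightarrow> (\<forall>m l. l \<noteq> n \<longrightarrow> a (m, l) = 0) \<and>
    (\<exists>C x. 0 < x \<and> x < 1 \<and> (\<forall>m. (cmod (a (m, n)) * monomial_norm2 (m, n))\<^sup>2 \<le> C * x ^ m))"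

lemma row_decay_da_coeffs:
  assumes "row_decay n a"
  shows "a \<in> da_coeffs"
proof -
  obtain C x where 0: "\<And>m l. l \<noteq> n \<Longrightarrow> a (m, l) = 0" and x: "0 < x" "x < 1"
    and C: "\<And>m. (cmod (a (m, n)) * monomial_norm2 (m, n))\<^sup>2 \<le> C * x ^ m"
    using assms unfolding row_decay_def by blast
  \<comment> \<open>\<open>summable_inverse_weight\<close> sums over both exponents; on a single row
    \<open>y ^ n\<close> is a constant, so any positive \<open>y\<close> with
    \<open>x + y < 1\<close> will do.\<close>
  define y where "y = (1 - x) / 2"
  have y: "0 < y" "x + y < 1" using x by (simp_all add: y_def field_simps)
  have C0: "0 \<le> C" using order_trans[OF zero_le_power2 C[of 0]] by simp
  have le: "(cmod (a p))\<^sup>2 * monomial_norm2 p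
      \<le> (C / y ^ n) * (x ^ fst p * y ^ snd p / monomial_norm2 p)" for p
  proof (cases "snd p = n")
    case True
    then obtain m where p: "p = (m, n)" by (metis prod.collapse)
    have w: "0 < monomial_norm2 p" by (rule monomial_norm2_pos)
    have "(cmod (a p))\<^sup>2 * monomial_norm2 p = (cmod (a p) * monomial_norm2 p)\<^sup>2 / monomial_norm2 p"
      using w by (simp add: power2_eq_square)
    also have "\<dots> \<le> C * x ^ m / monomial_norm2 p"
      using C[of m] w by (simp add: p divide_right_mono)
    also have "\<dots> = (C / y ^ n) * (x ^ fst p * y ^ snd p / monomial_norm2 p)"
      using y by (simp add: p)
    finally show ?thesis .
  next
    case False
    then have "a p = 0" using 0[of "snd p" "fst p"] by simp
    then show ?thesis using C0 x y monomial_norm2_pos[of p] by simp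
  qed
  have "(\<lambda>p. (C / y ^ n) * (x ^ fst p * y ^ snd p / monomial_norm2 p)) summable_on UNIV"
    by (intro summable_on_cmult_right summable_inverse_weight) (use x y in auto)
  then have "(\<lambda>p. (cmod (a p))\<^sup>2 * monomial_norm2 p) summable_on UNIV"
    by (rule summable_on_comparison_test) (rule le, rule coeffs_term_nonneg)
  then show ?thesis by (simp add: da_coeffs_def)
qed

lemma row_decay_mult:
  assumes a: "row_decay n a" and \<eta>: "\<And>m. cmod (\<eta> (m, n)) \<le> B * (1 + real m)"
  shows "row_decay n (\<lambda>p. \<eta> p * a p)"
proof -
  obtain C x where 0: "\<And>m l. l \<noteq> n \<Longrightarrow> a (m, l) = 0" and x: "0 < x" "x < 1"
    and C: "\<And>m. (cmod (a (m, n)) * monomial_norm2 (m, n))\<^sup>2 \<le> C * x ^ m"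
    using a unfolding row_decay_def by blast
  \<comment> \<open>The linear factor is traded for (1 + d)^m / d by Bernoulli. This
    \<open>d\<close> is small enough to keep the new ratio (1 + d)^2 x below 1, as (1 + d)^2 \<le> 1
    + 3d and 3d x < 1 - x.\<close>
  define d where "d = (1 - x) / 4"
  have d: "0 < d" "d \<le> 1" using x by (simp_all add: d_def)
  have "(1 + d)\<^sup>2 \<le> 1 + 3 * d"
    using d mult_left_mono[of d 1 d] by (simp add: power2_eq_square algebra_simps)
  then have "(1 + d)\<^sup>2 * x \<le> (1 + 3 * d) * x" using x by (intro mult_right_mono) auto
  also have "\<dots> = x + 3 * (1 - x) / 4 * x" by (simp add: d_def algebra_simps)
  also have "\<dots> < x + (1 - x) * 1"
    using x by (intro add_strict_left_mono mult_strict_mono) auto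
  finally have z: "(1 + d)\<^sup>2 * x < 1" by simp
  have lin: "1 + real m \<le> (1 + d) ^ m / d" for m
  proof -
    have "d * (1 + real m) \<le> 1 + real m * d" using d by (simp add: algebra_simps)
    also have "\<dots> \<le> (1 + d) ^ m" using d by (intro Bernoulli_inequality) auto
    finally show ?thesis using d by (simp add: field_simps)
  qed
  have B: "0 \<le> B" using order_trans[OF norm_ge_zero \<eta>[of 0]] by simp
  have "(cmod (\<eta> (m, n) * a (m, n)) * monomial_norm2 (m, n))\<^sup>2 \<le> (B / d)\<^sup>2 * C * ((1 + d)\<^sup>2 * x) ^ m" for m
  proof -
    have "cmod (\<eta> (m, n)) \<le> B * ((1 + d) ^ m / d)"
      using \<eta>[of m] mult_left_mono[OF lin B, of m] by linarith
    then have "(cmod (\<eta> (m, n)))\<^sup>2 \<le> (B * ((1 + d) ^ m / d))\<^sup>2" by (rule power_mono) simp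
    then have "(cmod (\<eta> (m, n)))\<^sup>2 * (cmod (a (m, n)) * monomial_norm2 (m, n))\<^sup>2
        \<le> (B * ((1 + d) ^ m / d))\<^sup>2 * (C * x ^ m)"
      using C by (intro mult_mono) auto
    also have "\<dots> = (B / d)\<^sup>2 * C * ((1 + d)\<^sup>2 * x) ^ m"
      by (simp add: power_mult_distrib power_divide power_mult[symmetric] mult_ac)
    finally show ?thesis by (simp add: norm_mult power_mult_distrib mult_ac)
  qed
  moreover have "0 < (1 + d)\<^sup>2 * x" using d x by simp
  ultimately show ?thesis unfolding row_decay_def using 0 z by auto
qed

section \<open>Basis vectors of the complement and their weights\<close>

locale da_ideal =
  fixes k :: nat and \<epsilon> :: real
  assumes k: "1 \<le> k" and eps: "0 < \<epsilon>" "\<epsilon> < 1"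
begin

abbreviation S :: "real \<Rightarrow> da set" where "S \<equiv> I_perp k \<epsilon>"

definition F :: real where "F = \<epsilon> powr (2 / real k)"

lemma F_pos: "0 < F" and F_less_1: "F < 1" and F_power_k: "F ^ k = \<epsilon>\<^sup>2"
proof -
  show "0 < F" using eps by (simp add: F_def)
  show "F < 1" using eps k by (simp add: F_def powr01_less_one)
  have "F ^ k = F powr real k" using \<open>0 < F\<close> by (simp add: powr_realpow)
  also have "\<dots> = \<epsilon> powr 2" using k by (simp add: F_def powr_powr)
  finally show "F ^ k = \<epsilon>\<^sup>2" using eps by (simp add: powr_numeral)
qed

text \<open>Turns decay by blocks of length k into a geometric sequence in m, up to a factor that is
  constant on each residue class; the negative binomial series become applicable.\<close>

lemma eps_power: "(\<epsilon> ^ (m div k))\<^sup>2 * F ^ (m mod k) = F ^ m"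
proof -
  have "F ^ m = F ^ (k * (m div k) + m mod k)" by simp
  also have "\<dots> = (F ^ k) ^ (m div k) * F ^ (m mod k)" by (simp only: power_add power_mult)
  also have "(F ^ k) ^ (m div k) = (\<epsilon> ^ (m div k))\<^sup>2"
    unfolding F_power_k by (simp add: power_mult[symmetric] mult.commute)
  finally show ?thesis by simp
qed

lemma wcoeff_S:
  assumes "f \<in> S t"
  shows "wcoeff f m n = (of_real \<epsilon> * cis (- t)) ^ (m div k) * wcoeff f (m mod k) n"
proof -
  have *: "wcoeff f (r + j * k) n = (of_real \<epsilon> * cis (- t)) ^ j * wcoeff f r n" for r j
  proof (induction j)
    case (Suc j)
    have "wcoeff f (r + Suc j * k) n = wcoeff f ((r + j * k) + k) n" by (simp add: algebra_simps)
    also have "\<dots> = of_real \<epsilon> * cis (- t) * wcoeff f (r + j * k) n"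
      using assms unfolding I_perp_iff by blast
    finally show ?case using Suc.IH by simp
  qed simp
  show ?thesis using *[of "m mod k" "m div k"] by simp
qed

lemma wcoeff_diag: "(\<And>p. cmod (\<nu> p) \<le> K) \<Longrightarrow> wcoeff (diag \<nu> f) m n = \<nu> (m, n) * wcoeff f m n"
  by (simp add: wcoeff_def coeffs2_diag[where K = K])

text \<open>Advancing the parameter by \<open>t\<close> multiplies the factor of the recursion by
  \<open>cis (- t)\<close>. With \<open>t = 0\<close> this covers the symbols of period k.\<close>

lemma diag_in_S:
  assumes "f \<in> S s" and b: "\<And>p. cmod (\<nu> p) \<le> K"
    and \<nu>: "\<And>m n. \<nu> (m + k, n) = cis (- t) * \<nu> (m, n)"
  shows "diag \<nu> f \<in> S (s + t)"
proof -
  have "cis (- (s + t)) = cis (- s) * cis (- t)" by (simp add: cis_mult)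
  then show ?thesis
    using assms(1) unfolding I_perp_iff
    by (simp add: wcoeff_diag[OF b] \<nu> mult_ac)
qed

text \<open>Dividing by the squared norm gives the weighted coefficients
  \<open>\<epsilon> ^ (m div k)\<close>: for \<open>r < k\<close>, the solution of the recursion at
  parameter 0 that starts with 1 at \<open>(r, n)\<close> and with 0 at all other starting
  points.\<close>

definition basis_coeffs :: "nat \<Rightarrow> nat \<Rightarrow> nat \<times> nat \<Rightarrow> complex" where
  "basis_coeffs r n = (\<lambda>(m, l). if l = n \<and> m mod k = r
     then of_real (\<epsilon> ^ (m div k) / monomial_norm2 (m, l)) else 0)"

lemma row_decay_basis: "row_decay n (basis_coeffs r n)"
proof -
  have "(cmod (basis_coeffs r n (m, n)) * monomial_norm2 (m, n))\<^sup>2 \<le> 1 / F ^ k * F ^ m" for m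
  proof -
    have w: "0 < monomial_norm2 (m, n)" by (rule monomial_norm2_pos)
    have "cmod (basis_coeffs r n (m, n)) * monomial_norm2 (m, n) \<le> \<epsilon> ^ (m div k)"
      using w eps by (auto simp: basis_coeffs_def norm_divide norm_power)
    then have "(cmod (basis_coeffs r n (m, n)) * monomial_norm2 (m, n))\<^sup>2 \<le> (\<epsilon> ^ (m div k))\<^sup>2"
      using w by (intro power_mono) auto
    moreover have "F ^ k \<le> F ^ (m mod k)"
      using F_pos F_less_1 k by (intro power_decreasing) (auto simp: less_imp_le)
    then have "(\<epsilon> ^ (m div k))\<^sup>2 * F ^ k \<le> F ^ m"
      unfolding eps_power[of m, symmetric] by (intro mult_left_mono) auto
    then have "(\<epsilon> ^ (m div k))\<^sup>2 \<le> 1 / F ^ k * F ^ m"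
      using F_pos by (simp add: field_simps)
    ultimately show ?thesis by linarith
  qed
  moreover have "\<forall>m l. l \<noteq> n \<longrightarrow> basis_coeffs r n (m, l) = 0" by (simp add: basis_coeffs_def)
  ultimately show ?thesis unfolding row_decay_def using F_pos F_less_1 by blast
qed

definition basis :: "nat \<Rightarrow> nat \<Rightarrow> da" where
  "basis r n = of_coeffs (basis_coeffs r n)"

lemma coeffs2_basis: "coeffs2 (basis r n) = basis_coeffs r n"
  unfolding basis_def by (rule coeffs2_of_coeffs[OF row_decay_da_coeffs[OF row_decay_basis]])

lemma basis_in_S: "basis r n \<in> S 0"
  unfolding I_perp_iff
proof (intro allI)
  fix m l
  have "(m + k) div k = Suc (m div k)" using k by simp
  then show "wcoeff (basis r n) (m + k) l = of_real \<epsilon> * cis (- 0) * wcoeff (basis r n) m l"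
    by (simp add: wcoeff_def coeffs2_basis basis_coeffs_def)
qed

text \<open>The share of one monomial in the squared norm of the basis vector; up to normalization,
  a negative binomial distribution conditioned on a residue class.\<close>

definition basis_weight :: "nat \<Rightarrow> nat \<Rightarrow> nat \<times> nat \<Rightarrow> real" where
  "basis_weight r n p = (cmod (basis_coeffs r n p))\<^sup>2 * monomial_norm2 p"

text \<open>On its residue class \<open>h\<close> is determined by its first weighted coefficient,
  so pairing with any real reweighting of the basis vector only sees the total weight. Constant
  \<open>g\<close> yields totality of the basis, \<open>g = phase\<close> yields flatness.\<close>

lemma cinner_weighted_basis:
  assumes h: "h \<in> S 0" and g: "(\<lambda>p. of_real (g p) * basis_coeffs r n p) \<in> da_coeffs"
    and sm: "(\<lambda>p. g p * basis_weight r n p) summable_on UNIV"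
  shows "cinner (of_coeffs (\<lambda>p. of_real (g p) * basis_coeffs r n p)) h
    = of_real (\<Sum>\<^sub>\<infinity>p. g p * basis_weight r n p) * cnj (wcoeff h r n)"
proof -
  have "of_real (g p) * basis_coeffs r n p * cnj (coeffs2 h p) * of_real (monomial_norm2 p)
      = of_real (g p * basis_weight r n p) * cnj (wcoeff h r n)" for p
  proof (cases "snd p = n \<and> fst p mod k = r")
    case True
    then obtain m where p: "p = (m, n)" "m mod k = r" by (metis prod.collapse)
    have "cnj (coeffs2 h p) * of_real (monomial_norm2 p) = cnj (wcoeff h m n)"
      by (simp add: wcoeff_def p)
    also have "\<dots> = of_real (\<epsilon> ^ (m div k)) * cnj (wcoeff h r n)"
      using wcoeff_S[OF h, of m n] p by simp
    finally have *: "cnj (coeffs2 h p) * of_real (monomial_norm2 p)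
      = of_real (\<epsilon> ^ (m div k)) * cnj (wcoeff h r n)" .
    have b: "basis_coeffs r n p = of_real (\<epsilon> ^ (m div k) / monomial_norm2 p)"
      using p by (simp add: basis_coeffs_def)
    have bw: "basis_weight r n p = \<epsilon> ^ (m div k) / monomial_norm2 p * \<epsilon> ^ (m div k)"
      unfolding basis_weight_def b norm_of_real power2_abs by (simp add: power2_eq_square)
    have "of_real (g p) * basis_coeffs r n p * cnj (coeffs2 h p) * of_real (monomial_norm2 p)
        = of_real (g p) * basis_coeffs r n p * (cnj (coeffs2 h p) * of_real (monomial_norm2 p))"
      by (simp only: mult.assoc)
    also have "\<dots> = of_real (g p * basis_weight r n p) * cnj (wcoeff h r n)"
      unfolding * b bw by (simp only: of_real_mult mult_ac)
    finally show ?thesis .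
  next
    case False
    then show ?thesis by (auto simp: basis_coeffs_def basis_weight_def case_prod_unfold)
  qed
  then have "cinner (of_coeffs (\<lambda>p. of_real (g p) * basis_coeffs r n p)) h
      = (\<Sum>\<^sub>\<infinity>p. of_real (g p * basis_weight r n p) * cnj (wcoeff h r n))"
    unfolding cinner_def coeffs2_of_coeffs[OF g] by (intro infsum_cong)
  also have "\<dots> = (\<Sum>\<^sub>\<infinity>p. of_real (g p * basis_weight r n p)) * cnj (wcoeff h r n)"
    by (rule infsum_cmult_left')
  also have "(\<Sum>\<^sub>\<infinity>p. of_real (g p * basis_weight r n p)) = (of_real (\<Sum>\<^sub>\<infinity>p. g p * basis_weight r n p) :: complex)"
    by (rule infsumI[OF has_sum_of_real[OF has_sum_infsum[OF sm]]])
  finally show ?thesis .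
qed

definition mass :: "nat \<Rightarrow> nat \<Rightarrow> real" where
  "mass r n = (\<Sum>\<^sub>\<infinity>p. basis_weight r n p)"

definition moment :: "nat \<Rightarrow> nat \<Rightarrow> real" where
  "moment r n = (\<Sum>\<^sub>\<infinity>p. real (fst p div k) * basis_weight r n p)"

text \<open>The number \<open>\<lambda>\<close> of the overview.\<close>

definition mean :: "nat \<Rightarrow> nat \<Rightarrow> real" where
  "mean r n = moment r n / mass r n"

lemma basis_weight_nonneg: "0 \<le> basis_weight r n p"
  unfolding basis_weight_def by (rule coeffs_term_nonneg)

lemma basis_weight_summable: "basis_weight r n summable_on UNIV"
  using coeffs2_square_summable[of "basis r n"] unfolding coeffs2_basis basis_weight_def .

text \<open>The second moment is a squared norm, finite by \<open>row_decay\<close>, and it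
  dominates the first because a natural number is at most its square.\<close>

lemma basis_weight_moment_summable: "(\<lambda>p. real (fst p div k) * basis_weight r n p) summable_on UNIV"
proof -
  have "row_decay n (\<lambda>p. of_nat (fst p div k) * basis_coeffs r n p)"
  proof (rule row_decay_mult[OF row_decay_basis, where B = 1])
    fix m
    have "real (m div k) \<le> real m" by (intro of_nat_mono div_le_dividend)
    then have "real (m div k) \<le> 1 + real m" by linarith
    then show "cmod (of_nat (fst (m, n) div k)) \<le> 1 * (1 + real m)" by simp
  qed
  then have "(\<lambda>p. of_nat (fst p div k) * basis_coeffs r n p) \<in> da_coeffs" by (rule row_decay_da_coeffs)
  then have "(\<lambda>p. (real (fst p div k))\<^sup>2 * basis_weight r n p) summable_on UNIV"
    by (simp add: da_coeffs_def norm_mult power_mult_distrib basis_weight_def mult.assoc)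
  then show ?thesis
  proof (rule summable_on_comparison_test)
    fix p :: "nat \<times> nat"
    have "real (fst p div k) \<le> (real (fst p div k))\<^sup>2"
      using le_square[of "fst p div k"] by (simp add: power2_eq_square flip: of_nat_mult)
    then show "real (fst p div k) * basis_weight r n p \<le> (real (fst p div k))\<^sup>2 * basis_weight r n p"
      using basis_weight_nonneg by (rule mult_right_mono)
  qed (simp add: basis_weight_nonneg)
qed

lemma mass_pos: "r < k \<Longrightarrow> 0 < mass r n"
proof -
  assume r: "r < k"
  have "0 < basis_weight r n (r, n)"
    using r monomial_norm2_pos[of "(r, n)"] by (simp add: basis_weight_def basis_coeffs_def)
  also have "\<dots> = (\<Sum>p\<in>{(r, n)}. basis_weight r n p)" by simp
  also have "\<dots> \<le> mass r n"
    unfolding mass_def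
    by (rule finite_sum_le_infsum[OF basis_weight_summable]) (auto simp: basis_weight_nonneg)
  finally show ?thesis .
qed

text \<open>Totality of the basis vectors: pairing with them reads off the first coefficient of each
  family, up to the positive factor \<open>mass\<close>.\<close>

lemma S_0_eq_zeroI:
  assumes h: "h \<in> S 0" and z: "\<And>r n. r < k \<Longrightarrow> cinner (basis r n) h = 0"
  shows "h = 0"
proof (rule da_eqI)
  have w: "wcoeff h r n = 0" if r: "r < k" for r n
  proof -
    have "(\<lambda>p. of_real 1 * basis_coeffs r n p) \<in> da_coeffs"
      by (simp add: row_decay_da_coeffs[OF row_decay_basis])
    from cinner_weighted_basis[OF h this] have "of_real (mass r n) * cnj (wcoeff h r n) = 0"
      using z[OF r, of n] basis_weight_summable by (simp add: mass_def basis_def)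
    then show ?thesis using mass_pos[OF r, of n] by simp
  qed
  fix p
  have "wcoeff h (fst p) (snd p) = 0"
    using wcoeff_S[OF h, of "fst p" "snd p"] w[of "fst p mod k"] k by simp
  then show "coeffs2 h p = coeffs2 0 p" using monomial_norm2_pos[of p] by (simp add: wcoeff_def)
qed

text \<open>
  The part \<open>- (m div k)\<close> carries \<open>I(0)\<^sup>\<bottom>\<close> to \<open>I(t)\<^sup>\<bottom>\<close>; the part \<open>mean\<close> makes the velocity of a
  transported basis vector orthogonal to \<open>I(t)\<^sup>\<bottom>\<close>.
\<close>

definition phase :: "nat \<times> nat \<Rightarrow> real" where
  "phase p = mean (fst p mod k) (snd p) - real (fst p div k)"

lemma phase_shift: "phase (m + k, n) = phase (m, n) - 1"
proof -
  have "(m + k) div k = Suc (m div k)" using k by simp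
  then show ?thesis by (simp add: phase_def)
qed

text \<open>The constant depends on \<open>n\<close>, which is why \<open>row_decay\<close> is
  confined to a single row.\<close>

lemma phase_bound: "\<bar>phase (m, n)\<bar> \<le> (1 + (\<Sum>r<k. \<bar>mean r n\<bar>)) * (1 + real m)"
proof -
  have "m mod k < k" using k by simp
  then have "\<bar>mean (m mod k) n\<bar> \<le> (\<Sum>r<k. \<bar>mean r n\<bar>)"
    by (intro member_le_sum) auto
  moreover have "real (m div k) \<le> real m" by (intro of_nat_mono div_le_dividend)
  moreover have "0 \<le> (\<Sum>r<k. \<bar>mean r n\<bar>) * real m" by (intro mult_nonneg_nonneg sum_nonneg) auto
  moreover have "(1 + (\<Sum>r<k. \<bar>mean r n\<bar>)) * (1 + real m)
      = 1 + (\<Sum>r<k. \<bar>mean r n\<bar>) + real m + (\<Sum>r<k. \<bar>mean r n\<bar>) * real m"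
    by (simp add: algebra_simps)
  ultimately show ?thesis unfolding phase_def fst_conv snd_conv by linarith
qed

lemma row_decay_phase:
  assumes "row_decay n a"
  shows "row_decay n (\<lambda>p. of_real (phase p) * a p)"
  by (rule row_decay_mult[OF assms, where B = "1 + (\<Sum>r<k. \<bar>mean r n\<bar>)"]) (simp add: phase_bound)

lemma row_decay_cmult: "row_decay n a \<Longrightarrow> row_decay n (\<lambda>p. c * a p)"
  by (rule row_decay_mult[where \<eta> = "\<lambda>_. c" and B = "cmod c"]) (simp_all add: algebra_simps)

text \<open>Isometric on the whole space although \<open>phase\<close> is unbounded; the
  unboundedness only affects differentiability in \<open>t\<close>.\<close>

definition transport :: "real \<Rightarrow> da \<Rightarrow> da" where
  "transport t = diag (\<lambda>p. cis (t * phase p))"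

lemma coeffs2_transport: "coeffs2 (transport t f) p = cis (t * phase p) * coeffs2 f p"
  unfolding transport_def by (rule coeffs2_diag[where K = 1]) simp

lemma transport_in_S: "f \<in> S s \<Longrightarrow> transport t f \<in> S (s + t)"
  unfolding transport_def
  by (rule diag_in_S[where K = 1]) (simp_all add: phase_shift cis_mult algebra_simps)

lemma transport_transport: "transport s (transport t f) = transport (s + t) f"
  by (rule da_eqI) (simp add: coeffs2_transport cis_mult distrib_right flip: mult.assoc)

lemma transport_0 [simp]: "transport 0 f = f"
  by (rule da_eqI) (simp add: coeffs2_transport)

lemma cinner_transport: "cinner (transport t f) g = cinner f (transport (- t) g)"
  unfolding transport_def by (subst cinner_diag[where K = 1]) (simp_all add: cis_cnj)

lemma transport_add: "transport t (f + g) = transport t f + transport t g"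
  and transport_cscale: "transport t (cscale c f) = cscale c (transport t f)"
  and norm_transport: "norm (transport t f) = norm f"
  unfolding transport_def
  by (rule diag_add[where K = 1] diag_cscale[where K = 1] norm_diag_unimodular; simp)+

text \<open>The Taylor error of each coefficient is at most (s - t)^2 times \<open>phase\<close>
  squared times the coefficient, and rows with geometric decay stay square summable after two
  factors \<open>phase\<close>.\<close>

lemma transport_has_vector_derivative:
  assumes "row_decay n a"
  shows "((\<lambda>t. transport t (of_coeffs a)) has_vector_derivative
    transport t (of_coeffs (\<lambda>p. \<i> * of_real (phase p) * a p))) (at t)"
proof (rule quadratic_error_has_vector_derivative)
  fix s
  have a1: "row_decay n (\<lambda>p. \<i> * of_real (phase p) * a p)"
    using row_decay_cmult[OF row_decay_phase[OF assms], of \<i>] by (simp add: mult.assoc)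
  have a2: "row_decay n (\<lambda>p. of_real (phase p) * (of_real (phase p) * a p))"
    by (intro row_decay_phase assms)
  note c = coeffs2_of_coeffs[OF row_decay_da_coeffs[OF assms]]
    coeffs2_of_coeffs[OF row_decay_da_coeffs[OF a1]] coeffs2_of_coeffs[OF row_decay_da_coeffs[OF a2]]
  show "norm (transport s (of_coeffs a) - transport t (of_coeffs a)
      - (s - t) *\<^sub>R transport t (of_coeffs (\<lambda>p. \<i> * of_real (phase p) * a p)))
    \<le> norm (of_coeffs (\<lambda>p. of_real (phase p) * (of_real (phase p) * a p))) * (s - t)\<^sup>2" (is "norm ?d \<le> norm ?q * _")
  proof -
    have "cmod (coeffs2 ?d p) \<le> (s - t)\<^sup>2 * cmod (coeffs2 ?q p)" for p
    proof -
      define x where "x = (s - t) * phase p"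
      have "cis (s * phase p) = cis (t * phase p) * cis x"
        by (simp add: cis_mult x_def algebra_simps)
      then have "coeffs2 ?d p = cis (t * phase p) * (cis x - 1 - \<i> * of_real x) * a p"
        by (simp add: coeffs2_simps coeffs2_transport c) (simp add: x_def algebra_simps)
      then have "cmod (coeffs2 ?d p) = cmod (cis x - 1 - \<i> * of_real x) * cmod (a p)"
        by (simp add: norm_mult)
      also have "\<dots> \<le> x\<^sup>2 * cmod (a p)" by (intro mult_right_mono cis_Taylor) simp
      also have "\<dots> = (s - t)\<^sup>2 * cmod (coeffs2 ?q p)"
        by (simp add: c x_def norm_mult power_mult_distrib power2_eq_square)
      finally show ?thesis .
    qed
    then have "norm ?d \<le> (s - t)\<^sup>2 * norm ?q" by (intro norm_le_coeffs) auto
    then show ?thesis by (simp add: mult.commute)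
  qed
qed

lemma vderiv_transport:
  assumes "row_decay n a"
  shows "vderiv (\<lambda>t. transport t (of_coeffs a)) = (\<lambda>t. transport t (of_coeffs (\<lambda>p. \<i> * of_real (phase p) * a p)))"
  unfolding vderiv_def
  by (intro ext vector_derivative_at transport_has_vector_derivative[OF assms])

lemma smooth_transport:
  assumes "row_decay n a"
  shows "smooth (\<lambda>t. transport t (of_coeffs a))"
proof -
  have "\<exists>b. row_decay n b \<and> (vderiv ^^ j) (\<lambda>t. transport t (of_coeffs a)) = (\<lambda>t. transport t (of_coeffs b))" for j
  proof (induction j)
    case (Suc j)
    then obtain b where b: "row_decay n b"
      "(vderiv ^^ j) (\<lambda>t. transport t (of_coeffs a)) = (\<lambda>t. transport t (of_coeffs b))" by blast
    then have "row_decay n (\<lambda>p. \<i> * of_real (phase p) * b p)"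
      using row_decay_cmult[OF row_decay_phase, of n b \<i>] by (simp add: mult.assoc)
    then show ?case using vderiv_transport[OF b(1)] b(2) by auto
  qed (use assms in auto)
  then show ?thesis
    unfolding smooth_def
    using transport_has_vector_derivative differentiableI_vector by metis
qed

text \<open>Here the choice of \<open>mean\<close> enters: under \<open>basis_weight\<close> the
  phase averages to zero.\<close>

lemma cinner_phase_basis:
  assumes h: "h \<in> S 0" and r: "r < k"
  shows "cinner (of_coeffs (\<lambda>p. of_real (phase p) * basis_coeffs r n p)) h = 0"
proof -
  have eq: "phase p * basis_weight r n p
      = mean r n * basis_weight r n p + - (real (fst p div k) * basis_weight r n p)" for p
    by (cases "fst p mod k = r \<and> snd p = n")
      (auto simp: phase_def basis_weight_def basis_coeffs_def case_prod_unfold left_diff_distrib)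
  have "((\<lambda>p. phase p * basis_weight r n p) has_sum (mean r n * mass r n + - moment r n)) UNIV"
    unfolding eq mass_def moment_def
    by (intro has_sum_add has_sum_uminusI has_sum_cmult_right has_sum_infsum basis_weight_summable
        basis_weight_moment_summable)
  moreover have "mean r n * mass r n + - moment r n = 0"
    using mass_pos[OF r, of n] by (simp add: mean_def)
  ultimately have 0: "((\<lambda>p. phase p * basis_weight r n p) has_sum 0) UNIV" by simp
  show ?thesis
    using cinner_weighted_basis[OF h row_decay_da_coeffs[OF row_decay_phase[OF row_decay_basis]]
        has_sum_imp_summable[OF 0]] infsumI[OF 0] by simp
qed

lemma cinner_vderiv_transport_basis:
  assumes h: "h \<in> S t" and r: "r < k"
  shows "cinner (vderiv (\<lambda>t. transport t (basis r n)) t) h = 0"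
proof -
  have "transport (- t) h \<in> S 0" using transport_in_S[OF h, of "- t"] by simp
  moreover have "of_coeffs (\<lambda>p. \<i> * of_real (phase p) * basis_coeffs r n p)
      = cscale \<i> (of_coeffs (\<lambda>p. of_real (phase p) * basis_coeffs r n p))"
    using row_decay_da_coeffs[OF row_decay_phase[OF row_decay_basis]]
      row_decay_da_coeffs[OF row_decay_cmult[OF row_decay_phase[OF row_decay_basis]]]
    by (intro da_eqI) (simp add: coeffs2_cscale coeffs2_of_coeffs mult.assoc)
  ultimately show ?thesis
    unfolding basis_def vderiv_transport[OF row_decay_basis]
    using cinner_phase_basis[OF _ r] by (simp add: cinner_transport cinner_cscale_left)
qed

section \<open>Flat sections and parallel transport\<close>

lemma flat_transport_basis: "r < k \<Longrightarrow> flat k \<epsilon> (\<lambda>t. transport t (basis r n))"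
  unfolding flat_def smooth_section_def connection_def
  using smooth_transport[OF row_decay_basis] transport_in_S[OF basis_in_S]
  by (auto simp: basis_def[symmetric] intro!: proj_eq_0I closed_csubspace_I_perp cinner_vderiv_transport_basis)

text \<open>Both terms in the derivative of the pairing with a transported basis vector vanish, one
  by flatness of \<open>\<xi>\<close> and one by the choice of \<open>phase\<close>. The constant
  pairings then determine \<open>\<xi> t\<close>.\<close>

lemma flat_eq_transport:
  assumes "flat k \<epsilon> \<xi>"
  shows "\<xi> t = transport t (\<xi> 0)"
proof -
  have \<xi>: "\<xi> t \<in> S t" "connection k \<epsilon> \<xi> t = 0" "(\<xi> has_vector_derivative vderiv \<xi> t) (at t)" for t
  proof -
    show "\<xi> t \<in> S t" "connection k \<epsilon> \<xi> t = 0" using assms by (auto simp: flat_def smooth_section_def)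
    have "((vderiv ^^ 0) \<xi>) differentiable (at t)"
      using assms unfolding flat_def smooth_section_def smooth_def by blast
    then show "(\<xi> has_vector_derivative vderiv \<xi> t) (at t)"
      by (simp add: vderiv_def vector_derivative_works)
  qed
  have const: "cinner (\<xi> t) (transport t (basis r n)) = cinner (\<xi> 0) (basis r n)" if r: "r < k" for r n t
  proof -
    let ?g = "\<lambda>t. transport t (basis r n)"
    have g: "(?g has_vector_derivative vderiv ?g t) (at t)" for t
      unfolding basis_def vderiv_transport[OF row_decay_basis]
      by (rule transport_has_vector_derivative[OF row_decay_basis])
    have "((\<lambda>t. cinner (\<xi> t) (?g t)) has_vector_derivative 0) (at t)" for t
    proof -
      have "cinner (vderiv \<xi> t) (?g t) = cinner (proj (S t) (vderiv \<xi> t)) (?g t)"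
        using transport_in_S[OF basis_in_S[of r n], of t]
        by (simp add: cinner_proj[OF closed_csubspace_I_perp])
      then have "cinner (vderiv \<xi> t) (?g t) = 0" using \<xi>(2)[of t] by (simp add: connection_def)
      moreover have "cinner (\<xi> t) (vderiv ?g t) = 0"
        using cinner_vderiv_transport_basis[OF \<xi>(1)[of t] r, where n = n] by (metis cinner_commute complex_cnj_zero)
      ultimately show ?thesis
        using cinner.has_vector_derivative[OF \<xi>(3) g, of t] by simp
    qed
    then obtain c where "\<And>t. t \<in> UNIV \<Longrightarrow> cinner (\<xi> t) (?g t) = c"
      using has_vector_derivative_zero_constant[of UNIV "\<lambda>t. cinner (\<xi> t) (?g t)"] by auto
    then show ?thesis using transport_0[of "basis r n"] by (metis UNIV_I)
  qed
  \<comment> \<open>Pulled back to time 0, where the basis is known to be total.\<close>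
  define h where "h = transport (- t) (\<xi> t) - \<xi> 0"
  have "h = 0"
  proof (rule S_0_eq_zeroI)
    show "h \<in> S 0"
      unfolding h_def using transport_in_S[OF \<xi>(1)[of t], of "- t"] \<xi>(1)[of 0]
      by (intro closed_csubspaceD(5)[OF closed_csubspace_I_perp]) simp_all
    fix r n assume "r < k"
    then have "cinner h (basis r n) = 0"
      using const[of r t n] by (simp add: h_def cinner_diff_left cinner_transport)
    then show "cinner (basis r n) h = 0" by (metis cinner_commute complex_cnj_zero)
  qed
  then have "transport t (transport (- t) (\<xi> t)) = transport t (\<xi> 0)" by (simp add: h_def)
  then show ?thesis by (simp add: transport_transport)
qed

lemma transport_bounded_ops: "restrict (transport t) (S 0) \<in> bounded_ops (S 0) (S t)"
  by (rule restrict_bounded_ops[where K = 1])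
    (use transport_in_S[of _ 0 t] in
      \<open>auto simp: closed_csubspace_I_perp transport_add transport_cscale norm_transport\<close>)

text \<open>Passing to adjoints replaces the density of the span of the basis by its totality.\<close>

lemma bounded_ops_eq_on_basis:
  assumes A: "A \<in> bounded_ops (S 0) T" and B: "B \<in> bounded_ops (S 0) T" and T: "closed_csubspace T"
    and eq: "\<And>r n. r < k \<Longrightarrow> A (basis r n) = B (basis r n)"
  shows "A = B"
proof (rule bounded_ops_eqI[OF A B])
  fix f assume f: "f \<in> S 0"
  note S0 = closed_csubspace_I_perp[of k \<epsilon> 0]
  show "A f = B f"
  proof (rule inner_eq_imp_eq[OF T])
    fix g assume g: "g \<in> T"
    define h where "h = adj (S 0) T A g - adj (S 0) T B g"
    have h: "h \<in> S 0" unfolding h_def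
      by (intro closed_csubspaceD(5)[OF S0] bounded_opsD(2)[OF adj_bounded_ops[OF S0 T A] g]
          bounded_opsD(2)[OF adj_bounded_ops[OF S0 T B] g])
    have *: "cinner x h = cinner (A x) g - cinner (B x) g" if "x \<in> S 0" for x
      using cinner_adj[OF S0 T A that g] cinner_adj[OF S0 T B that g]
      by (simp add: h_def cinner_diff_right)
    have "h = 0" by (rule S_0_eq_zeroI[OF h]) (simp add: * basis_in_S eq)
    then have "cinner (A f) g = cinner (B f) g" using *[OF f] by simp
    then show "cinner g (A f) = cinner g (B f)" by (metis cinner_commute)
  qed (use f bounded_opsD(2)[OF A] bounded_opsD(2)[OF B] in auto)
qed

text \<open>Existence holds since every flat section is transported; uniqueness holds since each
  basis vector is the initial value of a flat section.\<close>

lemma parallel_transport_eq: "parallel_transport k \<epsilon> t = restrict (transport t) (S 0)"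
  unfolding parallel_transport_def
proof (rule the_equality)
  have "restrict (transport t) (S 0) (\<xi> 0) = \<xi> t" if \<xi>: "flat k \<epsilon> \<xi>" for \<xi>
  proof -
    have "\<xi> 0 \<in> S 0" using \<xi> by (simp add: flat_def smooth_section_def)
    then show ?thesis using flat_eq_transport[OF \<xi>, of t] by simp
  qed
  then show "restrict (transport t) (S 0) \<in> bounded_ops (S 0) (S t) \<and>
      (\<forall>\<xi>. flat k \<epsilon> \<xi> \<longrightarrow> restrict (transport t) (S 0) (\<xi> 0) = \<xi> t)"
    using transport_bounded_ops by blast
next
  fix U assume U: "U \<in> bounded_ops (S 0) (S t) \<and> (\<forall>\<xi>. flat k \<epsilon> \<xi> \<longrightarrow> U (\<xi> 0) = \<xi> t)"
  show "U = restrict (transport t) (S 0)"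
  proof (rule bounded_ops_eq_on_basis[OF _ transport_bounded_ops closed_csubspace_I_perp])
    fix r n assume "r < k"
    then have "U (transport 0 (basis r n)) = transport t (basis r n)"
      using U flat_transport_basis[of r n] by blast
    then show "U (basis r n) = restrict (transport t) (S 0) (basis r n)"
      using basis_in_S by simp
  qed (use U in blast)
qed

end

section \<open>Asymptotics of the phases\<close>

text \<open>Complex \<open>z\<close>, for the evaluation at F times a root of unity.\<close>

lemma negative_binomial_sums:
  fixes z :: complex
  assumes "cmod z < 1"
  shows "(\<lambda>m. of_nat ((m + n) choose m) * z ^ m) sums (1 / (1 - z) ^ Suc n)"
proof -
  have nz: "1 - z \<noteq> 0" using assms by auto
  have "(\<lambda>m. (- of_nat (Suc n) gchoose m) * (- z) ^ m) sums (1 + - z) powr (- of_nat (Suc n))"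
    by (rule gen_binomial_complex) (use assms in simp)
  moreover have "(- of_nat (Suc n) gchoose m) * (- z) ^ m = of_nat ((m + n) choose m) * z ^ m" for m
  proof -
    have "(- of_nat (Suc n) gchoose m :: complex) = (- 1) ^ m * of_nat ((m + n) choose m)"
      unfolding gbinomial_minus binomial_gbinomial by (simp add: algebra_simps)
    moreover have "(- z) ^ m = (- 1) ^ m * z ^ m" by (rule power_minus)
    ultimately show ?thesis
      by (simp add: mult_ac flip: power_mult_distrib mult.assoc)
  qed
  moreover have "(1 + - z) powr (- of_nat (Suc n)) = 1 / (1 - z) ^ Suc n"
    using nz by (simp add: powr_minus powr_nat' field_simps del: of_nat_Suc power_Suc)
  ultimately show ?thesis by simp
qed

text \<open>The absorption identity for binomial coefficients reduces this to the previous series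
  with n + 1 for n.\<close>

lemma negative_binomial_moment_sums:
  fixes z :: complex
  assumes "cmod z < 1"
  shows "(\<lambda>m. of_nat m * (of_nat ((m + n) choose m) * z ^ m)) sums (of_nat (Suc n) * z / (1 - z) ^ Suc (Suc n))"
proof -
  have sums: "(\<lambda>m. of_nat (Suc n) * z * (of_nat ((m + Suc n) choose m) * z ^ m))
      sums (of_nat (Suc n) * z * (1 / (1 - z) ^ Suc (Suc n)))"
    by (intro sums_mult negative_binomial_sums assms)
  have eq: "of_nat (Suc n) * z * (of_nat ((m + Suc n) choose m) * z ^ m)
      = of_nat (Suc m) * (of_nat ((Suc m + n) choose Suc m) * z ^ Suc m)" for m
  proof -
    have "Suc m * ((Suc m + n) choose Suc m) = Suc n * ((m + Suc n) choose m)"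
      using Suc_times_binomial_add[of m n] by simp
    then have *: "(of_nat (Suc m) * of_nat ((Suc m + n) choose Suc m) :: complex)
        = of_nat (Suc n) * of_nat ((m + Suc n) choose m)"
      by (metis of_nat_mult)
    have "of_nat (Suc n) * z * (of_nat ((m + Suc n) choose m) * z ^ m)
        = (of_nat (Suc n) * of_nat ((m + Suc n) choose m)) * (z * z ^ m)"
      by (simp only: mult_ac)
    also have "\<dots> = of_nat (Suc m) * (of_nat ((Suc m + n) choose Suc m) * z ^ Suc m)"
      unfolding *[symmetric] by (simp only: mult.assoc power_Suc)
    finally show ?thesis .
  qed
  have "(\<lambda>m. of_nat (Suc m) * (of_nat ((Suc m + n) choose Suc m) * z ^ Suc m))
      sums (of_nat (Suc n) * z / (1 - z) ^ Suc (Suc n))"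
    using sums unfolding eq times_divide_eq_right mult_1_right .
  then show ?thesis by (subst (asm) sums_Suc_iff) simp
qed

text \<open>The mean is of order n, so the remaining terms must vanish even after multiplication by
  \<open>Suc n\<close>. The offset \<open>d\<close> covers the exponents n + 1 of the mass and n + 2
  of the moment.\<close>

lemma dominant_power_sum_limit:
  fixes c q :: "nat \<Rightarrow> complex"
  assumes k: "1 \<le> k" and c: "c 0 = 1" and q: "q 0 = 1" "\<And>j. 0 < j \<Longrightarrow> j < k \<Longrightarrow> cmod (q j) < 1"
  shows "(\<lambda>n. of_nat (Suc n) * ((\<Sum>j<k. c j * q j ^ (Suc n + d)) - 1)) \<longlonglongrightarrow> 0"
proof -
  have "of_nat (Suc n) * ((\<Sum>j<k. c j * q j ^ (Suc n + d)) - 1)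
      = (\<Sum>j\<in>{1..<k}. (c j * q j ^ d) * (of_nat (Suc n) * q j ^ Suc n))" for n
  proof -
    have "{..<k} = insert 0 {1..<k}" using k by auto
    then have "(\<Sum>j<k. c j * q j ^ (Suc n + d)) - 1 = (\<Sum>j\<in>{1..<k}. c j * q j ^ (Suc n + d))"
      by (simp add: c q)
    also have "of_nat (Suc n) * \<dots> = (\<Sum>j\<in>{1..<k}. (c j * q j ^ d) * (of_nat (Suc n) * q j ^ Suc n))"
      unfolding sum_distrib_left by (intro sum.cong refl) (simp only: power_add mult_ac)
    finally show ?thesis .
  qed
  moreover have "(\<lambda>n. \<Sum>j\<in>{1..<k}. (c j * q j ^ d) * (of_nat (Suc n) * q j ^ Suc n))
      \<longlonglongrightarrow> (\<Sum>j\<in>{1..<k}. (c j * q j ^ d) * 0)"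
  proof (intro tendsto_sum tendsto_mult tendsto_const)
    fix j assume "j \<in> {1..<k}"
    then have "cmod (q j) < 1" using q by simp
    then show "(\<lambda>n. of_nat (Suc n) * q j ^ Suc n) \<longlonglongrightarrow> 0"
      by (intro LIMSEQ_Suc powser_times_n_limit_0)
  qed
  ultimately show ?thesis by simp
qed

context da_ideal
begin

section \<open>Roots of unity and closed forms for mass and moment\<close>

definition unit_root :: "nat \<Rightarrow> complex" where
  "unit_root j = cis (2 * pi * real j / real k)"

lemma unit_root_eq_iff: "unit_root i = unit_root j \<longleftrightarrow> i mod k = j mod k"
proof -
  have "unit_root j = exp (2 * of_real pi * \<i> * of_nat j / of_nat k)" for j
    by (simp add: unit_root_def cis_conv_exp mult_ac)
  then show ?thesis using complex_root_unity_eq[OF k] by simp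
qed

lemma unit_root_power: "unit_root i ^ j = cis (2 * pi * real i * real j / real k)"
  unfolding unit_root_def Complex.DeMoivre by (rule arg_cong[of _ _ cis]) simp

lemma unit_root_0 [simp]: "unit_root 0 = 1"
  by (simp add: unit_root_def)

lemma norm_unit_root [simp]: "cmod (unit_root j) = 1"
  by (simp add: unit_root_def)

text \<open>A geometric sum in \<open>x\<close>, the root of unity of index m - r, whose k-th power
  is 1; conjugation serves as inversion.\<close>

lemma unit_root_filter:
  "(\<Sum>j<k. cnj (unit_root j) ^ r * unit_root j ^ m) = (if m mod k = r mod k then of_nat k else 0)"
proof -
  define x where "x = cnj (unit_root r) * unit_root m"
  have "cnj (unit_root j) ^ r * unit_root j ^ m = x ^ j" for j
  proof -
    have "unit_root j ^ m = unit_root m ^ j" "unit_root j ^ r = unit_root r ^ j"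
      by (simp_all add: unit_root_power mult_ac)
    then show ?thesis by (simp add: x_def power_mult_distrib flip: complex_cnj_power)
  qed
  then have sum: "(\<Sum>j<k. cnj (unit_root j) ^ r * unit_root j ^ m) = (\<Sum>j<k. x ^ j)" by simp
  have one: "cnj (unit_root r) * unit_root r = 1"
    using complex_norm_square[of "unit_root r"] by (simp add: mult.commute)
  have x: "x = 1 \<longleftrightarrow> m mod k = r mod k"
  proof -
    have "x = 1 \<longleftrightarrow> unit_root m = unit_root r"
      unfolding x_def using one by (metis mult.left_commute mult.right_neutral mult.commute)
    then show ?thesis by (simp add: unit_root_eq_iff)
  qed
  have "unit_root i ^ k = 1" for i
  proof -
    have "unit_root i ^ k = cis (2 * pi * real i)" using k by (simp add: unit_root_power)
    then show ?thesis by (simp add: cis_multiple_2pi)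
  qed
  then have "x ^ k = 1" by (simp add: x_def power_mult_distrib flip: complex_cnj_power)
  then show ?thesis unfolding sum using x by (simp add: sum_gp_strict)
qed

text \<open>On the circle of radius F the point F alone is nearest to 1. The strictness makes all
  terms but the one at root 1 decay.\<close>

lemma F_less_norm:
  assumes "0 < j" "j < k"
  shows "1 - F < cmod (1 - unit_root j * of_real F)"
proof -
  have "unit_root j \<noteq> unit_root 0" using assms by (subst unit_root_eq_iff) simp
  then have ne: "unit_root j \<noteq> 1" by simp
  have sq: "(Re (unit_root j))\<^sup>2 + (Im (unit_root j))\<^sup>2 = 1"
    using cmod_power2[of "unit_root j"] by simp
  have "Re (unit_root j) < 1"
  proof (rule ccontr)
    assume "\<not> Re (unit_root j) < 1"
    then have "Re (unit_root j) = 1" using complex_Re_le_cmod[of "unit_root j"] by simp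
    with sq have "Im (unit_root j) = 0" by simp
    with \<open>Re (unit_root j) = 1\<close> ne show False by (simp add: complex_eq_iff)
  qed
  then have "F * Re (unit_root j) < F" using F_pos by simp
  moreover have "(cmod (1 - unit_root j * of_real F))\<^sup>2 = 1 - 2 * (F * Re (unit_root j))
      + F\<^sup>2 * ((Re (unit_root j))\<^sup>2 + (Im (unit_root j))\<^sup>2)"
    unfolding cmod_power2 by (simp add: power2_eq_square algebra_simps)
  moreover have "(1 - F)\<^sup>2 = 1 - 2 * F + F\<^sup>2" by (simp add: power2_eq_square algebra_simps)
  ultimately have "(1 - F)\<^sup>2 < (cmod (1 - unit_root j * of_real F))\<^sup>2" by (simp add: sq)
  then show ?thesis by (rule power2_less_imp_less) simp
qed

lemma basis_weight_row:
  assumes "r < k"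
  shows "basis_weight r n (m, n) = (if m mod k = r then F ^ m / F ^ r * real ((m + n) choose m) else 0)"
proof (cases "m mod k = r")
  case True
  have "F ^ m / F ^ r = (\<epsilon> ^ (m div k))\<^sup>2"
    using eps_power[of m] F_pos True by (simp add: field_simps)
  moreover have "basis_weight r n (m, n) = (\<epsilon> ^ (m div k))\<^sup>2 / monomial_norm2 (m, n)"
    using True unfolding basis_weight_def basis_coeffs_def
    by (simp add: norm_divide norm_power power_divide power2_eq_square)
      (simp add: power_mult_distrib[symmetric])
  ultimately show ?thesis using True by (simp add: monomial_norm2_def)
qed (simp add: basis_weight_def basis_coeffs_def)

lemma row_sums:
  assumes "(\<lambda>p. g p * basis_weight r n p) summable_on UNIV"
  shows "(\<lambda>m. g (m, n) * basis_weight r n (m, n)) sums (\<Sum>\<^sub>\<infinity>p. g p * basis_weight r n p)"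
proof -
  have inj: "inj (\<lambda>m. (m, n))" by (rule injI) simp
  have "((\<lambda>p. g p * basis_weight r n p) has_sum (\<Sum>\<^sub>\<infinity>p. g p * basis_weight r n p)) (range (\<lambda>m. (m, n)))"
    using has_sum_infsum[OF assms]
    by (rule has_sum_cong_neutral[THEN iffD1, rotated -1])
      (auto simp: basis_weight_def basis_coeffs_def image_iff)
  then have "((\<lambda>m. g (m, n) * basis_weight r n (m, n)) has_sum (\<Sum>\<^sub>\<infinity>p. g p * basis_weight r n p)) UNIV"
    by (simp add: has_sum_reindex[OF inj] o_def)
  then show ?thesis by (rule has_sum_imp_sums)
qed

lemma root_times_F: "cmod (unit_root j * of_real F) < 1"
  using F_pos F_less_1 by (simp add: norm_mult)

text \<open>The filter extracts the residue class from the negative binomial series;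
  \<open>real k\<close> stems from the filter, \<open>F ^ r\<close> from the normalization of
  \<open>basis_weight\<close>.\<close>

lemma mass_closed_form:
  assumes r: "r < k"
  shows "of_real (real k * F ^ r * mass r n)
    = (\<Sum>j<k. cnj (unit_root j) ^ r * (1 / (1 - unit_root j * of_real F) ^ Suc n))"
proof -
  have "(\<lambda>m. \<Sum>j<k. cnj (unit_root j) ^ r * (of_nat ((m + n) choose m) * (unit_root j * of_real F) ^ m))
      sums (\<Sum>j<k. cnj (unit_root j) ^ r * (1 / (1 - unit_root j * of_real F) ^ Suc n))"
    by (intro sums_sum sums_mult negative_binomial_sums root_times_F)
  moreover have "(\<Sum>j<k. cnj (unit_root j) ^ r * (of_nat ((m + n) choose m) * (unit_root j * of_real F) ^ m))
      = of_real (real k * F ^ r * basis_weight r n (m, n))" for m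
  proof -
    have "(\<Sum>j<k. cnj (unit_root j) ^ r * (of_nat ((m + n) choose m) * (unit_root j * of_real F) ^ m))
      = (\<Sum>j<k. cnj (unit_root j) ^ r * unit_root j ^ m) * (of_real F ^ m * of_nat ((m + n) choose m))"
      unfolding sum_distrib_right by (intro sum.cong refl) (simp add: power_mult_distrib mult_ac)
    also have "\<dots> = of_real (real k * F ^ r * basis_weight r n (m, n))"
      using F_pos r by (simp add: unit_root_filter basis_weight_row[OF r])
    finally show ?thesis .
  qed
  ultimately have "(\<lambda>m. of_real (real k * F ^ r * basis_weight r n (m, n)) :: complex)
      sums (\<Sum>j<k. cnj (unit_root j) ^ r * (1 / (1 - unit_root j * of_real F) ^ Suc n))"
    by simp
  moreover have "(\<lambda>m. of_real (real k * F ^ r * basis_weight r n (m, n)) :: complex)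
      sums of_real (real k * F ^ r * mass r n)"
    unfolding mass_def using row_sums[of "\<lambda>_. 1" r n] basis_weight_summable
    by (intro sums_of_real sums_mult) simp
  ultimately show ?thesis by (rule sums_unique2[symmetric])
qed

text \<open>The negative binomial moment counts m = k (m div k) + r rather than m div k, whence the
  combination on the left.\<close>

lemma moment_closed_form:
  assumes r: "r < k"
  shows "of_real (real k * F ^ r * (real k * moment r n + real r * mass r n))
    = (\<Sum>j<k. cnj (unit_root j) ^ r *
        (of_nat (Suc n) * (unit_root j * of_real F) / (1 - unit_root j * of_real F) ^ Suc (Suc n)))"
proof -
  have "(\<lambda>m. \<Sum>j<k. cnj (unit_root j) ^ r * (of_nat m * (of_nat ((m + n) choose m) * (unit_root j * of_real F) ^ m)))
      sums (\<Sum>j<k. cnj (unit_root j) ^ r *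
        (of_nat (Suc n) * (unit_root j * of_real F) / (1 - unit_root j * of_real F) ^ Suc (Suc n)))"
    by (intro sums_sum sums_mult negative_binomial_moment_sums root_times_F)
  moreover have "(\<Sum>j<k. cnj (unit_root j) ^ r * (of_nat m * (of_nat ((m + n) choose m) * (unit_root j * of_real F) ^ m)))
      = of_real (real k * F ^ r * (real k * (real (m div k) * basis_weight r n (m, n)) + real r * basis_weight r n (m, n)))" for m
  proof -
    have "(\<Sum>j<k. cnj (unit_root j) ^ r * (of_nat m * (of_nat ((m + n) choose m) * (unit_root j * of_real F) ^ m)))
      = (\<Sum>j<k. cnj (unit_root j) ^ r * unit_root j ^ m) * (of_nat m * of_real F ^ m * of_nat ((m + n) choose m))"
      unfolding sum_distrib_right by (intro sum.cong refl) (simp add: power_mult_distrib mult_ac)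
    also have "\<dots> = of_real (real k * F ^ r * (real m * basis_weight r n (m, n)))"
      using F_pos r by (simp add: unit_root_filter basis_weight_row[OF r])
    also have "real m * basis_weight r n (m, n)
        = real k * (real (m div k) * basis_weight r n (m, n)) + real r * basis_weight r n (m, n)"
    proof (cases "m mod k = r")
      case True
      then have "m = k * (m div k) + r" by (metis mult_div_mod_eq)
      then have "real m = real k * real (m div k) + real r" by (metis of_nat_add of_nat_mult)
      then show ?thesis by (simp only: distrib_right mult.assoc)
    qed (simp add: basis_weight_row[OF r])
    finally show ?thesis .
  qed
  ultimately have "(\<lambda>m. of_real (real k * F ^ r * (real k * (real (m div k) * basis_weight r n (m, n))
        + real r * basis_weight r n (m, n))) :: complex)
      sums (\<Sum>j<k. cnj (unit_root j) ^ r *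
        (of_nat (Suc n) * (unit_root j * of_real F) / (1 - unit_root j * of_real F) ^ Suc (Suc n)))"
    by simp
  moreover have "(\<lambda>m. of_real (real k * F ^ r * (real k * (real (m div k) * basis_weight r n (m, n))
        + real r * basis_weight r n (m, n))) :: complex)
      sums of_real (real k * F ^ r * (real k * moment r n + real r * mass r n))"
    unfolding mass_def moment_def
    using row_sums[of "\<lambda>_. 1" r n] basis_weight_summable
      row_sums[OF basis_weight_moment_summable, of n r]
    by (intro sums_of_real sums_mult sums_add) simp_all
  ultimately show ?thesis by (rule sums_unique2[symmetric])
qed

text \<open>
  The roots-of-unity filter writes \<open>mass\<close> and \<open>moment\<close> as sums of powers of \<open>(1 - F) / (1 - \<omega> F)\<close>;
  all terms with \<open>\<omega> \<noteq> 1\<close> decay exponentially, even after multiplication by \<open>n\<close>.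
\<close>

lemma mean_asymptotics:
  assumes r: "r < k"
  shows "(\<lambda>n. mean r n - (real (Suc n) * F / (1 - F) - real r) / real k) \<longlonglongrightarrow> 0"
proof -
  define q where "q j = of_real (1 - F) / (1 - unit_root j * of_real F)" for j
  \<comment> \<open>\<open>A\<close> and \<open>B\<close> are mass and moment divided by their terms
    at the root 1, so both tend to 1.\<close>
  define A where "A n = (\<Sum>j<k. cnj (unit_root j) ^ r * q j ^ (Suc n + 0))" for n
  define B where "B n = (\<Sum>j<k. (cnj (unit_root j) ^ r * unit_root j) * q j ^ (Suc n + 1))" for n
  have F1: "1 - F \<noteq> 0" using F_less_1 by simp
  have q0: "q 0 = 1" using F1 by (simp add: q_def)
  have q_less: "cmod (q j) < 1" if "0 < j" "j < k" for j
  proof -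
    have "cmod (q j) = (1 - F) / cmod (1 - unit_root j * of_real F)"
      unfolding q_def norm_divide norm_of_real using F_less_1 by simp
    then show ?thesis using F_less_norm[OF that] F_less_1 by (simp add: divide_less_eq)
  qed
  have limA: "(\<lambda>n. of_nat (Suc n) * (A n - 1)) \<longlonglongrightarrow> 0"
    unfolding A_def by (rule dominant_power_sum_limit[where q = q, OF k _ q0 q_less]) auto
  have limB: "(\<lambda>n. of_nat (Suc n) * (B n - 1)) \<longlonglongrightarrow> 0"
    unfolding B_def by (rule dominant_power_sum_limit[where q = q, OF k _ q0 q_less]) auto
  have "(\<lambda>n. inverse (of_nat (Suc n)) * (of_nat (Suc n) * (A n - 1))) \<longlonglongrightarrow> 0 * 0"
    by (intro tendsto_mult limA lim_inverse_n[THEN LIMSEQ_Suc])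
  moreover have "inverse (of_nat (Suc n)) * (of_nat (Suc n) * (A n - 1)) = A n - 1" for n
    using of_nat_neq_0[of n, where 'a = complex] by (simp del: of_nat_Suc)
  ultimately have "(\<lambda>n. A n - 1) \<longlonglongrightarrow> 0" by (simp del: of_nat_Suc)
  then have limA1: "A \<longlonglongrightarrow> 1" by (rule LIM_zero_cancel)
  have mass_A: "of_real (real k * F ^ r * mass r n) = A n / of_real (1 - F) ^ Suc n" for n
    unfolding mass_closed_form[OF r] A_def q_def sum_divide_distrib
    using F1 by (intro sum.cong refl) (simp add: power_divide)
  have moment_B: "of_real (real k * F ^ r * (real k * moment r n + real r * mass r n))
      = of_nat (Suc n) * of_real F * B n / of_real (1 - F) ^ Suc (Suc n)" for n
    unfolding moment_closed_form[OF r] B_def q_def sum_divide_distrib sum_distrib_left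
    using F1 by (intro sum.cong refl) (simp add: power_divide)
  \<comment> \<open>Since k \<lambda> + r = (n + 1) F / (1 - F) * B / A, the error is a constant
    times (n + 1) (B - A) / A, and B - A splits as (B - 1) - (A - 1).\<close>
  have "of_real (mean r n - (real (Suc n) * F / (1 - F) - real r) / real k)
      = of_real (F / (real k * (1 - F))) * ((of_nat (Suc n) * (B n - 1) - of_nat (Suc n) * (A n - 1)) / A n)" for n
  proof -
    have pos: "real k * F ^ r * mass r n \<noteq> 0" using k F_pos mass_pos[OF r, of n] by simp
    then have A0: "A n \<noteq> 0" using mass_A[of n] by (metis div_0 of_real_eq_0_iff)
    have "of_real (real k * mean r n + real r)
        = of_real (real k * F ^ r * (real k * moment r n + real r * mass r n)) / (of_real (real k * F ^ r * mass r n) :: complex)"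
      using pos unfolding of_real_divide[symmetric] of_real_eq_iff by (simp add: mean_def field_simps)
    also have "\<dots> = of_nat (Suc n) * of_real (F / (1 - F)) * (B n / A n)"
      unfolding mass_A moment_B using F1 A0 by (simp add: divide_simps)
    finally have *: "of_real (real k * mean r n + real r) = of_nat (Suc n) * of_real (F / (1 - F)) * (B n / A n)" .
    have "of_real (mean r n - (real (Suc n) * F / (1 - F) - real r) / real k)
        = (of_real (real k * mean r n + real r) - of_nat (Suc n) * of_real (F / (1 - F))) / (of_real (real k) :: complex)"
      using k F1 by (simp add: field_simps)
    also have "\<dots> = of_real (F / (real k * (1 - F))) * ((of_nat (Suc n) * (B n - 1) - of_nat (Suc n) * (A n - 1)) / A n)"
    proof -
      have alg: "(N * c * (b / a) - N * c) / K = (c / K) * ((N * (b - 1) - N * (a - 1)) / a)"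
        if "K \<noteq> 0" "a \<noteq> 0" for N c a b K :: complex
        using that by (simp add: field_simps)
      have "of_real (F / (real k * (1 - F))) = of_real (F / (1 - F)) / (of_real (real k) :: complex)"
        by (simp add: mult.commute)
      then show ?thesis unfolding * by (simp only:) (rule alg[OF _ A0], use k in simp)
    qed
    finally show ?thesis .
  qed
  moreover have "(\<lambda>n. of_real (F / (real k * (1 - F))) * ((of_nat (Suc n) * (B n - 1) - of_nat (Suc n) * (A n - 1)) / A n))
      \<longlonglongrightarrow> of_real (F / (real k * (1 - F))) * ((0 - 0) / 1)"
    by (intro tendsto_mult tendsto_const tendsto_divide tendsto_diff limA limB limA1) simp
  ultimately have "(\<lambda>n. complex_of_real (mean r n - (real (Suc n) * F / (1 - F) - real r) / real k)) \<longlonglongrightarrow> of_real 0"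
    by simp
  then show ?thesis unfolding tendsto_of_real_iff .
qed

end

section \<open>Conjugation by the monodromy\<close>

lemma norm_cis_minus_one_le: "cmod (cis x - 1) \<le> \<bar>x\<bar>"
  using Taylor_exp[of "\<i> * of_real x" 0] by (simp add: cis_conv_exp norm_mult)

context da_ideal
begin

section \<open>Compact diagonal operators on the complement\<close>

lemma diag_S_bounded_ops:
  assumes b: "\<And>p. cmod (d p) \<le> K" and per: "\<And>m n. d (m + k, n) = d (m, n)"
  shows "restrict (diag d) (S 0) \<in> bounded_ops (S 0) (S 0)"
proof (rule restrict_bounded_ops[OF closed_csubspace_I_perp, where K = K])
  fix f assume "f \<in> S 0"
  then have "diag d f \<in> S (0 + 0)" by (rule diag_in_S[OF _ b]) (simp add: per)
  then show "diag d f \<in> S 0" by simp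
qed (use diag_add[OF b] diag_cscale[OF b] norm_diag_le[OF b] in simp_all)

lemma periodic_mod:
  assumes "\<And>m n. d (m + k, n) = d (m, n)"
  shows "d (m mod k, n) = d (m, n)"
proof -
  have "d (r + j * k, n) = d (r, n)" for r j
  proof (induction j)
    case (Suc j)
    have "d (r + Suc j * k, n) = d ((r + j * k) + k, n)" by (simp add: algebra_simps)
    then show ?case using assms Suc.IH by simp
  qed simp
  from this[of "m mod k" "m div k"] show ?thesis by simp
qed

lemma wcoeff_le_norm: "cmod (wcoeff f m n) \<le> norm f"
proof -
  let ?w = "monomial_norm2 (m, n)"
  have w: "0 < ?w" by (rule monomial_norm2_pos)
  have "sqrt ?w * sqrt ?w \<le> sqrt ?w * 1"
    using w monomial_norm2_le_1[of "(m, n)"] by (intro mult_left_mono) auto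
  then have "?w \<le> sqrt ?w" using w by simp
  then have "cmod (coeffs2 f (m, n)) * ?w \<le> cmod (coeffs2 f (m, n)) * sqrt ?w"
    by (rule mult_left_mono) simp
  also have "\<dots> \<le> norm f" by (rule coeffs2_le_norm)
  finally show ?thesis using w by (simp add: wcoeff_def norm_mult)
qed

text \<open>A symbol of period k is constant along each family, so cutting off at
  \<open>n < N\<close> leaves only the \<open>k * N\<close> basis vectors below the cutoff: an
  operator of finite rank.\<close>

lemma diag_truncated:
  assumes b: "\<And>p. cmod (d p) \<le> K" and per: "\<And>m n. d (m + k, n) = d (m, n)" and f: "f \<in> S 0"
  shows "diag (\<lambda>p. if snd p < N then d p else 0) f
    = (\<Sum>i\<in>{..<k} \<times> {..<N}. cscale (d i * wcoeff f (fst i) (snd i)) (basis (fst i) (snd i)))"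
proof (rule da_eqI)
  fix p :: "nat \<times> nat"
  obtain m l where p: "p = (m, l)" by (cases p)
  have b': "cmod (if snd p < N then d p else 0) \<le> K" for p
    using b[of p] order_trans[OF norm_ge_zero b[of p]] by simp
  let ?v = "d (m, l) * coeffs2 f (m, l)"
  have "coeffs2 (cscale (d i * wcoeff f (fst i) (snd i)) (basis (fst i) (snd i))) p
      = (if i = (m mod k, l) then ?v else 0)" for i
  proof (cases "i = (m mod k, l)")
    case True
    have "coeffs2 f (m, l) = wcoeff f m l / of_real (monomial_norm2 (m, l))"
      by (simp add: wcoeff_def)
    also have "wcoeff f m l = of_real (\<epsilon> ^ (m div k)) * wcoeff f (m mod k) l"
      using wcoeff_S[OF f, of m l] by simp
    finally show ?thesis using True
      by (simp add: p coeffs2_cscale coeffs2_basis basis_coeffs_def periodic_mod[of d, OF per])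
  next
    case False
    then have "basis_coeffs (fst i) (snd i) p = 0" by (auto simp: basis_coeffs_def p prod_eq_iff)
    then show ?thesis using False by (simp add: coeffs2_cscale coeffs2_basis)
  qed
  then have "coeffs2 (\<Sum>i\<in>{..<k} \<times> {..<N}. cscale (d i * wcoeff f (fst i) (snd i)) (basis (fst i) (snd i))) p
      = (\<Sum>i\<in>{..<k} \<times> {..<N}. if i = (m mod k, l) then ?v else 0)"
    unfolding coeffs2_sum by (intro sum.cong refl)
  also have "\<dots> = (if l < N then ?v else 0)" using k by (simp add: sum.delta)
  also have "\<dots> = coeffs2 (diag (\<lambda>p. if snd p < N then d p else 0) f) p"
    unfolding coeffs2_diag[where \<nu> = "\<lambda>p. if snd p < N then d p else 0", OF b'] by (simp add: p)
  finally show "coeffs2 (diag (\<lambda>p. if snd p < N then d p else 0) f) p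
      = coeffs2 (\<Sum>i\<in>{..<k} \<times> {..<N}. cscale (d i * wcoeff f (fst i) (snd i)) (basis (fst i) (snd i))) p"
    by simp
qed

text \<open>A norm limit of the finite-rank truncations: past row \<open>N\<close> the symbol is
  uniformly small, and coefficients bounded by \<open>K\<close> keep the truncated images of the
  unit ball in a compact set.\<close>

lemma diag_compact_ops:
  assumes b: "\<And>p. cmod (d p) \<le> K" and per: "\<And>m n. d (m + k, n) = d (m, n)"
    and lim: "\<And>e. 0 < e \<Longrightarrow> \<exists>N. \<forall>m n. N \<le> n \<longrightarrow> cmod (d (m, n)) \<le> e"
  shows "restrict (diag d) (S 0) \<in> compact_ops (S 0) (S 0)"
proof -
  have "compact (closure (restrict (diag d) (S 0) ` (S 0 \<inter> cball 0 1)))"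
  proof (rule compact_closure_approx)
    fix e :: real assume e: "0 < e"
    then obtain N where N: "\<And>m n. N \<le> n \<Longrightarrow> cmod (d (m, n)) \<le> e / 2"
      using lim[of "e / 2"] by auto
    define dN where "dN = (\<lambda>p. if snd p < N then d p else 0)"
    have bN: "cmod (dN p) \<le> K" for p
      using b[of p] order_trans[OF norm_ge_zero b[of p]] by (simp add: dN_def)
    define C where "C = {sum x ({..<k} \<times> {..<N}) | x. \<forall>i\<in>{..<k} \<times> {..<N}.
      x i \<in> (\<lambda>c. cscale c (basis (fst i) (snd i))) ` cball 0 K}"
    have "compact C"
      unfolding C_def by (rule compact_finite_sums) (auto simp: compact_cscale_disc)
    moreover have "\<exists>c\<in>C. dist c x < e" if "x \<in> restrict (diag d) (S 0) ` (S 0 \<inter> cball 0 1)" for x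
    proof -
      obtain f where f: "f \<in> S 0" "norm f \<le> 1" and x: "x = diag d f" using \<open>x \<in> _\<close> by auto
      have "diag dN f \<in> C"
        unfolding C_def
      proof (intro CollectI exI conjI ballI)
        show "diag dN f = (\<Sum>i\<in>{..<k} \<times> {..<N}. cscale (d i * wcoeff f (fst i) (snd i)) (basis (fst i) (snd i)))"
          unfolding dN_def by (rule diag_truncated[OF b per f(1)])
        fix i
        have "cmod (wcoeff f (fst i) (snd i)) \<le> 1" using wcoeff_le_norm[of f "fst i" "snd i"] f(2) by simp
        then have "cmod (d i) * cmod (wcoeff f (fst i) (snd i)) \<le> K * 1"
          using b[of i] order_trans[OF norm_ge_zero b[of i]] by (intro mult_mono) auto
        then have "d i * wcoeff f (fst i) (snd i) \<in> cball 0 K" by (simp add: norm_mult)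
        then show "cscale (d i * wcoeff f (fst i) (snd i)) (basis (fst i) (snd i))
            \<in> (\<lambda>c. cscale c (basis (fst i) (snd i))) ` cball 0 K" by (rule imageI)
      qed
      moreover have "norm (diag dN f - x) \<le> e / 2 * norm f"
      proof (rule norm_le_coeffs)
        fix p
        have "cmod (dN p - d p) \<le> e / 2" using N[of "snd p" "fst p"] e by (simp add: dN_def)
        then have "cmod (dN p - d p) * cmod (coeffs2 f p) \<le> e / 2 * cmod (coeffs2 f p)"
          by (rule mult_right_mono) simp
        moreover have "coeffs2 (diag dN f - x) p = (dN p - d p) * coeffs2 f p"
          by (simp add: x coeffs2_diff coeffs2_diag[where \<nu> = dN, OF bN] coeffs2_diag[where \<nu> = d, OF b] left_diff_distrib)
        ultimately show "cmod (coeffs2 (diag dN f - x) p) \<le> e / 2 * cmod (coeffs2 f p)"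
          by (simp add: norm_mult)
      qed (use e in simp)
      moreover have "e / 2 * norm f \<le> e / 2 * 1" using f(2) e by (intro mult_left_mono) auto
      ultimately have "diag dN f \<in> C" "norm (diag dN f - x) < e" using e by linarith+
      then show ?thesis unfolding dist_norm by blast
    qed
    ultimately show "\<exists>C. compact C \<and> (\<forall>x\<in>restrict (diag d) (S 0) ` (S 0 \<inter> cball 0 1). \<exists>c\<in>C. dist c x < e)"
      by blast
  qed
  then show ?thesis using diag_S_bounded_ops[OF b per] by (simp add: compact_ops_def)
qed

section \<open>Phase differences up to vanishing errors\<close>

definition phase_error :: "nat \<Rightarrow> nat \<Rightarrow> real" where
  "phase_error r n = mean r n - (real (Suc n) * F / (1 - F) - real r) / real k"

text \<open>The residue in the asymptotic mean and the block number combine to m / k, so up to the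
  error the phase is affine in m and n.\<close>

lemma phase_eq: "phase (m, n) = phase_error (m mod k) n + real (Suc n) * F / (1 - F) / real k - real m / real k"
proof -
  have "real m = real k * real (m div k) + real (m mod k)"
    by (metis mult_div_mod_eq of_nat_add of_nat_mult)
  then have "real m / real k = real (m div k) + real (m mod k) / real k"
    using k by (simp add: field_simps)
  then show ?thesis by (simp add: phase_def phase_error_def diff_divide_distrib)
qed

text \<open>Uniform in m because only k residues occur.\<close>

lemma phase_error_uniform:
  assumes "0 < e"
  obtains N where "\<And>m n. N \<le> n \<Longrightarrow> \<bar>phase_error (m mod k) n\<bar> < e"
proof -
  have "\<forall>r\<in>{..<k}. \<forall>\<^sub>F n in sequentially. \<bar>phase_error r n\<bar> < e"
    using tendstoD[OF mean_asymptotics assms] by (auto simp: phase_error_def dist_real_def)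
  then have "\<forall>\<^sub>F n in sequentially. \<forall>r\<in>{..<k}. \<bar>phase_error r n\<bar> < e"
    by (rule eventually_ball_finite[rotated]) simp
  then obtain N where "\<forall>n\<ge>N. \<forall>r\<in>{..<k}. \<bar>phase_error r n\<bar> < e"
    unfolding eventually_sequentially by blast
  then show thesis using k by (intro that[of N]) simp
qed

text \<open>
  The symbol of \<open>U\<^sup>*TU - e\<^sup>i\<^sup>x T\<close> relative to \<open>T\<close>, for a compression \<open>T\<close> of a multiplication operator sending the
  monomial with exponent \<open>h p\<close> to the one with exponent \<open>p\<close>, up to shifting exponents of \<open>z\<^sub>1\<close> by \<open>k\<close>.
\<close>

definition twist :: "(nat \<times> nat \<Rightarrow> nat \<times> nat) \<Rightarrow> real \<Rightarrow> nat \<times> nat \<Rightarrow> complex" where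
  "twist h x p = cis (2 * pi * (phase (h p) - phase p)) - cis x"

lemma norm_twist_le: "cmod (twist h x p) \<le> 2"
  using norm_triangle_ineq4[of "cis (2 * pi * (phase (h p) - phase p))" "cis x"]
  by (simp add: twist_def)

lemma twist_periodic:
  assumes "\<And>m n. h (m + k, n) = (fst (h (m, n)) + k, snd (h (m, n)))"
  shows "twist h x (m + k, n) = twist h x (m, n)"
proof -
  have "phase (h (m + k, n)) = phase (h (m, n)) - 1"
    unfolding assms phase_shift by simp
  then show ?thesis by (simp add: twist_def phase_shift)
qed

text \<open>The integer \<open>j\<close> allows a shift to cross a block of length k, which a full
  turn does not see; \<open>N\<^sub>0\<close> excludes the bottom row, where lowering n is
  truncated.\<close>

lemma twist_limit:
  assumes h: "\<And>m n. N\<^sub>0 \<le> n \<Longrightarrow> \<exists>m' n'. n \<le> Suc n' \<and> (\<exists>j::int. 2 * pi * (phase (h (m, n)) - phase (m, n))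
      = x + 2 * pi * of_int j + 2 * pi * (phase_error (m' mod k) n' - phase_error (m mod k) n))"
    and e: "0 < e"
  shows "\<exists>N. \<forall>m n. N \<le> n \<longrightarrow> cmod (twist h x (m, n)) \<le> e"
proof -
  have "0 < e / (4 * pi)" using e by simp
  then obtain N where N: "\<And>m n. N \<le> n \<Longrightarrow> \<bar>phase_error (m mod k) n\<bar> < e / (4 * pi)"
    by (rule phase_error_uniform) blast
  show ?thesis
  \<comment> \<open>\<open>Suc N\<close>, because the source row \<open>n'\<close> may lie one below
    \<open>n\<close>.\<close>
  proof (intro exI[of _ "max N\<^sub>0 (Suc N)"] allI impI)
    fix m n assume n: "max N\<^sub>0 (Suc N) \<le> n"
    then obtain m' n' j where *: "n \<le> Suc n'" "2 * pi * (phase (h (m, n)) - phase (m, n))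
      = x + 2 * pi * of_int j + 2 * pi * (phase_error (m' mod k) n' - phase_error (m mod k) n)"
      using h[of n m] by auto
    define y where "y = 2 * pi * (phase_error (m' mod k) n' - phase_error (m mod k) n)"
    have "twist h x (m, n) = cis x * (cis y - 1)"
      unfolding twist_def *(2) y_def[symmetric]
      by (simp add: cis_mult[symmetric] cis_multiple_2pi right_diff_distrib)
    then have "cmod (twist h x (m, n)) \<le> \<bar>y\<bar>" using norm_cis_minus_one_le by (simp add: norm_mult)
    also have "\<bar>y\<bar> = 2 * pi * \<bar>phase_error (m' mod k) n' - phase_error (m mod k) n\<bar>"
      by (simp add: y_def abs_mult)
    also have "\<dots> \<le> 2 * pi * (e / (2 * pi))"
    proof (rule mult_left_mono)
      have "e / (2 * pi) = e / (4 * pi) + e / (4 * pi)" by (simp add: field_simps)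
      then show "\<bar>phase_error (m' mod k) n' - phase_error (m mod k) n\<bar> \<le> e / (2 * pi)"
        using N[of n' m'] N[of n m] n *(1) by linarith
    qed simp
    also have "\<dots> = e" by simp
    finally show "cmod (twist h x (m, n)) \<le> e" .
  qed
qed

section \<open>The monodromy operator and its conjugation action\<close>

abbreviation U :: "da \<Rightarrow> da" where "U \<equiv> restrict (transport (2 * pi)) (S 0)"

abbreviation V :: "da \<Rightarrow> da" where "V \<equiv> restrict (transport (- (2 * pi))) (S 0)"

lemma S_2pi: "S (2 * pi) = S 0" "S (- (2 * pi)) = S 0"
  by (auto simp: I_perp_iff cis_cnj[symmetric])

lemma transport_2pi_in_S: "f \<in> S 0 \<Longrightarrow> transport (2 * pi) f \<in> S 0"
  "f \<in> S 0 \<Longrightarrow> transport (- (2 * pi)) f \<in> S 0"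
  using transport_in_S[of f 0 "2 * pi"] transport_in_S[of f 0 "- (2 * pi)"] by (simp_all add: S_2pi)

lemma U_bounded_ops: "U \<in> bounded_ops (S 0) (S 0)" and V_bounded_ops: "V \<in> bounded_ops (S 0) (S 0)"
  using transport_bounded_ops[of "2 * pi"] transport_bounded_ops[of "- (2 * pi)"] by (simp_all add: S_2pi)

lemma unitary_U: "unitary_op (S 0) (S 0) U"
  unfolding unitary_op_def
proof (intro conjI ballI U_bounded_ops)
  show "U ` S 0 = S 0"
  proof
    show "U ` S 0 \<subseteq> S 0" by (auto simp: transport_2pi_in_S)
    show "S 0 \<subseteq> U ` S 0"
    proof
      fix f assume f: "f \<in> S 0"
      have "f = U (V f)" using f by (simp add: transport_2pi_in_S transport_transport)
      then show "f \<in> U ` S 0" using f by (auto simp: transport_2pi_in_S intro!: image_eqI[of _ _ "V f"])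
    qed
  qed
  fix f g assume "f \<in> S 0" "g \<in> S 0"
  then show "cinner (U f) (U g) = cinner f g" by (simp add: cinner_transport transport_transport)
qed

lemma adj_U: "adj (S 0) (S 0) U = V"
  by (rule adj_eqI[OF closed_csubspace_I_perp V_bounded_ops]) (simp add: cinner_transport)

text \<open>Moving the symbol of \<open>U\<close> past \<open>M\<close> shifts it by
  \<open>h\<close>, and periodicity lets it commute with the projection; after applying
  \<open>V\<close> only the phase difference between source and target remains.\<close>

lemma conj_compression:
  assumes M: "\<And>\<nu> K f. (\<And>p. cmod (\<nu> p) \<le> K) \<Longrightarrow> (\<And>m n. \<nu> (m + k, n) = \<nu> (m, n)) \<Longrightarrow>
      M (diag \<nu> f) = diag (\<lambda>p. \<nu> (h p)) (M f)"
    and h: "\<And>m n. h (m + k, n) = (fst (h (m, n)) + k, snd (h (m, n)))"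
    and f: "f \<in> S 0"
  shows "V (compression (S 0) M (U f)) - cscale (cis x) (compression (S 0) M f)
    = diag (twist h x) (compression (S 0) M f)"
proof -
  define \<mu> where "\<mu> = (\<lambda>p. cis (2 * pi * phase p))"
  \<comment> \<open>This is where a full turn is used: the phase drops by exactly 1 over a
    period.\<close>
  have per: "\<mu> (m + k, n) = \<mu> (m, n)" for m n
    by (simp add: \<mu>_def phase_shift right_diff_distrib flip: cis_divide)
  have hper: "\<mu> (h (m + k, n)) = \<mu> (h (m, n))" for m n
    unfolding h per by simp
  have b: "cmod (\<mu> (h p)) \<le> 1" for p by (simp add: \<mu>_def)
  have inv: "diag (\<lambda>p. \<mu> (h p)) g \<in> S 0" "diag (\<lambda>p. cnj (\<mu> (h p))) g \<in> S 0" if "g \<in> S 0" for g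
    using diag_in_S[OF that, of "\<lambda>p. \<mu> (h p)" 1 0] diag_in_S[OF that, of "\<lambda>p. cnj (\<mu> (h p))" 1 0] b
    by (simp_all add: hper)
  define g where "g = proj (S 0) (M f)"
  have "transport (2 * pi) f = diag \<mu> f" by (simp add: transport_def \<mu>_def)
  moreover have "M (diag \<mu> f) = diag (\<lambda>p. \<mu> (h p)) (M f)"
    by (rule M[where K = 1]) (simp_all add: \<mu>_def per[unfolded \<mu>_def])
  moreover have "proj (S 0) (diag (\<lambda>p. \<mu> (h p)) (M f)) = diag (\<lambda>p. \<mu> (h p)) g"
    unfolding g_def by (rule proj_diag[OF closed_csubspace_I_perp b inv])
  ultimately have "compression (S 0) M (U f) = diag (\<lambda>p. \<mu> (h p)) g"
    using f transport_2pi_in_S(1)[OF f] by (simp add: compression_def)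
  moreover have g: "g \<in> S 0" unfolding g_def by (rule proj_in[OF closed_csubspace_I_perp])
  ultimately have "V (compression (S 0) M (U f)) = transport (- (2 * pi)) (diag (\<lambda>p. \<mu> (h p)) g)"
    using inv by simp
  moreover have "transport (- (2 * pi)) (diag (\<lambda>p. \<mu> (h p)) g) - cscale (cis x) g = diag (twist h x) g"
    by (rule da_eqI)
      (simp add: coeffs2_simps coeffs2_transport coeffs2_diag[where K = 1, OF b]
        coeffs2_diag[where K = 2, OF norm_twist_le],
        simp add: twist_def \<mu>_def left_diff_distrib right_diff_distrib cis_mult flip: mult.assoc)
  moreover have "compression (S 0) M f = g" using f by (simp add: compression_def g_def)
  ultimately show ?thesis by simp
qed

text \<open>The first operator is a compact diagonal operator after \<open>T\<close>. Taking
  adjoints turns this product into the adjoint of \<open>T\<close> after the compact diagonal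
  operator with conjugate symbol.\<close>

lemma conj_compact:
  assumes T: "T \<in> bounded_ops (S 0) (S 0)"
    and b: "\<And>p. cmod (d p) \<le> K" and per: "\<And>m n. d (m + k, n) = d (m, n)"
    and lim: "\<And>e. 0 < e \<Longrightarrow> \<exists>N. \<forall>m n. N \<le> n \<longrightarrow> cmod (d (m, n)) \<le> e"
    and eq: "\<And>f. f \<in> S 0 \<Longrightarrow> V (T (U f)) - cscale c (T f) = diag d (T f)"
  shows "(\<lambda>f\<in>S 0. V (T (U f)) - cscale c (T f)) \<in> compact_ops (S 0) (S 0)"
    and "(\<lambda>f\<in>S 0. V (adj (S 0) (S 0) T (U f)) - cscale (cnj c) (adj (S 0) (S 0) T f))
      \<in> compact_ops (S 0) (S 0)"
proof -
  note S0 = closed_csubspace_I_perp[of k \<epsilon> 0]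
  let ?T' = "adj (S 0) (S 0) T"
  let ?d' = "\<lambda>p. cnj (d p)"
  note T' = adj_bounded_ops[OF S0 S0 T]
  have "(\<lambda>f\<in>S 0. V (T (U f)) - cscale c (T f)) = compose (S 0) (restrict (diag d) (S 0)) T"
    unfolding compose_def
    by (rule restrict_ext) (simp only: eq restrict_apply'[OF bounded_opsD(2)[OF T]])
  then show "(\<lambda>f\<in>S 0. V (T (U f)) - cscale c (T f)) \<in> compact_ops (S 0) (S 0)"
    using compact_ops_comp_right[OF diag_compact_ops[OF b per lim] T S0 S0] by simp
  have b': "cmod (?d' p) \<le> K" for p using b by simp
  have D: "restrict (diag ?d') (S 0) \<in> compact_ops (S 0) (S 0)"
    by (rule diag_compact_ops[OF b']) (simp_all add: per lim)
  then have Db: "restrict (diag ?d') (S 0) \<in> bounded_ops (S 0) (S 0)" by (simp add: compact_ops_def)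
  have "V (?T' (U f)) - cscale (cnj c) (?T' f) = ?T' (diag ?d' f)" if f: "f \<in> S 0" for f
  proof (rule inner_eq_imp_eq[OF S0])
    have Uf: "U f \<in> S 0" and T'f: "?T' f \<in> S 0" and Df: "diag ?d' f \<in> S 0"
      using bounded_opsD(2)[OF U_bounded_ops f] bounded_opsD(2)[OF T' f] bounded_opsD(2)[OF Db f] f by simp_all
    have T'Uf: "?T' (U f) \<in> S 0" by (rule bounded_opsD(2)[OF T' Uf])
    show "V (?T' (U f)) - cscale (cnj c) (?T' f) \<in> S 0"
      by (intro closed_csubspaceD(5)[OF S0] closed_csubspaceD(3)[OF S0] T'f bounded_opsD(2)[OF V_bounded_ops T'Uf])
    show "?T' (diag ?d' f) \<in> S 0" by (rule bounded_opsD(2)[OF T' Df])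
    fix g assume g: "g \<in> S 0"
    have Ug: "U g \<in> S 0" and Tg: "T g \<in> S 0"
      using bounded_opsD(2)[OF U_bounded_ops g] bounded_opsD(2)[OF T g] .
    have TUg: "T (U g) \<in> S 0" by (rule bounded_opsD(2)[OF T Ug])
    have "cinner g (V (?T' (U f))) = cinner (U g) (?T' (U f))"
      using cinner_adj[OF S0 S0 U_bounded_ops g T'Uf] unfolding adj_U by simp
    also have "\<dots> = cinner (T (U g)) (U f)" using cinner_adj[OF S0 S0 T Ug Uf] by simp
    also have "\<dots> = cinner (V (T (U g))) f"
      using cinner_adj'[OF S0 S0 U_bounded_ops f TUg] unfolding adj_U by simp
    also have "V (T (U g)) = cscale c (T g) + diag d (T g)" using eq[OF g] by (simp add: diff_eq_eq add.commute)
    also have "cinner (cscale c (T g) + diag d (T g)) f = c * cinner (T g) f + cinner (T g) (diag ?d' f)"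
      by (simp add: cinner_add_left cinner_cscale_left cinner_diag[OF b])
    also have "\<dots> = cinner g (cscale (cnj c) (?T' f)) + cinner g (?T' (diag ?d' f))"
      using cinner_adj[OF S0 S0 T g f] cinner_adj[OF S0 S0 T g Df] by (simp add: cinner_cscale_right)
    finally show "cinner g (V (?T' (U f)) - cscale (cnj c) (?T' f)) = cinner g (?T' (diag ?d' f))"
      by (simp add: cinner_diff_right)
  qed
  then have "(\<lambda>f\<in>S 0. V (?T' (U f)) - cscale (cnj c) (?T' f)) = compose (S 0) ?T' (restrict (diag ?d') (S 0))"
    unfolding compose_def by (intro restrict_ext) simp
  then show "(\<lambda>f\<in>S 0. V (?T' (U f)) - cscale (cnj c) (?T' f)) \<in> compact_ops (S 0) (S 0)"
    using compact_ops_comp_left[OF T' D S0 S0] by simp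
qed

lemma T1_bounded_ops: "T1 k \<epsilon> \<in> bounded_ops (S 0) (S 0)"
  unfolding T1_def
  by (rule compression_bounded_ops[OF closed_csubspace_I_perp mult_z1_add mult_z1_cscale norm_mult_z1_le])

lemma T2_bounded_ops: "T2 k \<epsilon> \<in> bounded_ops (S 0) (S 0)"
  unfolding T2_def
  by (rule compression_bounded_ops[OF closed_csubspace_I_perp mult_z2_add mult_z2_cscale norm_mult_z2_le])

lemma conj_T1_compact:
  shows "(\<lambda>f\<in>S 0. V (T1 k \<epsilon> (U f)) - cscale (cis (2 * pi / real k)) (T1 k \<epsilon> f)) \<in> compact_ops (S 0) (S 0)"
    and "(\<lambda>f\<in>S 0. V (adj (S 0) (S 0) (T1 k \<epsilon>) (U f)) - cscale (cis (- (2 * pi / real k))) (adj (S 0) (S 0) (T1 k \<epsilon>) f))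
      \<in> compact_ops (S 0) (S 0)"
proof -
  \<comment> \<open>\<open>fst p + k - 1\<close> instead of the truncated \<open>fst p - 1\<close>, for which the shift rule below would fail at \<open>m = 0\<close>\<close>
  define h :: "nat \<times> nat \<Rightarrow> nat \<times> nat" where "h = (\<lambda>p. (fst p + k - 1, snd p))"
  have h: "h (m + k, n) = (fst (h (m, n)) + k, snd (h (m, n)))" for m n using k by (simp add: h_def)
  have M: "mult_z1 (diag \<nu> f) = diag (\<lambda>p. \<nu> (h p)) (mult_z1 f)"
    if b: "\<And>p. cmod (\<nu> p) \<le> K" and per: "\<And>m n. \<nu> (m + k, n) = \<nu> (m, n)" for \<nu> K f
  proof (rule da_eqI)
    fix p
    have "\<nu> (h p) = \<nu> (fst p - 1, snd p)" if "fst p \<noteq> 0"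
      using that per[of "fst p - 1" "snd p"] by (simp add: h_def)
    then show "coeffs2 (mult_z1 (diag \<nu> f)) p = coeffs2 (diag (\<lambda>p. \<nu> (h p)) (mult_z1 f)) p"
      by (simp add: coeffs2_mult_z1 coeffs2_diag[where \<nu> = \<nu>, OF b]
          coeffs2_diag[where \<nu> = "\<lambda>p. \<nu> (h p)" and K = K, OF b])
  qed
  have lim: "\<exists>N. \<forall>m n. N \<le> n \<longrightarrow> cmod (twist h (2 * pi / real k) (m, n)) \<le> e" if "0 < e" for e
  proof (rule twist_limit[OF _ that])
    fix m n
    \<comment> \<open>The source has first exponent m - 1, which gains 1 / k of a turn; the added k
      costs one full turn, the integer -1 below.\<close>
    have "real (m + k - 1) = real m + real k - 1" using k by (simp add: of_nat_diff)
    then have "phase (h (m, n)) - phase (m, n)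
      = 1 / real k - 1 + (phase_error ((m + k - 1) mod k) n - phase_error (m mod k) n)"
      using k by (simp add: h_def phase_eq field_simps)
    then have "2 * pi * (phase (h (m, n)) - phase (m, n))
        = 2 * pi * (1 / real k - 1 + (phase_error ((m + k - 1) mod k) n - phase_error (m mod k) n))"
      by (simp only:)
    also have "\<dots> = 2 * pi / real k + 2 * pi * of_int (- 1)
        + 2 * pi * (phase_error ((m + k - 1) mod k) n - phase_error (m mod k) n)"
      by (simp add: algebra_simps)
    finally have "2 * pi * (phase (h (m, n)) - phase (m, n)) = 2 * pi / real k + 2 * pi * of_int (- 1)
        + 2 * pi * (phase_error ((m + k - 1) mod k) n - phase_error (m mod k) n)" .
    then show "\<exists>m' n'. n \<le> Suc n' \<and> (\<exists>j::int. 2 * pi * (phase (h (m, n)) - phase (m, n))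
      = 2 * pi / real k + 2 * pi * of_int j + 2 * pi * (phase_error (m' mod k) n' - phase_error (m mod k) n))"
      by (intro exI[of _ "m + k - 1"] exI[of _ n] conjI exI[of _ "-1 :: int"]) simp_all
  qed
  note * = conj_compact[OF T1_bounded_ops norm_twist_le twist_periodic[OF h] lim
      conj_compression[of mult_z1, OF M h, folded T1_def]]
  show "(\<lambda>f\<in>S 0. V (T1 k \<epsilon> (U f)) - cscale (cis (2 * pi / real k)) (T1 k \<epsilon> f)) \<in> compact_ops (S 0) (S 0)"
    by (rule *(1))
  show "(\<lambda>f\<in>S 0. V (adj (S 0) (S 0) (T1 k \<epsilon>) (U f)) - cscale (cis (- (2 * pi / real k))) (adj (S 0) (S 0) (T1 k \<epsilon>) f))
      \<in> compact_ops (S 0) (S 0)"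
    using *(2) unfolding cis_cnj .
qed

lemma conj_T2_compact:
  shows "(\<lambda>f\<in>S 0. V (T2 k \<epsilon> (U f)) - cscale (cis (- (2 * pi * F / (real k * (1 - F))))) (T2 k \<epsilon> f)) \<in> compact_ops (S 0) (S 0)"
    and "(\<lambda>f\<in>S 0. V (adj (S 0) (S 0) (T2 k \<epsilon>) (U f)) - cscale (cis (2 * pi * F / (real k * (1 - F)))) (adj (S 0) (S 0) (T2 k \<epsilon>) f))
      \<in> compact_ops (S 0) (S 0)"
proof -
  \<comment> \<open>the value at \<open>snd p = 0\<close> is irrelevant: \<^const>\<open>mult_z2\<close> has no such coefficients\<close>
  define h :: "nat \<times> nat \<Rightarrow> nat \<times> nat" where "h = (\<lambda>p. (fst p, snd p - 1))"
  have h: "h (m + k, n) = (fst (h (m, n)) + k, snd (h (m, n)))" for m n by (simp add: h_def)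
  have M: "mult_z2 (diag \<nu> f) = diag (\<lambda>p. \<nu> (h p)) (mult_z2 f)"
    if b: "\<And>p. cmod (\<nu> p) \<le> K" and per: "\<And>m n. \<nu> (m + k, n) = \<nu> (m, n)" for \<nu> K f
    by (rule da_eqI) (simp add: coeffs2_mult_z2 coeffs2_diag[where \<nu> = \<nu>, OF b]
        coeffs2_diag[where \<nu> = "\<lambda>p. \<nu> (h p)" and K = K, OF b], simp add: h_def)
  let ?x = "- (2 * pi * F / (real k * (1 - F)))"
  have lim: "\<exists>N. \<forall>m n. N \<le> n \<longrightarrow> cmod (twist h ?x (m, n)) \<le> e" if "0 < e" for e
  proof (rule twist_limit[OF _ that])
    fix m n :: nat assume n: "1 \<le> n"
    \<comment> \<open>The increment of the asymptotic mean when n grows by one. The source row is n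
      - 1, so \<open>c\<close> enters with a minus sign.\<close>
    define c where "c = F / (real k * (1 - F))"
    have c: "real l * F / (1 - F) / real k = real l * c" for l
      by (simp add: c_def mult.commute)
    obtain l where l: "n = Suc l" using n by (cases n) auto
    have "phase (h (m, n)) - phase (m, n) = - c + (phase_error (m mod k) (n - 1) - phase_error (m mod k) n)"
      unfolding h_def fst_conv snd_conv phase_eq c by (simp add: l distrib_right)
    then have "2 * pi * (phase (h (m, n)) - phase (m, n))
        = 2 * pi * (- c + (phase_error (m mod k) (n - 1) - phase_error (m mod k) n))"
      by (simp only:)
    also have "\<dots> = ?x + 2 * pi * of_int 0
        + 2 * pi * (phase_error (m mod k) (n - 1) - phase_error (m mod k) n)"
    proof -
      have "?x = - (2 * pi * c)" by (simp add: c_def)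
      then show ?thesis by (simp only: distrib_left)
    qed
    finally have "2 * pi * (phase (h (m, n)) - phase (m, n)) = ?x + 2 * pi * of_int 0
        + 2 * pi * (phase_error (m mod k) (n - 1) - phase_error (m mod k) n)" .
    then show "\<exists>m' n'. n \<le> Suc n' \<and> (\<exists>j::int. 2 * pi * (phase (h (m, n)) - phase (m, n))
      = ?x + 2 * pi * of_int j + 2 * pi * (phase_error (m' mod k) n' - phase_error (m mod k) n))"
      using n by (intro exI[of _ m] exI[of _ "n - 1"] conjI exI[of _ "0 :: int"]) simp_all
  qed
  note * = conj_compact[OF T2_bounded_ops norm_twist_le twist_periodic[OF h] lim
      conj_compression[of mult_z2, OF M h, folded T2_def]]
  show "(\<lambda>f\<in>S 0. V (T2 k \<epsilon> (U f)) - cscale (cis ?x) (T2 k \<epsilon> f)) \<in> compact_ops (S 0) (S 0)"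
    by (rule *(1))
  show "(\<lambda>f\<in>S 0. V (adj (S 0) (S 0) (T2 k \<epsilon>) (U f)) - cscale (cis (2 * pi * F / (real k * (1 - F)))) (adj (S 0) (S 0) (T2 k \<epsilon>) f))
      \<in> compact_ops (S 0) (S 0)"
    using *(2) unfolding cis_cnj minus_minus .
qed

lemma monodromy_eq: "monodromy k \<epsilon> = U"
  unfolding monodromy_def by (rule parallel_transport_eq)

text \<open>Checked on generators: the identity is fixed, each compressed shift becomes a multiple
  of itself plus a compact operator, and the compact operators form an ideal.\<close>

lemma toeplitz_conj_invariant:
  assumes A: "A \<in> toeplitz_algebra k \<epsilon>"
  shows "compose (S 0) V (compose (S 0) A U) \<in> toeplitz_algebra k \<epsilon>"
proof -
  note S0 = closed_csubspace_I_perp[of k \<epsilon> 0]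
  define G where "G = {(\<lambda>f\<in>S 0. f), T1 k \<epsilon>, T2 k \<epsilon>} \<union> compact_ops (S 0) (S 0)"
  have T: "toeplitz_algebra k \<epsilon> = cstar_subalgebra (S 0) hull G"
    unfolding toeplitz_algebra_def G_def Let_def ..
  have G: "G \<subseteq> bounded_ops (S 0) (S 0)"
    using T1_bounded_ops T2_bounded_ops id_bounded_ops[OF S0] unfolding G_def compact_ops_def by blast
  note D = cstar_subalgebraD[OF cstar_subalgebra_hull[OF S0 G]]
  note VD = bounded_opsD[OF V_bounded_ops]
  have shift: "compose (S 0) V (compose (S 0) B U) \<in> cstar_subalgebra (S 0) hull G"
    if "B \<in> G" "(\<lambda>f\<in>S 0. V (B (U f)) - cscale c (B f)) \<in> compact_ops (S 0) (S 0)" for B c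
  proof -
    have "(\<lambda>f\<in>S 0. cscale c (B f)) \<in> cstar_subalgebra (S 0) hull G"
      by (rule D(3)[OF hull_inc[OF that(1)]])
    moreover have "(\<lambda>f\<in>S 0. V (B (U f)) - cscale c (B f)) \<in> cstar_subalgebra (S 0) hull G"
      using that(2) by (intro hull_inc) (simp add: G_def)
    ultimately have "(\<lambda>f\<in>S 0. (\<lambda>f\<in>S 0. cscale c (B f)) f + (\<lambda>f\<in>S 0. V (B (U f)) - cscale c (B f)) f)
        \<in> cstar_subalgebra (S 0) hull G" by (rule D(2))
    moreover have "(\<lambda>f\<in>S 0. (\<lambda>f\<in>S 0. cscale c (B f)) f + (\<lambda>f\<in>S 0. V (B (U f)) - cscale c (B f)) f)
        = compose (S 0) V (compose (S 0) B U)"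
      unfolding compose_def by (rule restrict_ext) simp
    ultimately show ?thesis by simp
  qed
  have "compose (S 0) V (compose (S 0) B U) \<in> cstar_subalgebra (S 0) hull G" if "B \<in> G" for B
  proof -
    have "B = (\<lambda>f\<in>S 0. f) \<or> B = T1 k \<epsilon> \<or> B = T2 k \<epsilon> \<or> B \<in> compact_ops (S 0) (S 0)"
      using that by (simp only: G_def Un_iff insert_iff empty_iff simp_thms disj_assoc)
    then consider (1) "B = (\<lambda>f\<in>S 0. f)" | (2) "B = T1 k \<epsilon>" | (3) "B = T2 k \<epsilon>"
      | (4) "B \<in> compact_ops (S 0) (S 0)" by (elim disjE)
    then show ?thesis
    proof cases
      case 1
      have "compose (S 0) V (compose (S 0) B U) = B"
        unfolding 1 compose_def
        by (rule restrict_ext) (simp add: transport_2pi_in_S transport_transport)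
      then show ?thesis using that by (simp add: hull_inc)
    next
      case 2
      show ?thesis by (rule shift[OF that]) (unfold 2, rule conj_T1_compact(1))
    next
      case 3
      show ?thesis by (rule shift[OF that]) (unfold 3, rule conj_T2_compact(1))
    next
      case 4
      have "compose (S 0) V (compose (S 0) B U) \<in> compact_ops (S 0) (S 0)"
        by (rule compact_ops_comp_left[OF V_bounded_ops compact_ops_comp_right[OF 4 U_bounded_ops S0 S0] S0 S0])
      then show ?thesis by (intro hull_inc) (simp add: G_def)
    qed
  qed
  from conj_hull_subset[OF S0 unitary_U G this[folded adj_U] A[unfolded T]]
  show ?thesis unfolding adj_U T .
qed

end

theorem theorem2p8:
  fixes k :: nat and \<epsilon> F :: real and S :: "da set"
    and U U' T\<^sub>1 T\<^sub>2 T\<^sub>1' T\<^sub>2' :: "da \<Rightarrow> da"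
  assumes "1 \<le> k" and "0 < \<epsilon>" and "\<epsilon> < 1"
    and "F = \<epsilon> powr (2 / real k)"
    and "S = I_perp k \<epsilon> 0"
    and "U = monodromy k \<epsilon>" and "U' = adj S S U"
    and "T\<^sub>1 = T1 k \<epsilon>" and "T\<^sub>1' = adj S S T\<^sub>1"
    and "T\<^sub>2 = T2 k \<epsilon>" and "T\<^sub>2' = adj S S T\<^sub>2"
  shows "unitary_op S S U \<and>
    (\<forall>A\<in>toeplitz_algebra k \<epsilon>. compose S U' (compose S A U) \<in> toeplitz_algebra k \<epsilon>) \<and>
    (\<lambda>f\<in>S. U' (T\<^sub>1 (U f)) - cscale (cis (2 * pi / real k)) (T\<^sub>1 f)) \<in> compact_ops S S \<and>
    (\<lambda>f\<in>S. U' (T\<^sub>1' (U f)) - cscale (cis (- (2 * pi / real k))) (T\<^sub>1' f)) \<in> compact_ops S S \<and>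
    (\<lambda>f\<in>S. U' (T\<^sub>2 (U f)) - cscale (cis (- (2 * pi * F / (real k * (1 - F))))) (T\<^sub>2 f))
      \<in> compact_ops S S \<and>
    (\<lambda>f\<in>S. U' (T\<^sub>2' (U f)) - cscale (cis (2 * pi * F / (real k * (1 - F)))) (T\<^sub>2' f))
      \<in> compact_ops S S"
proof -
  interpret I: da_ideal k \<epsilon> by standard (use assms(1-3) in auto)
  have F: "F = I.F" by (simp only: assms(4) I.F_def)
  have U: "U = I.U" by (simp only: assms(6) I.monodromy_eq)
  have U': "U' = I.V" by (simp only: assms(5,7) U I.adj_U)
  show ?thesis
    unfolding assms(9,11) unfolding assms(5,8,10) U U' F
    using I.unitary_U I.toeplitz_conj_invariant I.conj_T1_compact I.conj_T2_compact by blast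
qed

end
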